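(* Let $d\in\mathbb N$, $$p\in\Bigl(2-\frac{2}{3d+2},\,2+\frac2d\Bigr),\qquad p'=\frac{p}{p-1},\qquad \bar q:=p\,\frac{4d+2}{d(p+2)}.$$ Then for every $q\in(\max\{p,p'\},\bar q)$ there exists $C=C(d,p,q)>0$ such that the following holds. If $f\in \mathrm L^2(\mathbb R^{1+2d})$ with $\nabla_v f\in \mathrm L^p(\mathbb R^{1+2d})$ satisfies $(\partial_t+v\cdot\nabla_x)f=\nabla_v\cdot S_0$ in the sense of distributions for some $S_0\in \mathrm L^{p'}(\mathbb R^{1+2d};\mathbb R^d)$, then $$\|f\|_{\dot B^{s(q)}_{q\infty,x}\mathrm L^q_{t,v}}\le C\,\|\nabla_v f\|_{\mathrm L^p(\mathbb R^{1+2d})}^{\alpha(q)}\,\|S_0\|_{\mathrm L^{p'}(\mathbb R^{1+2d})}^{1-\alpha(q)},$$ where $$s(q)=\frac{p(4d+2)-qd(p+2)}{q\,[d(p-2)+2p+2]},\qquad \alpha(q)=\frac{3d+1}{4d+2}-\frac{d-1}{4d+2}s(q)=\frac{q[p(1+d)-d+1]-(d-1)p}{q\,[d(p-2)+2p+2]}.$$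
   Context: Points of $\mathbb R^{1+2d}$ are written $(t,x,v)$. For $s\in(0,1)$ and $q\in[1,\infty]$, the homogeneous Besov seminorm in $x$ is $$\|f\|_{\dot B^{s}_{q\infty,x}\mathrm L^q_{t,v}}:=\sup_{h\in\mathbb R^d\setminus\{0\}}\frac{\|\Delta_x^hf\|_{\mathrm L^q(\mathbb R^{1+2d})}}{|h|^s},\qquad [\Delta_x^hf](t,x,v):=f(t,x+h,v)-f(t,x,v).$$ *)

theory Defs
  imports "HOL-Analysis.Analysis"
begin

text \<open>Points of R^(1+2d) are triples (t,x,v) with t real and x, v in real^'d,
  where d = CARD('d).\<close>
type_synonym ('d) pt = "real \<times> (real^'d) \<times> (real^'d)"

fun Ck :: "nat \<Rightarrow> ('a::real_normed_vector \<Rightarrow> real) \<Rightarrow> bool" where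
  "Ck 0 \<phi> = continuous_on UNIV \<phi>"
| "Ck (Suc k) \<phi> = (continuous_on UNIV \<phi> \<and> (\<forall>z. \<phi> differentiable (at z)) \<and>
      (\<forall>u. Ck k (\<lambda>z. frechet_derivative \<phi> (at z) u)))"

definition smooth :: "('a::real_normed_vector \<Rightarrow> real) \<Rightarrow> bool" where
  "smooth \<phi> \<longleftrightarrow> (\<forall>k. Ck k \<phi>)"

definition test_fun :: "('a::euclidean_space \<Rightarrow> real) \<Rightarrow> bool" where
  "test_fun \<phi> \<longleftrightarrow> smooth \<phi> \<and> compact (closure {z. \<phi> z \<noteq> 0})"

definition Lp_norm :: "real \<Rightarrow> ('a::euclidean_space \<Rightarrow> 'b::real_normed_vector) \<Rightarrow> ennreal" where
  "Lp_norm p g = (let I = (\<integral>\<^sup>+ z. ennreal (norm (g z) powr p) \<partial>lebesgue) in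
      if I = \<infinity> then \<infinity> else ennreal ((enn2real I) powr (1 / p)))"

definition in_Lp :: "real \<Rightarrow> ('a::euclidean_space \<Rightarrow> 'b::{real_normed_vector, second_countable_topology}) \<Rightarrow> bool" where
  "in_Lp p g \<longleftrightarrow> g \<in> borel_measurable lebesgue \<and> Lp_norm p g < \<infinity>"

definition Delta_x :: "real^'d::finite \<Rightarrow> ('d pt \<Rightarrow> real) \<Rightarrow> 'd pt \<Rightarrow> real" where
  "Delta_x h f = (\<lambda>(t, x, v). f (t, x + h, v) - f (t, x, v))"

definition besov_x :: "real \<Rightarrow> real \<Rightarrow> ('d::finite pt \<Rightarrow> real) \<Rightarrow> ennreal" where
  "besov_x s q f = (SUP h \<in> UNIV - {0}. Lp_norm q (Delta_x h f) / ennreal (norm h powr s))"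

definition weak_grad_v :: "('d::finite pt \<Rightarrow> real) \<Rightarrow> ('d pt \<Rightarrow> real^'d) \<Rightarrow> bool" where
  "weak_grad_v f G \<longleftrightarrow> (\<forall>\<phi> e. test_fun \<phi> \<longrightarrow>
     (\<integral>z. f z * frechet_derivative \<phi> (at z) (0, 0, e) \<partial>lebesgue)
       = - (\<integral>z. (G z \<bullet> e) * \<phi> z \<partial>lebesgue))"

definition kinetic_eq :: "('d::finite pt \<Rightarrow> real) \<Rightarrow> ('d pt \<Rightarrow> real^'d) \<Rightarrow> bool" where
  "kinetic_eq f S \<longleftrightarrow> (\<forall>\<phi>. test_fun \<phi> \<longrightarrow>
     (\<integral>z. f z * frechet_derivative \<phi> (at z) (1, snd (snd z), 0) \<partial>lebesgue)
       = (\<integral>z. frechet_derivative \<phi> (at z) (0, 0, S z) \<partial>lebesgue))"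

end

theory Submission
  imports Defs
begin

text \<open>
  Average \<open>f\<close> against a bump in kinetic coordinates around \<open>z\<close>, at time scale \<open>\<tau> s\<close> and velocity scale \<open>\<nu> s\<close>
  with \<open>\<tau> s * \<nu> s = exp s\<close>. As \<open>s\<close> runs from minus to plus infinity the average moves from a multiple of
  \<open>f z\<close> to 0. Its \<open>s\<close>-derivative tests \<open>f\<close> against the generator of the dilations applied to the bump;
  this function splits explicitly as \<open>Y b + div\<^sub>v a\<close>, where \<open>Y\<close> is the transport field and \<open>a\<close>, \<open>b\<close> have compact
  support, so the two hypotheses on \<open>f\<close> turn it into averages of \<open>G\<close> and \<open>S\<close>. An increment by \<open>h\<close> in \<open>x\<close>
  gains a factor \<open>min 1 (norm h * exp (- s))\<close>, the averages map \<open>L\<^sup>p\<close> to \<open>L\<^sup>q\<close>, and the exponents \<open>\<beta>\<close>, \<open>\<gamma>\<close> of the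
  scales are chosen so that both integrals over \<open>s\<close> scale like \<open>norm h powr s(q)\<close>. The remaining parameter
  \<open>k\<close>, which trades time scale for velocity scale, is optimised to obtain the product of norms.
\<close>

section \<open>Smooth bump functions\<close>

text \<open>The splitting of the generator rests on a commutator: the \<open>x\<close>-gradient
  equals \<open>grad_v Y - Y grad_v\<close>. Thus every \<open>x\<close>-derivative of the bump,
  which neither hypothesis on \<open>f\<close> controls, is traded for a \<open>v\<close>-derivative
  and a derivative along \<open>Y\<close>. The bound for the increment of the difference of two
  averages is uniform in both scales, so only the two limits remain. At large scales
  \<open>f\<close> in L^2 suffices, because the cell volume tends to infinity. At small scales the
  cells are anisotropic and sheared by a velocity-dependent drift; instead of differentiating
  pointwise, the averages are paired with continuous compactly supported functions, on which the
  adjoint averages converge uniformly, and the pointwise bound is recovered almost everywhere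
  afterwards. Asking both scale integrals to have the same exponent, together with
  \<open>\<beta> + \<gamma> = 1\<close>, is a linear system for \<open>\<beta>\<close> and
  \<open>\<gamma>\<close>; after multiplication by \<open>p\<close> its determinant is the
  denominator \<open>d * (p - 2) + 2 * p + 2\<close>. All constants are independent of
  \<open>k\<close>, so \<open>k\<close> may be chosen after them and may depend on the
  norms.\<close>

lemma Ck_continuous: "Ck k f \<Longrightarrow> continuous_on UNIV f"
  by (cases k) auto

lemma Ck_Suc_imp: "Ck (Suc k) f \<Longrightarrow> Ck k f"
proof (induction k arbitrary: f)
  case (Suc k)
  then show ?case by (metis Ck.simps(2))
qed auto

lemma Ck_has_derivative:
  "Ck (Suc k) f \<Longrightarrow> (f has_derivative frechet_derivative f (at z)) (at z)"
  by (simp flip: frechet_derivative_works)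

lemma Ck_const: "Ck k (\<lambda>z. c)"
  by (induction k arbitrary: c) auto

lemma Ck_bounded_linear:
  assumes "bounded_linear l" shows "Ck k l"
proof (cases k)
  case (Suc m)
  have "frechet_derivative l (at z) = l" for z
    using assms bounded_linear_imp_has_derivative frechet_derivative_at by metis
  then show ?thesis
    using assms Suc by (auto simp: Ck_const linear_continuous_on bounded_linear_imp_differentiable)
qed (use assms in \<open>auto simp: linear_continuous_on\<close>)

lemma Ck_add:
  assumes "Ck k f" "Ck k g" shows "Ck k (\<lambda>z. f z + g z)"
  using assms
proof (induction k arbitrary: f g)
  case (Suc k)
  have "frechet_derivative (\<lambda>z. f z + g z) (at z) u = frechet_derivative f (at z) u + frechet_derivative g (at z) u" for z u
  proof -
    have "((\<lambda>z. f z + g z) has_derivative (\<lambda>u. frechet_derivative f (at z) u + frechet_derivative g (at z) u)) (at z)"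
      using Suc.prems by (auto intro!: has_derivative_add simp flip: frechet_derivative_works)
    from frechet_derivative_at[OF this] show ?thesis by metis
  qed
  then show ?case using Suc by (auto intro!: continuous_intros differentiable_add)
qed (auto intro!: continuous_intros)

lemma Ck_mult:
  assumes "Ck k f" "Ck k g" shows "Ck k (\<lambda>z. f z * g z)"
  using assms
proof (induction k arbitrary: f g)
  case (Suc k)
  have "frechet_derivative (\<lambda>z. f z * g z) (at z) u = f z * frechet_derivative g (at z) u + frechet_derivative f (at z) u * g z" for z u
  proof -
    have "((\<lambda>z. f z * g z) has_derivative (\<lambda>u. f z * frechet_derivative g (at z) u + frechet_derivative f (at z) u * g z)) (at z)"
      using Suc.prems by (auto intro!: has_derivative_mult simp flip: frechet_derivative_works)
    from frechet_derivative_at[OF this] show ?thesis by metis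
  qed
  then show ?case using Suc
    by (auto intro!: continuous_intros differentiable_mult Ck_add Suc.IH intro: Ck_Suc_imp)
qed (auto intro!: continuous_intros)

lemma Ck_sum:
  assumes "\<And>i. i \<in> I \<Longrightarrow> Ck k (f i)" shows "Ck k (\<lambda>z. \<Sum>i\<in>I. f i z)"
  using assms by (induction I rule: infinite_finite_induct) (auto intro: Ck_const Ck_add)

lemma Ck_cmult: "Ck k f \<Longrightarrow> Ck k (\<lambda>z. c * f z)"
  by (intro Ck_mult Ck_const)

lemma Ck_diff: "Ck k f \<Longrightarrow> Ck k g \<Longrightarrow> Ck k (\<lambda>z. f z - g z)"
  using Ck_add[OF _ Ck_cmult[of k g "-1"], of f] by simp

text \<open>For fixed \<open>z\<close> the kinetic coordinates of \<open>w\<close> are affine in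
  \<open>w\<close>, so this is the chain rule that the rescaled kernels call for. Directional
  derivatives of the composite have the same shape with another function in place of
  \<open>f\<close>, which feeds the induction.\<close>

lemma Ck_affine:
  fixes f :: "'b::real_normed_vector \<Rightarrow> real"
  assumes "Ck k f" and L: "bounded_linear L" 
  shows "Ck k (\<lambda>z. f (L z + a))"
  using assms(1)
proof (induction k arbitrary: f)
  case 0
  have "continuous_on UNIV (\<lambda>z. L z + a)"
    using L by (intro continuous_intros linear_continuous_on)
  with 0 show ?case by (auto intro: continuous_on_compose2)
next
  case (Suc k)
  have D: "((\<lambda>z. f (L z + a)) has_derivative (\<lambda>u. frechet_derivative f (at (L z + a)) (L u))) (at z)" for z
  proof (rule has_derivative_compose[of "\<lambda>z. L z + a" L _ _ f])
    show "((\<lambda>z. L z + a) has_derivative L) (at z)"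
      using L by (auto intro!: derivative_eq_intros bounded_linear_imp_has_derivative)
    show "(f has_derivative frechet_derivative f (at (L z + a))) (at (L z + a))"
      using Suc.prems by (auto simp flip: frechet_derivative_works)
  qed
  have E: "frechet_derivative (\<lambda>z. f (L z + a)) (at z) = (\<lambda>u. frechet_derivative f (at (L z + a)) (L u))" for z
    using frechet_derivative_at[OF D[of z]] by simp
  have "continuous_on UNIV (\<lambda>z. f (L z + a))"
    by (intro continuous_at_imp_continuous_on ballI has_derivative_continuous[OF D])
  moreover have "Ck k (\<lambda>z. frechet_derivative f (at (L z + a)) (L u))" for u
    using Suc.IH[of "\<lambda>y. frechet_derivative f (at y) (L u)"] Suc.prems by auto
  ultimately show ?case using D E by (auto simp: differentiable_def)
qed

section \<open>Flat profiles and the radial bumps built from them\<close>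

definition bump_profile :: "nat \<Rightarrow> real \<Rightarrow> real" where
  "bump_profile n u = (if u \<le> 0 then 0 else (1 / u) ^ n * exp (- 1 / u))"

lemma bump_profile_tendsto_0: "(bump_profile n \<longlongrightarrow> 0) (at_right 0)"
proof -
  have "((\<lambda>x::real. x ^ n / exp x) \<longlongrightarrow> 0) at_top" by (rule tendsto_power_div_exp_0)
  then have "((\<lambda>u::real. (inverse u) ^ n / exp (inverse u)) \<longlongrightarrow> 0) (at_right 0)"
    by (rule filterlim_compose) (rule filterlim_inverse_at_top_right)
  then show ?thesis
  proof (rule Lim_transform_eventually)
    show "\<forall>\<^sub>F u in at_right 0. inverse u ^ n / exp (inverse u) = bump_profile n u"
      by (auto simp: bump_profile_def eventually_at_filter exp_minus field_simps)
  qed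
qed

text \<open>The exponent \<open>n\<close> is a parameter because the family is closed under
  differentiation; smoothness of all members then needs a single induction. At 0 the right
  difference quotient of \<open>bump_profile n\<close> is \<open>bump_profile (n+1)\<close>, which
  tends to 0.\<close>

lemma bump_profile_DERIV:
  "(bump_profile n has_real_derivative bump_profile (n+2) u - n * bump_profile (n+1) u) (at u)"
proof -
  consider "u < 0" | "u > 0" | "u = 0" by linarith
  then show ?thesis
  proof cases
    case 1
    have "((\<lambda>u. 0) has_real_derivative 0) (at u)" by simp
    then have "(bump_profile n has_real_derivative 0) (at u)"
      by (rule DERIV_cong_ev[THEN iffD1, rotated -1])
         (use 1 in \<open>auto simp: bump_profile_def intro!: eventually_mono[OF eventually_nhds_in_open[of "{..<0}" u]]\<close>)
    then show ?thesis using 1 by (simp add: bump_profile_def)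
  next
    case 2
    have "((\<lambda>u. (1 / u) ^ n * exp (- 1 / u)) has_real_derivative bump_profile (n+2) u - n * bump_profile (n+1) u) (at u)"
    proof -
      have D: "((\<lambda>u. 1 / u) has_real_derivative (- ((1 / u)^2))) (at u)"
        using 2 by (auto intro!: derivative_eq_intros simp: power2_eq_square)
      have "((\<lambda>u. (1 / u) ^ n * exp (- (1 / u))) has_real_derivative
          (of_nat n * (1 / u) ^ (n - Suc 0) * (- ((1 / u)^2))) * exp (- (1 / u))
          + (1 / u) ^ n * (exp (- (1 / u)) * (1 / u)^2)) (at u)"
        using 2 by (auto intro!: derivative_eq_intros simp: power2_eq_square)
      moreover have "(of_nat n * (1 / u) ^ (n - Suc 0) * (- ((1 / u)^2))) * exp (- (1 / u))
          + (1 / u) ^ n * (exp (- (1 / u)) * (1 / u)^2) = bump_profile (n+2) u - n * bump_profile (n+1) u"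
        using 2 by (cases n) (simp_all add: bump_profile_def power2_eq_square algebra_simps add_divide_distrib)
      ultimately show ?thesis by simp
    qed
    then show ?thesis
      by (rule DERIV_cong_ev[THEN iffD1, rotated -1])
         (use 2 in \<open>auto simp: bump_profile_def intro!: eventually_mono[OF eventually_nhds_in_open[of "{0<..}" u]]\<close>)
  next
    case 3
    have "((\<lambda>y. bump_profile n y / y) \<longlongrightarrow> 0) (at_right 0)"
      using bump_profile_tendsto_0[of "n+1"]
      by (rule Lim_transform_eventually) (auto simp: bump_profile_def eventually_at_filter)
    moreover have "((\<lambda>y. bump_profile n y / y) \<longlongrightarrow> 0) (at_left 0)"
      by (rule Lim_transform_eventually[of "\<lambda>_. 0"]) (auto simp: bump_profile_def eventually_at_filter)
    ultimately have "((\<lambda>y. bump_profile n y / y) \<longlongrightarrow> 0) (at 0)"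
      by (rule filterlim_split_at[rotated])
    then show ?thesis using 3 by (simp add: bump_profile_def has_field_derivative_iff)
  qed
qed

definition bump :: "nat \<Rightarrow> 'a::euclidean_space \<Rightarrow> real" where
  "bump n y = bump_profile n (1 - y \<bullet> y)"

text \<open>The derivative of \<open>bump_profile n\<close> at \<open>1 - y \<bullet> y\<close>; the
  gradient of \<open>bump n\<close> at \<open>y\<close> is \<open>- 2 * bump' n y\<close> times
  \<open>y\<close>.\<close>

definition bump' :: "nat \<Rightarrow> 'a::euclidean_space \<Rightarrow> real" where
  "bump' n y = bump (n+2) y - n * bump (n+1) y"

lemma bump_has_derivative:
  "(bump n has_derivative (\<lambda>u. bump' n y * (- 2 * (y \<bullet> u)))) (at y)"
proof -
  have D: "((\<lambda>y. 1 - y \<bullet> y) has_derivative (\<lambda>u. - 2 * (y \<bullet> u))) (at y)"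
    by (auto intro!: derivative_eq_intros simp: inner_commute)
  have "((\<lambda>y. bump_profile n (1 - y \<bullet> y)) has_derivative
      (\<lambda>u. (- 2 * (y \<bullet> u)) * (bump_profile (n+2) (1 - y \<bullet> y) - n * bump_profile (n+1) (1 - y \<bullet> y)))) (at y)"
    using has_derivative_compose[OF D bump_profile_DERIV[unfolded has_field_derivative_def]]
    by (simp add: mult.commute)
  then show ?thesis by (simp add: bump_def[abs_def] bump'_def mult.commute)
qed

lemma Ck_inner_right: "Ck k (\<lambda>y::'a::euclidean_space. y \<bullet> u)"
  by (rule Ck_bounded_linear) (rule bounded_linear_inner_left)

lemma continuous_on_bump: "continuous_on A (bump n)"
  by (intro continuous_at_imp_continuous_on ballI has_derivative_continuous[OF bump_has_derivative])

lemma Ck_bump: "Ck k (bump n :: 'a::euclidean_space \<Rightarrow> real)"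
proof (induction k arbitrary: n)
  case (Suc k)
  have "frechet_derivative (bump n) (at y) u = (bump (n+2) y - n * bump (n+1) y) * (-2 * (y \<bullet> u))" for y u :: 'a
    using frechet_derivative_at[OF bump_has_derivative[of n y]] by (metis bump'_def)
  moreover have "Ck k (\<lambda>y::'a. (bump (n+2) y - n * bump (n+1) y) * (-2 * (y \<bullet> u)))" for u
    by (intro Ck_mult Ck_diff Ck_const Ck_inner_right Suc.IH)
  moreover have "bump n differentiable (at y)" for y :: 'a
    using bump_has_derivative differentiable_def by blast
  ultimately show ?case by (simp add: continuous_on_bump)
qed (simp add: continuous_on_bump)

lemma bump_eq_0: "norm y \<ge> 1 \<Longrightarrow> bump n y = 0"
  by (simp add: bump_def bump_profile_def dot_square_norm)

lemma bump_0_nonneg: "bump 0 y \<ge> 0"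
  by (simp add: bump_def bump_profile_def)

lemma bump_0_le_1: "bump 0 y \<le> 1"
  by (simp add: bump_def bump_profile_def)

text \<open>\<open>Ck\<close> gives continuity of each directional derivative separately, so a bound
  for the operator norm is assembled from compactness bounds in the basis directions. One constant
  serves for size and slope, as both enter the kernel estimates.\<close>

lemma C1_compact_support_Lipschitz:
  fixes f :: "'a::euclidean_space \<Rightarrow> real"
  assumes "Ck (Suc 0) f" and supp: "\<And>y. norm y > 1 \<Longrightarrow> f y = 0"
  obtains K where "K \<ge> 0" "\<And>y y'. \<bar>f y - f y'\<bar> \<le> K * norm (y - y')" "\<And>y. \<bar>f y\<bar> \<le> K"
proof -
  have diff: "f differentiable (at z)" for z using assms by auto
  have D: "(f has_derivative frechet_derivative f (at z)) (at z)" for z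
    using diff frechet_derivative_works by blast
  have D0: "frechet_derivative f (at z) = (\<lambda>_. 0)" if "norm z > 1" for z
  proof -
    have "open (- cball (0::'a) 1)" by auto
    then have "(f has_derivative (\<lambda>_. 0)) (at z)"
      by (rule has_derivative_transform_within_open[OF has_derivative_const[of 0]])
         (use that supp in auto)
    then show ?thesis using frechet_derivative_at by metis
  qed
  have "\<exists>K. \<forall>z. \<bar>frechet_derivative f (at z) u\<bar> \<le> K" for u
  proof -
    have "compact ((\<lambda>z. frechet_derivative f (at z) u) ` cball 0 1)"
      using assms(1) by (intro compact_continuous_image[OF continuous_on_subset[OF _ subset_UNIV]]) simp_all
    then obtain K where "\<forall>z\<in>cball 0 1. \<bar>frechet_derivative f (at z) u\<bar> \<le> K"
      by (auto dest!: compact_imp_bounded simp: bounded_iff)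
    then have "\<bar>frechet_derivative f (at z) u\<bar> \<le> max K 0" for z
      by (cases "norm z \<le> 1") (use D0[of z] in \<open>auto simp: le_max_iff_disj\<close>)
    then show ?thesis by blast
  qed
  then obtain K where K: "\<And>u z. \<bar>frechet_derivative f (at z) u\<bar> \<le> K u" by metis
  define B where "B = (\<Sum>b\<in>Basis. \<bar>K b\<bar>)"
  have B0: "0 \<le> B" by (simp add: B_def sum_nonneg)
  have on: "onorm (frechet_derivative f (at z)) \<le> B" for z
  proof (rule onorm_bound[OF B0])
    fix u
    interpret linear "frechet_derivative f (at z)" using linear_frechet_derivative[OF diff] .
    have "frechet_derivative f (at z) u = frechet_derivative f (at z) (\<Sum>b\<in>Basis. (u \<bullet> b) *\<^sub>R b)"
      by (simp add: euclidean_representation)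
    also have "\<dots> = (\<Sum>b\<in>Basis. (u \<bullet> b) * frechet_derivative f (at z) b)"
      by (simp add: sum scale)
    also have "norm \<dots> \<le> (\<Sum>b\<in>Basis. norm u * \<bar>K b\<bar>)"
      using K by (intro sum_norm_le) (auto simp: abs_mult Basis_le_norm intro!: mult_mono order_trans[OF K])
    finally show "norm (frechet_derivative f (at z) u) \<le> B * norm u"
      by (simp add: B_def sum_distrib_left mult.commute)
  qed
  have lip: "\<bar>f y - f y'\<bar> \<le> B * norm (y - y')" for y y'
    using differentiable_bound[of UNIV f "\<lambda>z. frechet_derivative f (at z)" B y y'] D on
    by (auto simp: has_derivative_at_withinI)
  have "compact (f ` cball 0 1)"
    using Ck_continuous[OF assms(1)]
    by (intro compact_continuous_image[OF continuous_on_subset[OF _ subset_UNIV]]) simp_all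
  then obtain A where A: "\<forall>z\<in>cball 0 1. \<bar>f z\<bar> \<le> A"
    by (auto dest!: compact_imp_bounded simp: bounded_iff)
  have "\<bar>f y\<bar> \<le> max A B" for y
    by (cases "norm y \<le> 1") (use A B0 supp[of y] in \<open>auto simp: le_max_iff_disj\<close>)
  moreover have "\<bar>f y - f y'\<bar> \<le> max A B * norm (y - y')" for y y'
    by (rule order_trans[OF lip]) (auto intro: mult_right_mono)
  ultimately show thesis using that[of "max A B"] B0 by auto
qed

section \<open>Powers of extended nonnegative reals\<close>

text \<open>Infinity is treated apart because \<open>enn2real\<close> sends it to 0, which would
  destroy monotonicity. With this convention \<open>Lp_norm\<close> is the power
  \<open>1 / p\<close> of an integral of powers \<open>p\<close>.\<close>

definition epowr :: "ennreal \<Rightarrow> real \<Rightarrow> ennreal" where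
  "epowr x r = (if x = \<infinity> then \<infinity> else ennreal (enn2real x powr r))"

abbreviation nrm :: "('a \<Rightarrow> 'b::real_normed_vector) \<Rightarrow> 'a \<Rightarrow> ennreal" where
  "nrm f \<equiv> \<lambda>x. ennreal (norm (f x))"

abbreviation epow_int :: "real \<Rightarrow> ('a::euclidean_space \<Rightarrow> ennreal) \<Rightarrow> ennreal" where
  "epow_int q F \<equiv> \<integral>\<^sup>+x. epowr (F x) q \<partial>lborel"

lemma epowr_ennreal [simp]: "x \<ge> 0 \<Longrightarrow> epowr (ennreal x) r = ennreal (x powr r)"
  by (simp add: epowr_def)

lemma epowr_top [simp]: "epowr top r = top" "epowr \<infinity> r = \<infinity>"
  by (simp_all add: epowr_def)

lemma epowr_0 [simp]: "epowr 0 r = 0"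
  by (simp add: epowr_def)

lemma epowr_mono: "x \<le> y \<Longrightarrow> r \<ge> 0 \<Longrightarrow> epowr x r \<le> epowr y r"
  by (cases x; cases y) (auto simp: powr_mono2 top_unique)

lemma epowr_measurable [measurable]:
  assumes [measurable]: "f \<in> borel_measurable M"
  shows "(\<lambda>x. epowr (f x) r) \<in> borel_measurable M"
proof -
  have [measurable]: "{x \<in> space M. f x = top} \<in> sets M"
    using measurable_sets[OF assms, of "{top}"] by (simp add: vimage_def Int_def conj_commute)
  show ?thesis unfolding epowr_def infinity_ennreal_def by (measurable; simp)
qed

lemma epowr_mult: "r > 0 \<Longrightarrow> x \<ge> 0 \<Longrightarrow> epowr (ennreal x * y) r = ennreal (x powr r) * epowr y r"
  by (cases y) (auto simp: powr_mult ennreal_mult'[symmetric] ennreal_mult_top ennreal_mult_eq_top_iff)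

lemma epowr_epowr: "r > 0 \<Longrightarrow> s > 0 \<Longrightarrow> epowr (epowr x r) s = epowr x (r * s)"
  by (cases x) (auto simp: powr_powr)

lemma epowr_one [simp]: "epowr x 1 = x"
  by (cases x) auto

lemma epowr_add: "r > 0 \<Longrightarrow> s > 0 \<Longrightarrow> epowr x (r + s) = epowr x r * epowr x s"
  by (cases x) (auto simp: powr_add ennreal_mult')

lemma epowr_le_iff_root: "r > 0 \<Longrightarrow> B \<ge> 0 \<Longrightarrow> epowr x r \<le> ennreal B \<Longrightarrow> x \<le> ennreal (B powr (1/r))"
  using epowr_mono[of "epowr x r" "ennreal B" "1/r"] by (simp add: epowr_epowr)

lemma epowr_add_le: "r > 0 \<Longrightarrow> epowr (x + y) r \<le> ennreal (2 powr r) * (epowr x r + epowr y r)"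
proof (cases "x \<le> y")
  case True
  assume r: "r > 0"
  have "epowr (x + y) r \<le> epowr (ennreal 2 * y) r"
    using True r by (intro epowr_mono) (auto simp: mult_2)
  also have "\<dots> = ennreal (2 powr r) * epowr y r" using r by (subst epowr_mult) auto
  finally show ?thesis by (rule order_trans) (auto intro: mult_left_mono)
next
  case False
  assume r: "r > 0"
  have "epowr (x + y) r \<le> epowr (ennreal 2 * x) r"
    using False r by (intro epowr_mono) (auto simp: mult_2)
  also have "\<dots> = ennreal (2 powr r) * epowr x r" using r by (subst epowr_mult) auto
  finally show ?thesis by (rule order_trans) (auto intro: mult_left_mono)
qed

text \<open>If \<open>x\<close> exceeds \<open>l\<close>, then \<open>(x / l) powr (q - 1)\<close>
  is at least 1 and may be inserted as a factor. This is Young's inequality without sharp constants;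
  optimising over \<open>l\<close> restores homogeneity.\<close>

lemma tangent_powr:
  fixes x l q :: real
  assumes "x \<ge> 0" "l > 0" "q \<ge> 1"
  shows "x \<le> l powr (1 - q) * x powr q + l"
proof (cases "x \<le> l")
  case False
  then have "x = l powr (1 - q) * l powr (q - 1) * x"
    using assms by (simp flip: powr_add)
  also have "\<dots> \<le> l powr (1 - q) * x powr (q - 1) * x"
    using False assms by (intro mult_right_mono mult_left_mono powr_mono2) auto
  also have "\<dots> = l powr (1 - q) * x powr q"
    using False assms powr_mult_base[of x "q - 1"] by (simp add: mult_ac)
  finally show ?thesis using assms by simp
qed (use assms in \<open>simp add: add_increasing\<close>)

lemma epowr_tangent:
  assumes "l > 0" "q \<ge> 1"
  shows "x \<le> ennreal (l powr (1 - q)) * epowr x q + ennreal l"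
  using assms by (cases x) (auto simp: tangent_powr ennreal_mult'[symmetric] ennreal_plus[symmetric] ennreal_mult_top simp del: ennreal_plus)

text \<open>Holder's inequality up to the constant \<open>2 powr q\<close>, which is all that is needed
  and follows from optimising the pointwise bound over \<open>l\<close>.\<close>

lemma epowr_nn_integral_le:
  assumes [measurable]: "w \<in> borel_measurable M" "h \<in> borel_measurable M"
    and q: "q \<ge> 1" and m: "(\<integral>\<^sup>+x. w x \<partial>M) \<le> ennreal m" "m > 0"
  shows "epowr (\<integral>\<^sup>+x. w x * h x \<partial>M) q \<le> ennreal (2 powr q * m powr (q - 1)) * (\<integral>\<^sup>+x. w x * epowr (h x) q \<partial>M)"
proof (cases "(\<integral>\<^sup>+x. w x * epowr (h x) q \<partial>M)")
  case (real X)
  have bd: "(\<integral>\<^sup>+x. w x * h x \<partial>M) \<le> ennreal (l powr (1 - q) * X + l * m)" if "l > 0" for l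
  proof -
    have "(\<integral>\<^sup>+x. w x * h x \<partial>M) \<le> (\<integral>\<^sup>+x. ennreal (l powr (1 - q)) * (w x * epowr (h x) q) + ennreal l * w x \<partial>M)"
    proof (intro nn_integral_mono)
      fix x
      have "w x * h x \<le> w x * (ennreal (l powr (1 - q)) * epowr (h x) q + ennreal l)"
        by (intro mult_left_mono epowr_tangent that q) auto
      then show "w x * h x \<le> ennreal (l powr (1 - q)) * (w x * epowr (h x) q) + ennreal l * w x"
        by (simp add: distrib_left mult_ac)
    qed
    also have "\<dots> = ennreal (l powr (1 - q)) * ennreal X + ennreal l * (\<integral>\<^sup>+x. w x \<partial>M)"
      by (simp add: nn_integral_add nn_integral_cmult real)
    also have "\<dots> \<le> ennreal (l powr (1 - q)) * ennreal X + ennreal l * ennreal m"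
      by (intro add_left_mono mult_left_mono m) auto
    also have "\<dots> = ennreal (l powr (1 - q) * X + l * m)"
      using real that m by (simp add: ennreal_mult'[symmetric] ennreal_plus[symmetric] del: ennreal_plus)
    finally show ?thesis .
  qed
  show ?thesis
  proof (cases "X = 0")
    case True
    have "(\<integral>\<^sup>+x. w x * h x \<partial>M) \<le> 0"
    \<comment> \<open>The optimal \<open>l\<close> would be 0, so \<open>l\<close> is sent to 0
      instead.\<close>
    proof (rule ennreal_le_epsilon)
      fix e :: real assume "e > 0"
      then show "(\<integral>\<^sup>+x. w x * h x \<partial>M) \<le> 0 + ennreal e"
        using bd[of "e / m"] True m by simp
    qed
    then show ?thesis by simp
  next
    case False
    \<comment> \<open>At this \<open>l\<close> the two terms \<open>l powr (1 - q) * X\<close> and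
      \<open>l * m\<close> coincide.\<close>
    define l where "l = (X / m) powr (1 / q)"
    have l: "l > 0" using real False m by (simp add: l_def)
    have lq: "l powr q = X / m" using real False m q by (simp add: l_def powr_powr)
    have "l powr (1 - q) * X + l * m = l / (l powr q) * X + l * m"
      using l by (simp add: powr_diff)
    also have "\<dots> = 2 * (l * m)"
      unfolding lq using real False m by simp
    finally have *: "(\<integral>\<^sup>+x. w x * h x \<partial>M) \<le> ennreal (2 * (l * m))" using bd[OF l] by simp
    have "epowr (\<integral>\<^sup>+x. w x * h x \<partial>M) q \<le> epowr (ennreal (2 * (l * m))) q"
      using * q by (intro epowr_mono) auto
    also have "\<dots> = ennreal (2 powr q * (X / m * m powr q))"
      using l m by (simp add: powr_mult lq)
    also have "X / m * m powr q = m powr (q - 1) * X" using m by (simp add: powr_diff)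
    finally show ?thesis using real by (simp add: ennreal_mult'[symmetric] mult_ac)
  qed
next
  case top
  then show ?thesis using m by (simp add: ennreal_mult_top)
qed

section \<open>Kinetic scalings and averages\<close>

lemma nn_integral_affine:
  fixes f :: "'a::euclidean_space \<Rightarrow> ennreal"
  assumes [measurable]: "f \<in> borel_measurable borel" and c: "c \<noteq> 0"
  shows "(\<integral>\<^sup>+x. f x \<partial>lborel) = ennreal (\<bar>c\<bar> ^ DIM('a)) * (\<integral>\<^sup>+x. f (t + c *\<^sub>R x) \<partial>lborel)"
  by (subst lborel_affine[OF c, of t])
     (simp add: nn_integral_density nn_integral_distr nn_integral_cmult)

text \<open>The variable \<open>x\<close> is put innermost, so that a shift of \<open>x\<close>
  depending on \<open>t\<close> and \<open>v\<close> can be removed while both are frozen.\<close>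

lemma nn_integral_lborel_triple:
  fixes f :: "'a::euclidean_space \<times> 'b::euclidean_space \<times> 'c::euclidean_space \<Rightarrow> ennreal"
  assumes [measurable]: "f \<in> borel_measurable borel"
  shows "(\<integral>\<^sup>+z. f z \<partial>lborel) = (\<integral>\<^sup>+t. \<integral>\<^sup>+v. \<integral>\<^sup>+x. f (t, x, v) \<partial>lborel \<partial>lborel \<partial>lborel)"
proof -
  have [measurable]: "f \<in> borel_measurable (borel \<Otimes>\<^sub>M (borel \<Otimes>\<^sub>M borel))"
    by (simp add: borel_prod)
  have "(\<integral>\<^sup>+z. f z \<partial>lborel) = (\<integral>\<^sup>+z. f z \<partial>(lborel \<Otimes>\<^sub>M (lborel \<Otimes>\<^sub>M lborel)))"
    by (simp add: lborel_prod)
  also have "\<dots> = (\<integral>\<^sup>+t. \<integral>\<^sup>+y. f (t, y) \<partial>(lborel \<Otimes>\<^sub>M lborel) \<partial>lborel)"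
    by (subst sigma_finite_measure.nn_integral_fst[symmetric])
       (auto simp: lborel_prod lborel.sigma_finite_measure_axioms)
  also have "\<dots> = (\<integral>\<^sup>+t. \<integral>\<^sup>+v. \<integral>\<^sup>+x. f (t, x, v) \<partial>lborel \<partial>lborel \<partial>lborel)"
  proof (intro nn_integral_cong)
    fix t :: 'a
    have [measurable]: "(\<lambda>y. f (t, y)) \<in> borel_measurable (lborel \<Otimes>\<^sub>M lborel)" by measurable
    show "(\<integral>\<^sup>+y. f (t, y) \<partial>(lborel \<Otimes>\<^sub>M lborel)) = (\<integral>\<^sup>+v. \<integral>\<^sup>+x. f (t, x, v) \<partial>lborel \<partial>lborel)"
      by (subst lborel_pair.nn_integral_snd) auto
  qed
  finally show ?thesis .
qed

text \<open>The map is triangular: for fixed \<open>t\<close> and \<open>v\<close> the variable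
  \<open>x\<close> is scaled and translated, so \<open>c\<close> leaves no trace in the Jacobian.
  The shift depends on both \<open>t\<close> and \<open>v\<close> because, when the base point of
  the kinetic coordinates is integrated, it contains the product of its time and its
  velocity.\<close>

lemma nn_integral_shear_affine:
  fixes g :: "real \<times> 'b::euclidean_space \<times> 'c::euclidean_space \<Rightarrow> ennreal" and c :: "real \<Rightarrow> 'c \<Rightarrow> 'b"
  assumes [measurable]: "g \<in> borel_measurable borel"
    and c: "continuous_on UNIV (\<lambda>y. c (fst y) (snd y))"
    and "r \<noteq> 0" "m \<noteq> 0" "n \<noteq> 0"
  shows "ennreal (\<bar>r\<bar> * \<bar>m\<bar> ^ DIM('b) * \<bar>n\<bar> ^ DIM('c)) *
      (\<integral>\<^sup>+z. g (a + r * fst z, c (fst z) (snd (snd z)) + m *\<^sub>R fst (snd z), b + n *\<^sub>R snd (snd z)) \<partial>lborel)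
    = (\<integral>\<^sup>+z. g z \<partial>lborel)"
proof -
  have cm: "(\<lambda>y. c (fst y) (snd y)) \<in> borel_measurable borel"
    using c by (rule borel_measurable_continuous_onI)
  have [measurable]: "(\<lambda>(t, v). c t v) \<in> borel_measurable (borel \<Otimes>\<^sub>M borel)"
    using cm by (simp add: borel_prod case_prod_beta)
  have [measurable]: "g \<in> borel_measurable (borel \<Otimes>\<^sub>M (borel \<Otimes>\<^sub>M borel))"
    by (simp add: borel_prod)
  let ?h = "\<lambda>z. g (a + r * fst z, c (fst z) (snd (snd z)) + m *\<^sub>R fst (snd z), b + n *\<^sub>R snd (snd z))"
  have "?h \<in> borel_measurable (borel \<Otimes>\<^sub>M (borel \<Otimes>\<^sub>M borel))" by measurable
  then have hm: "?h \<in> borel_measurable borel" by (simp add: borel_prod)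
  let ?r = "ennreal \<bar>r\<bar>" and ?m = "ennreal (\<bar>m\<bar> ^ DIM('b))" and ?n = "ennreal (\<bar>n\<bar> ^ DIM('c))"
  have "(\<integral>\<^sup>+z. g z \<partial>lborel) = (\<integral>\<^sup>+t. \<integral>\<^sup>+v. \<integral>\<^sup>+x. g (t, x, v) \<partial>lborel \<partial>lborel \<partial>lborel)"
    by (rule nn_integral_lborel_triple) auto
  also have "\<dots> = ?r * (\<integral>\<^sup>+t. \<integral>\<^sup>+v. \<integral>\<^sup>+x. g (a + r * t, x, v) \<partial>lborel \<partial>lborel \<partial>lborel)"
    by (rule nn_integral_real_affine) (auto simp: assms)
  also have "\<dots> = ?r * (\<integral>\<^sup>+t. ?n * (\<integral>\<^sup>+v. \<integral>\<^sup>+x. g (a + r * t, x, b + n *\<^sub>R v) \<partial>lborel \<partial>lborel) \<partial>lborel)"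
    by (intro arg_cong2[where f="(*)"] nn_integral_cong nn_integral_affine) (auto simp: assms)
  also have "\<dots> = ?r * (\<integral>\<^sup>+t. ?n * (\<integral>\<^sup>+v. ?m * (\<integral>\<^sup>+x. g (a + r * t, c t v + m *\<^sub>R x, b + n *\<^sub>R v) \<partial>lborel) \<partial>lborel) \<partial>lborel)"
    by (intro arg_cong2[where f="(*)"] nn_integral_cong nn_integral_affine refl) (auto simp: assms)
  also have "\<dots> = ?r * (?n * (?m * (\<integral>\<^sup>+t. \<integral>\<^sup>+v. \<integral>\<^sup>+x. g (a + r * t, c t v + m *\<^sub>R x, b + n *\<^sub>R v) \<partial>lborel \<partial>lborel \<partial>lborel)))"
    by (simp add: nn_integral_cmult)
  also have "\<dots> = ?r * (?n * (?m * (\<integral>\<^sup>+z. ?h z \<partial>lborel)))"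
    by (subst nn_integral_lborel_triple[OF hm]) simp
  finally show ?thesis by (simp add: ennreal_mult mult_ac)
qed

section \<open>Kinetic dilations and their Jacobian\<close>

locale kinetic_scaling =
  fixes k \<beta> \<gamma> :: real
  assumes \<beta>: "\<beta> > 0" and \<gamma>: "\<gamma> > 0" and \<beta>\<gamma>: "\<beta> + \<gamma> = 1"
begin

definition \<tau> :: "real \<Rightarrow> real" where "\<tau> s = exp (k + \<beta> * s)"
definition \<nu> :: "real \<Rightarrow> real" where "\<nu> s = exp (- k + \<gamma> * s)"

text \<open>\<open>V d s\<close> is the volume of the unit cell of the scaling in dimension \<open>1 + 2 * d\<close>.\<close>

definition V :: "real \<Rightarrow> real \<Rightarrow> real" where
  "V n s = exp ((1 - n) * k + (\<beta> * (1 + n) + 2 * n * \<gamma>) * s)"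

text \<open>The Galilean translation taking \<open>z\<close> to the origin, followed by the inverse
  dilation. The drift uses the velocity of the base point \<open>z\<close>, not that of
  \<open>w\<close>; this makes the map affine in \<open>w\<close> and carries the transport field in
  \<open>w\<close> to a multiple of itself.\<close>

definition M :: "real \<Rightarrow> 'd::finite pt \<Rightarrow> 'd pt \<Rightarrow> 'd pt" where
  "M s z w = ((fst w - fst z) / \<tau> s,
      exp (- s) *\<^sub>R (fst (snd w) - fst (snd z) - (fst w - fst z) *\<^sub>R snd (snd z)),
      (1 / \<nu> s) *\<^sub>R (snd (snd w) - snd (snd z)))"

lemma pos [simp]: "\<tau> s > 0" "\<nu> s > 0" "V n s > 0"
  by (simp_all add: \<tau>_def \<nu>_def V_def)

lemma nonzero [simp]: "\<tau> s \<noteq> 0" "\<nu> s \<noteq> 0" "V n s \<noteq> 0"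
  by (simp_all add: \<tau>_def \<nu>_def V_def)

lemma abs_scales [simp]: "\<bar>\<tau> s\<bar> = \<tau> s" "\<bar>\<nu> s\<bar> = \<nu> s" "\<bar>V n s\<bar> = V n s"
  by (simp_all add: \<tau>_def \<nu>_def V_def)

lemma \<tau>\<nu>: "\<tau> s * \<nu> s = exp s"
  using \<beta>\<gamma> by (simp add: \<tau>_def \<nu>_def flip: exp_add distrib_right)

lemma V_eq: "V (real n) s = \<tau> s * exp s ^ n * \<nu> s ^ n"
proof -
  have "(\<beta> * (1 + n) + 2 * n * \<gamma>) * s = \<beta> * s + n * ((\<beta> + \<gamma>) * s) + n * (\<gamma> * s)"
    by (simp add: algebra_simps)
  then show ?thesis
    by (simp add: V_def \<tau>_def \<nu>_def \<beta>\<gamma> algebra_simps flip: exp_add exp_of_nat_mult)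
qed

lemma nn_integral_M_right:
  fixes g :: "'d::finite pt \<Rightarrow> ennreal"
  assumes g: "g \<in> borel_measurable borel"
  shows "(\<integral>\<^sup>+w. g (M s z w) \<partial>lborel) = ennreal (V (real CARD('d)) s) * (\<integral>\<^sup>+y. g y \<partial>lborel)"
proof -
  let ?V = "V (real CARD('d)) s"
  have e: "M s z w = (- fst z / \<tau> s + (1 / \<tau> s) * fst w,
      exp (- s) *\<^sub>R (- fst (snd z) - (fst w - fst z) *\<^sub>R snd (snd z)) + exp (- s) *\<^sub>R fst (snd w),
      - (1 / \<nu> s) *\<^sub>R snd (snd z) + (1 / \<nu> s) *\<^sub>R snd (snd w))" for w :: "'d pt"
    by (simp add: M_def diff_divide_distrib algebra_simps)
  have J: "\<bar>1 / \<tau> s\<bar> * \<bar>exp (- s)\<bar> ^ DIM(real^'d) * \<bar>1 / \<nu> s\<bar> ^ DIM(real^'d) = 1 / ?V"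
    by (simp add: V_eq exp_minus power_one_over field_simps)
  have "ennreal (1 / ?V) * (\<integral>\<^sup>+w. g (M s z w) \<partial>lborel) = (\<integral>\<^sup>+y. g y \<partial>lborel)"
    unfolding e J[symmetric] by (intro nn_integral_shear_affine g continuous_intros) auto
  then have "ennreal ?V * (\<integral>\<^sup>+y. g y \<partial>lborel) = ennreal (?V * (1 / ?V)) * (\<integral>\<^sup>+w. g (M s z w) \<partial>lborel)"
    by (subst ennreal_mult) (simp_all add: mult.assoc less_imp_le)
  then show ?thesis by simp
qed

text \<open>The Jacobian in the base point is the same as in \<open>w\<close>, the Galilean group
  being unimodular. This bounds the averages on L^1 and normalises their adjoints.\<close>

lemma nn_integral_M_left:
  fixes g :: "'d::finite pt \<Rightarrow> ennreal"
  assumes g: "g \<in> borel_measurable borel"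
  shows "(\<integral>\<^sup>+z. g (M s z w) \<partial>lborel) = ennreal (V (real CARD('d)) s) * (\<integral>\<^sup>+y. g y \<partial>lborel)"
proof -
  let ?V = "V (real CARD('d)) s"
  have e: "M s z w = (fst w / \<tau> s + (- 1 / \<tau> s) * fst z,
      exp (- s) *\<^sub>R (fst (snd w) - (fst w - fst z) *\<^sub>R snd (snd z)) + (- exp (- s)) *\<^sub>R fst (snd z),
      (1 / \<nu> s) *\<^sub>R snd (snd w) + (- 1 / \<nu> s) *\<^sub>R snd (snd z))" for z :: "'d pt"
    by (simp add: M_def diff_divide_distrib algebra_simps)
  have J: "\<bar>- 1 / \<tau> s\<bar> * \<bar>- exp (- s)\<bar> ^ DIM(real^'d) * \<bar>- 1 / \<nu> s\<bar> ^ DIM(real^'d) = 1 / ?V"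
    by (simp add: V_eq exp_minus power_one_over field_simps)
  have "ennreal (1 / ?V) * (\<integral>\<^sup>+z. g (M s z w) \<partial>lborel) = (\<integral>\<^sup>+y. g y \<partial>lborel)"
    unfolding e J[symmetric] by (intro nn_integral_shear_affine g continuous_intros) auto
  then have "ennreal ?V * (\<integral>\<^sup>+y. g y \<partial>lborel) = ennreal (?V * (1 / ?V)) * (\<integral>\<^sup>+z. g (M s z w) \<partial>lborel)"
    by (subst ennreal_mult) (simp_all add: mult.assoc less_imp_le)
  then show ?thesis by simp
qed

lemma continuous_M:
  "continuous_on UNIV (\<lambda>(s, z, w). M s z (w :: 'd::finite pt))"
  unfolding M_def case_prod_beta \<tau>_def \<nu>_def by (intro continuous_intros) auto

lemma M_measurable [measurable]:
  fixes g h :: "'a \<Rightarrow> 'd::finite pt"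
  assumes [measurable]: "f \<in> borel_measurable N" "g \<in> borel_measurable N" "h \<in> borel_measurable N"
  shows "(\<lambda>x. M (f x) (g x) (h x)) \<in> borel_measurable N"
proof -
  have "(\<lambda>(s, z, w). M s z (w :: 'd::finite pt)) \<in> borel_measurable borel"
    by (rule borel_measurable_continuous_onI[OF continuous_M])
  then have [measurable]: "(\<lambda>(s, z, w). M s z (w :: 'd::finite pt)) \<in> borel_measurable (borel \<Otimes>\<^sub>M borel \<Otimes>\<^sub>M borel)"
    by (simp add: borel_prod)
  have "(\<lambda>x. (\<lambda>(s, z, w). M s z w) (f x, g x, h x)) \<in> borel_measurable N"
    by measurable
  then show ?thesis by simp
qed

end

text \<open>A weak form of Minkowski's integral inequality: the weight \<open>N s\<close> is the size of the
  \<open>s\<close>-th slice in \<open>L\<^sup>q\<close>, and Holder is applied with respect to the measure \<open>w s * N s\<close>.\<close>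

lemma nn_integral_epowr_mixture:
  fixes w :: "real \<Rightarrow> real" and N :: "real \<Rightarrow> real" and a :: "real \<Rightarrow> 'a::euclidean_space \<Rightarrow> ennreal"
  assumes [measurable]: "(\<lambda>(s, z). a s z) \<in> borel_measurable (borel \<Otimes>\<^sub>M borel)"
    and [measurable]: "w \<in> borel_measurable borel" "N \<in> borel_measurable borel"
    and w0: "\<And>s. w s \<ge> 0" and N0: "\<And>s. N s > 0" and q: "q \<ge> 1"
    and slice: "\<And>s. (\<integral>\<^sup>+z. epowr (a s z) q \<partial>lborel) \<le> ennreal (N s powr q) * X"
    and m: "(\<integral>\<^sup>+s. ennreal (w s * N s) \<partial>lborel) \<le> ennreal m" "m > 0"
  shows "(\<integral>\<^sup>+z. epowr (\<integral>\<^sup>+s. ennreal (w s) * a s z \<partial>lborel) q \<partial>lborel) \<le> ennreal (2 powr q * m powr q) * X"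
proof -
  let ?L = "\<integral>\<^sup>+z. epowr (\<integral>\<^sup>+s. ennreal (w s) * a s z \<partial>lborel) q \<partial>lborel"
  let ?t = "\<lambda>s z. ennreal (w s * N s) * epowr (ennreal (1 / N s) * a s z) q" and ?c = "ennreal (2 powr q * m powr (q - 1))"
  have [measurable]: "(\<lambda>s. a s z) \<in> borel_measurable borel" for z
    using measurable_compose_Pair1 by measurable
  have split: "ennreal (w s) * a s z = ennreal (w s * N s) * (ennreal (1 / N s) * a s z)" for s z
    using N0[of s] w0[of s] by (simp add: ennreal_mult'[symmetric] mult.assoc[symmetric] less_imp_le)
  have "?L
     \<le> (\<integral>\<^sup>+z. ?c * (\<integral>\<^sup>+s. ?t s z \<partial>lborel) \<partial>lborel)"
    unfolding split by (intro nn_integral_mono epowr_nn_integral_le m q) auto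
  also have "\<dots> = ?c * (\<integral>\<^sup>+z. \<integral>\<^sup>+s. ?t s z \<partial>lborel \<partial>lborel)"
    by (intro nn_integral_cmult) measurable
  also have "(\<integral>\<^sup>+z. \<integral>\<^sup>+s. ?t s z \<partial>lborel \<partial>lborel)
     = (\<integral>\<^sup>+s. \<integral>\<^sup>+z. ?t s z \<partial>lborel \<partial>lborel)"
    by (intro lborel_pair.Fubini') measurable
  also have "\<dots> \<le> (\<integral>\<^sup>+s. ennreal (w s * N s) * X \<partial>lborel)"
  proof (intro nn_integral_mono)
    fix s
    have "(\<integral>\<^sup>+z. ?t s z \<partial>lborel)
       = ennreal (w s * N s) * (ennreal ((1 / N s) powr q) * (\<integral>\<^sup>+z. epowr (a s z) q \<partial>lborel))"
      using N0[of s] q by (simp add: epowr_mult nn_integral_cmult)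
    also have "\<dots> \<le> ennreal (w s * N s) * (ennreal ((1 / N s) powr q) * (ennreal (N s powr q) * X))"
      by (intro mult_left_mono slice) auto
    also have "\<dots> = ennreal (w s * N s) * X"
      using N0[of s] by (simp add: mult.assoc[symmetric] ennreal_mult'[symmetric] powr_mult[symmetric] less_imp_le)
    finally show "(\<integral>\<^sup>+z. ?t s z \<partial>lborel) \<le> ennreal (w s * N s) * X" .
  qed
  also have "\<dots> = (\<integral>\<^sup>+s. ennreal (w s * N s) \<partial>lborel) * X"
    by (intro nn_integral_multc) measurable
  also have "\<dots> \<le> ennreal m * X"
    by (intro mult_right_mono m) auto
  finally have "?L
     \<le> ?c * (ennreal m * X)" by (simp add: mult_left_mono)
  also have "\<dots> = ennreal (2 powr q * m powr q) * X"
  proof -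
    have "m powr q = m powr (q - 1) * m" using m powr_mult_base[of m "q - 1"] by (simp add: mult.commute)
    then show ?thesis using m by (simp add: ennreal_mult mult_ac)
  qed
  finally show ?thesis .
qed

section \<open>Exponential integrals over the scale\<close>

lemma nn_integral_exp_tail:
  fixes a :: real assumes "a > 0"
  shows "(\<integral>\<^sup>+s. ennreal (exp (- a * s)) * indicator {0..} s \<partial>lborel) = ennreal (1 / a)"
proof -
  have "(\<integral>\<^sup>+s. ennreal (exp (- a * s)) * indicator {0..} s \<partial>lborel) = ennreal (0 - (- exp (- a * 0) / a))"
  proof (rule nn_integral_FTC_atLeast)
    show "((\<lambda>s. - exp (- a * s) / a) has_real_derivative exp (- a * s)) (at s)" for s
      using assms by (auto intro!: derivative_eq_intros)
    have "((\<lambda>s. exp (- a * s)) \<longlongrightarrow> 0) at_top"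
      using assms by (intro filterlim_compose[OF exp_at_bot] filterlim_tendsto_neg_mult_at_bot[OF tendsto_const _ filterlim_ident]) simp
    then show "((\<lambda>s. - exp (- a * s) / a) \<longlongrightarrow> 0) at_top"
      using tendsto_divide[OF tendsto_minus, of _ 0 _ "\<lambda>_. a" a] assms by auto
  qed auto
  then show ?thesis by simp
qed

text \<open>Shifting \<open>s\<close> by \<open>ln l\<close> extracts
  \<open>l powr \<sigma>\<close>; the rest decays like \<open>exp (\<sigma> * s)\<close> at minus
  infinity and like \<open>exp (- (1 - \<sigma>) * s)\<close> at plus infinity, so the two bounds on
  \<open>\<sigma>\<close> are the convergence conditions at the two ends. With
  \<open>l = norm h\<close> this creates the homogeneity in \<open>h\<close> of the final
  estimate.\<close>

lemma nn_integral_min_exp: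
  fixes \<sigma> l :: real
  assumes "0 < \<sigma>" "\<sigma> < 1" "l > 0"
  shows "(\<integral>\<^sup>+s. ennreal (min 1 (l * exp (- s)) * exp (\<sigma> * s)) \<partial>lborel) \<le> ennreal (l powr \<sigma> * (1 / \<sigma> + 1 / (1 - \<sigma>)))"
proof -
  let ?p = "\<lambda>s. ennreal (exp (- (1 - \<sigma>) * s)) * indicator {0..} s" and ?l = "ennreal (l powr \<sigma>)"
  let ?m = "\<lambda>s. ennreal (exp (- \<sigma> * (- s))) * indicator {0..} (- s)"
  let ?g = "\<lambda>s. ennreal (min 1 (l * exp (- s)) * exp (\<sigma> * s))"
  have "(\<integral>\<^sup>+s. ?g s \<partial>lborel) = (\<integral>\<^sup>+s. ?g (ln l + s) \<partial>lborel)"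
    using nn_integral_real_affine[of ?g 1 "ln l"] by simp
  also have "\<dots> \<le> (\<integral>\<^sup>+s. ?l * ?p s
        + ?l * ?m s \<partial>lborel)"
  proof (intro nn_integral_mono)
    fix s :: real
    have 1: "l * exp (- (ln l + s)) = exp (- s)" using assms by (simp add: exp_minus exp_diff inverse_eq_divide)
    have 2: "exp (\<sigma> * (ln l + s)) = l powr \<sigma> * exp (\<sigma> * s)" using assms by (simp add: powr_def distrib_left exp_add)
    have "?g (ln l + s) = ?l * ennreal (min 1 (exp (- s)) * exp (\<sigma> * s))"
      unfolding 1 2 by (simp add: ennreal_mult'[symmetric] mult_ac)
    also have "\<dots> \<le> ?l * (?p s
        + ?m s)"
      by (intro mult_left_mono) (cases "s \<ge> 0"; auto simp: indicator_def algebra_simps ennreal_le_iff min_def mult_le_cancel_right1 simp flip: exp_add)+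
    finally show "?g (ln l + s) \<le> ?l * ?p s
        + ?l * ?m s"
      by (simp add: distrib_left)
  qed
  also have "\<dots> = ?l * integral\<^sup>N lborel ?p
        + ?l * integral\<^sup>N lborel ?m"
    by (subst nn_integral_add) (auto simp: nn_integral_cmult)
  also have "integral\<^sup>N lborel ?m = ennreal (1 / \<sigma>)"
    using nn_integral_real_affine[of "\<lambda>s. ennreal (exp (- \<sigma> * s)) * indicator {0..} s" "-1" 0]
    nn_integral_exp_tail[of \<sigma>] assms by simp
  also have "integral\<^sup>N lborel ?p = ennreal (1 / (1 - \<sigma>))"
    using nn_integral_exp_tail[of "1 - \<sigma>"] assms by simp
  also have "?l * ennreal (1 / (1 - \<sigma>)) + ?l * ennreal (1 / \<sigma>) = ennreal (l powr \<sigma> * (1 / \<sigma> + 1 / (1 - \<sigma>)))"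
    using assms by (simp add: ennreal_mult'[symmetric] ennreal_plus[symmetric] algebra_simps del: ennreal_plus)
  finally show ?thesis .
qed

lemma pred_cball_measurable [measurable]:
  fixes f :: "'b \<Rightarrow> 'a::metric_space"
  assumes "f \<in> borel_measurable N"
  shows "Measurable.pred N (\<lambda>x. f x \<in> cball c r)"
  using measurable_sets[OF assms, of "cball c r"]
  by (simp add: pred_def vimage_def Int_def conj_commute)

section \<open>Averages over kinetic cells and their mapping properties\<close>

context kinetic_scaling begin

text \<open>The sharp indicator replaces the smooth bump here: every kernel in use is bounded and
  supported in the unit ball, so this single positive operator dominates them all.\<close>

definition avg :: "real \<Rightarrow> ('d::finite pt \<Rightarrow> ennreal) \<Rightarrow> 'd pt \<Rightarrow> ennreal" where
  "avg s F z = (\<integral>\<^sup>+w. ennreal (1 / V (real CARD('d)) s) * indicator (cball 0 1) (M s z w) * F w \<partial>lborel)"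

lemma avg_measurable:
  fixes F :: "'d::finite pt \<Rightarrow> ennreal"
  assumes [measurable]: "F \<in> borel_measurable borel"
  shows "(\<lambda>(s, z). avg s F z) \<in> borel_measurable (borel \<Otimes>\<^sub>M borel)"
proof -
  have [measurable]: "V n \<in> borel_measurable borel" for n unfolding V_def by measurable
  show ?thesis unfolding avg_def case_prod_beta by measurable
qed

lemma avg_measurable' [measurable]:
  fixes F :: "'d::finite pt \<Rightarrow> ennreal"
  assumes [measurable]: "F \<in> borel_measurable borel"
  shows "avg s F \<in> borel_measurable borel"
  using avg_measurable[OF assms] by measurable

definition unit_vol :: "'d::finite pt itself \<Rightarrow> real" where
  "unit_vol _ = measure lborel (cball 0 1 :: 'd pt set)"

lemma unit_vol_pos: "unit_vol TYPE('d::finite pt) > 0"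
  unfolding unit_vol_def using content_cball_pos[of 1 "0::'d pt"] by simp

lemma nn_integral_unit_ball:
  "(\<integral>\<^sup>+y. indicator (cball 0 1) (y :: 'd::finite pt) \<partial>lborel) = ennreal (unit_vol TYPE('d pt))"
  using emeasure_lborel_cball_finite[of "0::'d pt" 1]
  by (simp add: unit_vol_def emeasure_eq_ennreal_measure top.not_eq_extremum)

lemma nn_integral_kernel:
  "(\<integral>\<^sup>+w. ennreal (1 / V (real CARD('d)) s) * indicator (cball 0 1) (M s (z :: 'd::finite pt) w) \<partial>lborel) = ennreal (unit_vol TYPE('d pt))"
  "(\<integral>\<^sup>+z. ennreal (1 / V (real CARD('d)) s) * indicator (cball 0 1) (M s z (w :: 'd::finite pt)) \<partial>lborel) = ennreal (unit_vol TYPE('d pt))"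
proof -
  have *: "ennreal (1 / V (real CARD('d)) s) * (ennreal (V (real CARD('d)) s) * X) = X" for X
    by (simp add: mult.assoc[symmetric] ennreal_mult'[symmetric] less_imp_le)
  show "(\<integral>\<^sup>+w. ennreal (1 / V (real CARD('d)) s) * indicator (cball 0 1) (M s z w) \<partial>lborel) = ennreal (unit_vol TYPE('d pt))"
    using nn_integral_M_right[of "indicator (cball 0 1)" s z] nn_integral_unit_ball[where 'd='d]
    by (subst nn_integral_cmult) (auto simp: *)
  show "(\<integral>\<^sup>+z. ennreal (1 / V (real CARD('d)) s) * indicator (cball 0 1) (M s z w) \<partial>lborel) = ennreal (unit_vol TYPE('d pt))"
    using nn_integral_M_left[of "indicator (cball 0 1)" s w] nn_integral_unit_ball[where 'd='d]
    by (subst nn_integral_cmult) (auto simp: *)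
qed

definition cavg :: "'d::finite pt itself \<Rightarrow> real \<Rightarrow> real" where
  "cavg T p = 2 powr p * unit_vol T powr (p - 1)"

lemma cavg_pos: "cavg TYPE('d::finite pt) p > 0"
  using unit_vol_pos[where 'd='d] by (simp add: cavg_def)

text \<open>Jensen's inequality for a kernel of total mass \<open>unit_vol\<close>, with the factor
  \<open>2 powr p\<close> inherited from the weak Holder bound.\<close>

lemma epowr_avg_le:
  fixes F :: "'d::finite pt \<Rightarrow> ennreal"
  assumes [measurable]: "F \<in> borel_measurable borel" and p: "p \<ge> 1"
  shows "epowr (avg s F z) p \<le> ennreal (cavg TYPE('d pt) p) * avg s (\<lambda>w. epowr (F w) p) z"
  unfolding avg_def cavg_def
  by (intro epowr_nn_integral_le p) (auto simp: nn_integral_kernel unit_vol_pos)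

text \<open>Dropping the indicator after Jensen leaves the global integral, so an
  \<open>L\<^sup>p\<close> function has averages bounded by a multiple of the power
  \<open>- 1 / p\<close> of the cell volume.\<close>

lemma epowr_avg_sup:
  fixes F :: "'d::finite pt \<Rightarrow> ennreal"
  assumes [measurable]: "F \<in> borel_measurable borel" and p: "p \<ge> 1"
  shows "epowr (avg s F z) p \<le> ennreal (cavg TYPE('d pt) p / V (real CARD('d)) s) * (epow_int p F)"
proof -
  have "avg s (\<lambda>w. epowr (F w) p) z \<le> (\<integral>\<^sup>+w. ennreal (1 / V (real CARD('d)) s) * epowr (F w) p \<partial>lborel)"
    unfolding avg_def by (intro nn_integral_mono) (auto simp: indicator_def)
  also have "\<dots> = ennreal (1 / V (real CARD('d)) s) * (epow_int p F)"
    by (intro nn_integral_cmult) auto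
  finally have "ennreal (cavg TYPE('d pt) p) * avg s (\<lambda>w. epowr (F w) p) z \<le> ennreal (cavg TYPE('d pt) p) * (ennreal (1 / V (real CARD('d)) s) * (epow_int p F))"
    by (intro mult_left_mono) auto
  also have "\<dots> = ennreal (cavg TYPE('d pt) p / V (real CARD('d)) s) * (epow_int p F)"
    using cavg_pos[of p, where 'd='d] by (simp add: mult.assoc[symmetric] ennreal_mult'[symmetric])
  finally show ?thesis using epowr_avg_le[OF assms] order_trans by blast
qed

lemma nn_integral_avg:
  fixes F :: "'d::finite pt \<Rightarrow> ennreal"
  assumes [measurable]: "F \<in> borel_measurable borel"
  shows "(\<integral>\<^sup>+z. avg s F z \<partial>lborel) = ennreal (unit_vol TYPE('d pt)) * (\<integral>\<^sup>+w. F w \<partial>lborel)"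
proof -
  have "(\<integral>\<^sup>+z. avg s F z \<partial>lborel) = (\<integral>\<^sup>+w. \<integral>\<^sup>+z. ennreal (1 / V (real CARD('d)) s) * indicator (cball 0 1) (M s z w) * F w \<partial>lborel \<partial>lborel)"
    unfolding avg_def by (intro lborel_pair.Fubini') measurable
  also have "\<dots> = (\<integral>\<^sup>+w. ennreal (unit_vol TYPE('d pt)) * F w \<partial>lborel)"
    by (simp add: nn_integral_multc nn_integral_kernel)
  finally show ?thesis by (simp add: nn_integral_cmult)
qed

definition cavg2 :: "'d::finite pt itself \<Rightarrow> real \<Rightarrow> real \<Rightarrow> real" where
  "cavg2 T p q = cavg T p powr (q / p) * unit_vol T"

lemma cavg2_pos: "cavg2 TYPE('d::finite pt) p q > 0"
  using unit_vol_pos[where 'd='d] cavg_pos[where 'd='d, of p] by (simp add: cavg2_def)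

text \<open>Interpolation by hand: of the \<open>q / p\<close> factors
  \<open>epowr (avg s F z) p\<close>, all but one are estimated by the supremum bound and the last
  by the L^1 bound. The power \<open>- (1 / p - 1 / q)\<close> of the cell volume is kept apart
  because it fixes the scaling exponents.\<close>

lemma nn_integral_epowr_avg:
  fixes F :: "'d::finite pt \<Rightarrow> ennreal"
  assumes [measurable]: "F \<in> borel_measurable borel" and p: "p \<ge> 1" and q: "q > p"
  shows "(epow_int q (avg s F))
    \<le> ennreal ((V (real CARD('d)) s powr (- (1 / p - 1 / q))) powr q) *
      (ennreal (cavg2 TYPE('d pt) p q) * epowr (epow_int p F) (q / p))"
proof -
  let ?c = "cavg TYPE('d pt) p" and ?V = "V (real CARD('d)) s" and ?N = "epow_int p F"
  let ?u = "unit_vol TYPE('d pt)" and ?a = "avg s (\<lambda>w. epowr (F w) p)"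
  note cpos = cavg_pos[where 'd='d, of p] and upos = unit_vol_pos[where 'd='d]
  have r: "q / p - 1 > 0" using p q by simp
  have "epowr (avg s F z) q \<le> ennreal ((?c / ?V) powr (q / p - 1)) * epowr ?N (q / p - 1) *
      (ennreal ?c * ?a z)" for z
  proof -
    have "epowr (avg s F z) q = epowr (epowr (avg s F z) p) ((q / p - 1) + 1)"
      using p q by (subst epowr_epowr) auto
    also have "\<dots> = epowr (epowr (avg s F z) p) (q / p - 1) * epowr (avg s F z) p"
      using r by (subst epowr_add) auto
    also have "\<dots> \<le> epowr (ennreal (?c / ?V) * ?N) (q / p - 1) * (ennreal ?c * ?a z)"
      using r p by (intro mult_mono epowr_mono epowr_avg_sup epowr_avg_le) auto
    also have "epowr (ennreal (?c / ?V) * ?N) (q / p - 1) = ennreal ((?c / ?V) powr (q / p - 1)) * epowr ?N (q / p - 1)"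
      using r cpos by (intro epowr_mult) (auto simp: less_imp_le)
    finally show ?thesis .
  qed
  then have "(epow_int q (avg s F)) \<le> (\<integral>\<^sup>+z. ennreal ((?c / ?V) powr (q / p - 1)) * epowr ?N (q / p - 1) *
      (ennreal ?c * ?a z) \<partial>lborel)"
    by (intro nn_integral_mono) auto
  also have "\<dots> = ennreal ((?c / ?V) powr (q / p - 1)) * epowr ?N (q / p - 1) * (ennreal ?c * (ennreal (?u) * ?N))"
    by (simp add: nn_integral_cmult nn_integral_avg)
  also have "\<dots> = ennreal ((?c / ?V) powr (q / p - 1) * (?c * ?u)) * (epowr ?N (q / p - 1) * epowr ?N 1)"
    using cpos upos by (simp add: ennreal_mult mult_ac)
  also have "epowr ?N (q / p - 1) * epowr ?N 1 = epowr ?N (q / p)"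
    using r by (subst epowr_add[symmetric]) auto
  also have "(?c / ?V) powr (q / p - 1) * (?c * ?u) = (?V powr (- (1 / p - 1 / q))) powr q * cavg2 TYPE('d pt) p q"
  proof -
    have "- (1 / p - 1 / q) * q = - (q / p - 1)" using p q by (simp add: field_simps)
    then have "(?V powr (- (1 / p - 1 / q))) powr q = ?V powr (- (q / p - 1))"
      unfolding powr_powr by simp
    moreover have "?c powr (q / p - 1) * ?c = ?c powr (q / p)"
      using powr_mult_base[of ?c "q / p - 1"] cpos by (simp add: mult.commute)
    ultimately show ?thesis
      using cpos pos(3)[of "real CARD('d)" s]
      by (simp only: cavg2_def powr_divide less_imp_le powr_minus_divide) (simp add: mult.assoc[symmetric])
  qed
  finally show ?thesis using cavg2_pos[where 'd='d, of p q]
    by (simp add: ennreal_mult mult_ac)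
qed

end

section \<open>Potentials for the dilation generator\<close>

lemma continuous_on_bump_compose [continuous_intros]:
  "continuous_on A f \<Longrightarrow> continuous_on A (\<lambda>x. bump n (f x))"
  using continuous_on_compose2[OF continuous_on_bump[of UNIV n]] by blast

lemma continuous_on_bump'_compose [continuous_intros]:
  "continuous_on A f \<Longrightarrow> continuous_on A (\<lambda>x. bump' n (f x))"
  unfolding bump'_def by (intro continuous_intros)

lemma bump_has_derivative_compose [derivative_intros]:
  "(f has_derivative f') (at x within S) \<Longrightarrow>
    ((\<lambda>x. bump n (f x)) has_derivative (\<lambda>u. bump' n (f x) * (- 2 * (f x \<bullet> f' u)))) (at x within S)"
  using has_derivative_compose[OF _ bump_has_derivative] by blast

lemma bump'_0 [simp]: "bump' 0 y = bump 2 y"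
  by (simp add: bump'_def numeral_2_eq_2)

lemma bump'_eq_0: "norm y \<ge> 1 \<Longrightarrow> bump' n y = 0"
  by (simp add: bump'_def bump_eq_0)

context kinetic_scaling begin

text \<open>Write \<open>\<phi>\<close> for \<open>bump 0\<close>, whose gradient is
  \<open>- 2 * bump 2 y\<close> times \<open>y\<close>. Then this is
  \<open>\<beta> (1 + d) t \<phi> - (x - \<beta> t v) . grad_v \<phi>\<close>, the part of the
  generator that is differentiated along \<open>Y\<close>.\<close>

definition bpot :: "'d::finite pt \<Rightarrow> real" where
  "bpot y = \<beta> * (1 + real CARD('d)) * fst y * bump 0 y
    + 2 * (fst (snd y) \<bullet> snd (snd y) - \<beta> * fst y * (snd (snd y) \<bullet> snd (snd y))) * bump 2 y"

text \<open>The function \<open>Y bpot\<close> in closed form, so that continuity and support can be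
  read off from polynomials and bumps.\<close>

definition bpot_Y :: "'d::finite pt \<Rightarrow> real" where
  "bpot_Y y = (let t = fst y; x = fst (snd y); v = snd (snd y); B = \<beta> * (1 + real CARD('d)) in
     B * bump 0 y - 2 * B * t * (t + v \<bullet> x) * bump 2 y + 2 * (v \<bullet> v - \<beta> * (v \<bullet> v)) * bump 2 y
     - 4 * (x \<bullet> v - \<beta> * t * (v \<bullet> v)) * (t + v \<bullet> x) * bump' 2 y)"

definition bpot_v :: "'d::finite pt \<Rightarrow> real^'d" where
  "bpot_v y = (let t = fst y; x = fst (snd y); v = snd (snd y); B = \<beta> * (1 + real CARD('d)) in
     (- 2 * B * t * bump 2 y - 4 * \<beta> * t * bump 2 y - 4 * (x \<bullet> v - \<beta> * t * (v \<bullet> v)) * bump' 2 y) *\<^sub>R v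
     + (2 * bump 2 y) *\<^sub>R x)"

text \<open>With \<open>\<phi> = bump 0\<close> this is
  \<open>2 \<gamma> \<phi> v + (Y \<phi>) (x - \<beta> t v)\<close>: the second summand comes from
  the term \<open>grad_v Y\<close> of the commutator, the first absorbs the remaining drift in
  \<open>v\<close>.\<close>

definition apot :: "'d::finite pt \<Rightarrow> real^'d" where
  "apot y = (2 * \<gamma> * bump 0 y) *\<^sub>R snd (snd y)
    - (2 * (fst y + snd (snd y) \<bullet> fst (snd y)) * bump 2 y) *\<^sub>R (fst (snd y) - (\<beta> * fst y) *\<^sub>R snd (snd y))"

text \<open>Summed over a basis this is the \<open>v\<close>-divergence of \<open>apot\<close>. The
  factor \<open>e \<bullet> e\<close> stays because the derivative formula is proved for arbitrary
  \<open>e\<close>.\<close>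

definition apot_v :: "real^'d \<Rightarrow> 'd::finite pt \<Rightarrow> real" where
  "apot_v e y = (let t = fst y; x = fst (snd y); v = snd (snd y) in
     2 * \<gamma> * bump 0 y * (e \<bullet> e) - 4 * \<gamma> * (v \<bullet> e) * (v \<bullet> e) * bump 2 y
     - 2 * (e \<bullet> x) * bump 2 y * (x \<bullet> e - \<beta> * t * (v \<bullet> e))
     + 4 * (t + v \<bullet> x) * bump' 2 y * (v \<bullet> e) * (x \<bullet> e - \<beta> * t * (v \<bullet> e))
     + 2 * (t + v \<bullet> x) * bump 2 y * \<beta> * t * (e \<bullet> e))"

text \<open>The divergence of \<open>bump 0 y\<close> times the field
  \<open>(\<beta> t, x, \<gamma> v)\<close>. The zeroth-order coefficient is
  \<open>\<beta> + d + d \<gamma>\<close>, rewritten with \<open>\<beta> + \<gamma> = 1\<close> so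
  as to be visibly the growth rate of \<open>V\<close>.\<close>

definition dil :: "'d::finite pt \<Rightarrow> real" where
  "dil y = (\<beta> * (1 + real CARD('d)) + 2 * real CARD('d) * \<gamma>) * bump 0 y
    - 2 * bump 2 y * (\<beta> * fst y * fst y + fst (snd y) \<bullet> fst (snd y) + \<gamma> * (snd (snd y) \<bullet> snd (snd y)))"

lemma bpot_has_derivative:
  fixes y :: "'d::finite pt"
  shows "(bpot has_derivative (\<lambda>u.
     \<beta> * (1 + real CARD('d)) * fst u * bump 0 y
     + \<beta> * (1 + real CARD('d)) * fst y * (bump 2 y * (- 2 * (y \<bullet> u)))
     + 2 * (fst (snd u) \<bullet> snd (snd y) + fst (snd y) \<bullet> snd (snd u) - \<beta> * fst u * (snd (snd y) \<bullet> snd (snd y))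
          - 2 * \<beta> * fst y * (snd (snd y) \<bullet> snd (snd u))) * bump 2 y
     + 2 * (fst (snd y) \<bullet> snd (snd y) - \<beta> * fst y * (snd (snd y) \<bullet> snd (snd y))) * (bump' 2 y * (- 2 * (y \<bullet> u))))) (at y)"
  unfolding bpot_def
  by (auto intro!: derivative_eq_intros ext simp: algebra_simps inner_commute)

lemma bpot_derivative_Y:
  fixes y :: "'d::finite pt"
  shows "frechet_derivative bpot (at y) (1, snd (snd y), 0) = bpot_Y y"
  unfolding frechet_derivative_at[OF bpot_has_derivative, symmetric]
  by (simp add: bpot_Y_def Let_def inner_prod_def algebra_simps inner_commute)

lemma bpot_derivative_v:
  fixes y :: "'d::finite pt"
  shows "frechet_derivative bpot (at y) (0, 0, e) = bpot_v y \<bullet> e"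
  unfolding frechet_derivative_at[OF bpot_has_derivative, symmetric]
  by (simp add: bpot_v_def Let_def inner_prod_def algebra_simps inner_commute)

lemma apot_has_derivative:
  fixes y :: "'d::finite pt"
  shows "((\<lambda>y. apot y \<bullet> e) has_derivative (\<lambda>u.
     2 * \<gamma> * (bump 2 y * (- 2 * (y \<bullet> u))) * (snd (snd y) \<bullet> e) + 2 * \<gamma> * bump 0 y * (snd (snd u) \<bullet> e)
     - 2 * (fst u + snd (snd u) \<bullet> fst (snd y) + snd (snd y) \<bullet> fst (snd u)) * bump 2 y * (fst (snd y) \<bullet> e - \<beta> * fst y * (snd (snd y) \<bullet> e))
     - 2 * (fst y + snd (snd y) \<bullet> fst (snd y)) * (bump' 2 y * (- 2 * (y \<bullet> u))) * (fst (snd y) \<bullet> e - \<beta> * fst y * (snd (snd y) \<bullet> e))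
     - 2 * (fst y + snd (snd y) \<bullet> fst (snd y)) * bump 2 y * (fst (snd u) \<bullet> e - \<beta> * fst u * (snd (snd y) \<bullet> e) - \<beta> * fst y * (snd (snd u) \<bullet> e)))) (at y)"
  unfolding apot_def
  by (auto intro!: derivative_eq_intros ext simp: algebra_simps inner_commute)

lemma apot_derivative_v:
  fixes y :: "'d::finite pt"
  shows "frechet_derivative (\<lambda>y. apot y \<bullet> e) (at y) (0, 0, e) = apot_v e y"
  unfolding frechet_derivative_at[OF apot_has_derivative, symmetric]
  by (simp add: apot_v_def Let_def inner_prod_def algebra_simps inner_commute)

text \<open>Write the time derivative as \<open>Y - v . grad_x\<close>, which leaves \<open>\<beta>
  t Y \<phi> + (x - \<beta> t v) . grad_x \<phi> + \<gamma> v . grad_v \<phi>\<close> besides the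
  zeroth-order term. Replace \<open>grad_x\<close> by \<open>grad_v Y - Y grad_v\<close> and move
  the coefficients under the derivatives. Since \<open>Y (x - \<beta> t v) = \<gamma> v\<close>, the
  remainders add up to \<open>\<beta> (1 + d) t Y \<phi>\<close> and
  \<open>2 \<gamma> v . grad_v \<phi>\<close>; moving these coefficients inside as well cancels the
  zeroth-order term exactly.\<close>

lemma dil_decomposition:
  fixes y :: "'d::finite pt"
  shows "dil y = bpot_Y y + (\<Sum>e\<in>Basis. apot_v e y)"
proof -
  obtain t x v where y: "y = (t, x, v)" by (metis prod.exhaust)
  have *: "(\<Sum>e\<in>Basis. (u \<bullet> e) * (w \<bullet> e)) = u \<bullet> w" for u w :: "real^'d"
    by (rule euclidean_inner[symmetric])
  have "(\<Sum>e\<in>Basis. apot_v e y) = (\<Sum>e\<in>Basis.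
     (2 * \<gamma> * bump 0 y + 2 * (t + v \<bullet> x) * bump 2 y * \<beta> * t)
     - 4 * \<gamma> * bump 2 y * ((v \<bullet> e) * (v \<bullet> e))
     - 2 * bump 2 y * ((x \<bullet> e) * (x \<bullet> e)) + 2 * bump 2 y * \<beta> * t * ((x \<bullet> e) * (v \<bullet> e))
     + 4 * (t + v \<bullet> x) * bump' 2 y * ((v \<bullet> e) * (x \<bullet> e)) - 4 * (t + v \<bullet> x) * bump' 2 y * \<beta> * t * ((v \<bullet> e) * (v \<bullet> e)))"
    by (intro sum.cong refl) (simp add: apot_v_def y inner_commute[of _ x] algebra_simps)
  also have "\<dots> = real CARD('d) * (2 * \<gamma> * bump 0 y + 2 * (t + v \<bullet> x) * bump 2 y * \<beta> * t)
     - 4 * \<gamma> * bump 2 y * (v \<bullet> v) - 2 * bump 2 y * (x \<bullet> x) + 2 * bump 2 y * \<beta> * t * (x \<bullet> v)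
     + 4 * (t + v \<bullet> x) * bump' 2 y * (v \<bullet> x) - 4 * (t + v \<bullet> x) * bump' 2 y * \<beta> * t * (v \<bullet> v)"
    by (simp add: sum.distrib sum_subtractf sum_distrib_left[symmetric] *)
  finally have A: "(\<Sum>e\<in>Basis. apot_v e y) = \<dots>" .
  have g: "\<beta> * c + \<gamma> * c = c" for c using \<beta>\<gamma> by (simp flip: distrib_right)
  show ?thesis
    by (subst A) (simp add: dil_def bpot_Y_def Let_def y inner_commute[of v x], simp add: algebra_simps g)
qed

lemma Ck_fst: "Ck j (\<lambda>y::'d::finite pt. fst y)"
  by (rule Ck_bounded_linear) (rule bounded_linear_fst)

lemma Ck_xe: "Ck j (\<lambda>y::'d::finite pt. fst (snd y) \<bullet> e)"
  by (rule Ck_bounded_linear)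
     (intro bounded_linear_compose[OF bounded_linear_inner_left] bounded_linear_fst_comp bounded_linear_snd)

lemma Ck_ve: "Ck j (\<lambda>y::'d::finite pt. snd (snd y) \<bullet> e)"
  by (rule Ck_bounded_linear)
     (intro bounded_linear_compose[OF bounded_linear_inner_left] bounded_linear_snd_comp bounded_linear_snd)

lemma Ck_xv: "Ck j (\<lambda>y::'d::finite pt. fst (snd y) \<bullet> snd (snd y))"
  by (subst euclidean_inner) (intro Ck_sum Ck_mult Ck_xe Ck_ve)

lemma Ck_vv: "Ck j (\<lambda>y::'d::finite pt. snd (snd y) \<bullet> snd (snd y))"
  by (subst euclidean_inner) (intro Ck_sum Ck_mult Ck_xe Ck_ve)

lemma Ck_bpot: "Ck j (bpot :: 'd::finite pt \<Rightarrow> real)"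
  unfolding bpot_def[abs_def] by (intro Ck_add Ck_diff Ck_mult Ck_const Ck_fst Ck_xv Ck_vv Ck_bump)

lemma Ck_apot: "Ck j (\<lambda>y::'d::finite pt. apot y \<bullet> e)"
  unfolding apot_def[abs_def] inner_diff_left inner_scaleR_left inner_commute[of "snd (snd _)" "fst (snd _)"]
  by (intro Ck_add Ck_diff Ck_mult Ck_const Ck_fst Ck_xv Ck_vv Ck_bump Ck_xe Ck_ve)

lemma Ck_bpot_v: "Ck j (\<lambda>y::'d::finite pt. bpot_v y \<bullet> e)"
  unfolding bpot_v_def[abs_def] Let_def inner_add_left inner_scaleR_left bump'_def
  by (intro Ck_add Ck_diff Ck_mult Ck_const Ck_fst Ck_xv Ck_vv Ck_bump Ck_xe Ck_ve)

lemma potentials_eq_0: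
  fixes y :: "'d::finite pt"
  assumes "norm y \<ge> 1"
  shows "bpot y = 0" "bpot_Y y = 0" "bpot_v y = 0" "apot y = 0" "apot_v e y = 0" "dil y = 0"
  using assms by (simp_all add: bpot_def bpot_Y_def bpot_v_def apot_def apot_v_def dil_def bump_eq_0 bump'_eq_0 Let_def)

lemma potentials_continuous:
  "continuous_on A (bpot :: 'd::finite pt \<Rightarrow> real)"
  "continuous_on A (bpot_Y :: 'd::finite pt \<Rightarrow> real)"
  "continuous_on A (bpot_v :: 'd::finite pt \<Rightarrow> real^'d)"
  "continuous_on A (apot :: 'd::finite pt \<Rightarrow> real^'d)"
  "continuous_on A (apot_v e :: 'd::finite pt \<Rightarrow> real)"
  "continuous_on A (dil :: 'd::finite pt \<Rightarrow> real)"
  unfolding bpot_def[abs_def] bpot_Y_def[abs_def] bpot_v_def[abs_def] apot_def[abs_def] apot_v_def[abs_def] dil_def[abs_def] Let_def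
  by (intro continuous_intros)+

end

section \<open>The integral identity for weak solutions\<close>

definition loc_integrable :: "('a::euclidean_space \<Rightarrow> 'b::real_normed_vector) \<Rightarrow> bool" where
  "loc_integrable f \<longleftrightarrow> f \<in> borel_measurable borel \<and>
     (\<forall>R. (\<integral>\<^sup>+w. ennreal (norm (f w)) * indicator (cball 0 R) w \<partial>lborel) < \<infinity>)"

lemma loc_integrable_measurable: "loc_integrable f \<Longrightarrow> f \<in> borel_measurable borel"
  by (simp add: loc_integrable_def)

lemma integrable_dominated_loc:
  fixes f :: "'a::euclidean_space \<Rightarrow> 'b::real_normed_vector" and g :: "'a \<Rightarrow> real"
  assumes f: "loc_integrable f" and [measurable]: "g \<in> borel_measurable borel"
    and g: "\<And>w. \<bar>g w\<bar> \<le> K * norm (f w) * indicator (cball 0 R) w"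
  shows "integrable lborel g"
proof (rule integrableI_bounded)
  have [measurable]: "f \<in> borel_measurable borel" using f by (rule loc_integrable_measurable)
  have "(\<integral>\<^sup>+w. ennreal (norm (g w)) \<partial>lborel) \<le> (\<integral>\<^sup>+w. ennreal \<bar>K\<bar> * (ennreal (norm (f w)) * indicator (cball 0 R) w) \<partial>lborel)"
  proof (intro nn_integral_mono)
    fix w
    have "\<bar>g w\<bar> \<le> \<bar>K\<bar> * norm (f w) * indicator (cball 0 R) w"
      by (rule order_trans[OF g]) (auto simp: indicator_def mult_right_mono)
    then show "ennreal (norm (g w)) \<le> ennreal \<bar>K\<bar> * (ennreal (norm (f w)) * indicator (cball 0 R) w)"
      by (auto simp: indicator_def ennreal_mult'[symmetric] split: if_splits)
  qed
  also have "\<dots> = ennreal \<bar>K\<bar> * (\<integral>\<^sup>+w. ennreal (norm (f w)) * indicator (cball 0 R) w \<partial>lborel)"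
    by (intro nn_integral_cmult) auto
  also have "\<dots> < \<infinity>" using f by (simp add: loc_integrable_def ennreal_mult_less_top)
  finally show "(\<integral>\<^sup>+w. ennreal (norm (g w)) \<partial>lborel) < \<infinity>" .
qed simp

text \<open>The tangent bound with \<open>l = 1\<close> gives
  \<open>norm (f w) \<le> norm (f w) powr p + 1\<close>, and the constant is integrable on
  balls.\<close>

lemma loc_integrable_Lp:
  fixes f :: "'a::euclidean_space \<Rightarrow> 'b::real_normed_vector"
  assumes [measurable]: "f \<in> borel_measurable borel" and p: "p \<ge> 1"
    and fin: "(epow_int p (nrm f)) < \<infinity>"
  shows "loc_integrable f"
  unfolding loc_integrable_def
proof (intro conjI allI)
  fix R
  have "(\<integral>\<^sup>+w. ennreal (norm (f w)) * indicator (cball 0 R) w \<partial>lborel)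
     \<le> (\<integral>\<^sup>+w. epowr (ennreal (norm (f w))) p + indicator (cball 0 R) w \<partial>lborel)"
  proof (intro nn_integral_mono)
    fix w
    show "ennreal (norm (f w)) * indicator (cball 0 R) w \<le> epowr (ennreal (norm (f w))) p + indicator (cball 0 R) w"
      using epowr_tangent[of 1 p "ennreal (norm (f w))"] p by (auto simp: indicator_def)
  qed
  also have "\<dots> = (epow_int p (nrm f)) + emeasure lborel (cball (0::'a) R)"
    by (subst nn_integral_add) auto
  also have "\<dots> < \<infinity>" using fin emeasure_lborel_cball_finite[of "0::'a" R] by simp
  finally show "(\<integral>\<^sup>+w. ennreal (norm (f w)) * indicator (cball 0 R) w \<partial>lborel) < \<infinity>" .
qed simp

lemma continuous_unit_support_bounded:
  fixes g :: "'a::euclidean_space \<Rightarrow> 'b::real_normed_vector"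
  assumes "continuous_on UNIV g" and supp: "\<And>y. norm y \<ge> 1 \<Longrightarrow> g y = 0"
  obtains K where "K \<ge> 0" "\<And>y. norm (g y) \<le> K * indicator (cball 0 1) y"
proof -
  have "compact (g ` cball 0 1)"
    by (rule compact_continuous_image[OF continuous_on_subset[OF assms(1) subset_UNIV]]) simp
  then obtain K where "\<forall>y\<in>cball 0 1. norm (g y) \<le> K"
    by (auto dest!: compact_imp_bounded simp: bounded_iff)
  then have K: "norm y \<le> 1 \<Longrightarrow> norm (g y) \<le> K" for y by simp
  have "K \<ge> 0" using K[of 0] norm_ge_zero order_trans by (metis norm_zero zero_le_one)
  moreover have "norm (g y) \<le> K * indicator (cball 0 1) y" for y
    using K[of y] supp[of y] by (cases "norm y \<le> 1") auto
  ultimately show thesis using that by blast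
qed

lemma ennreal_norm_integral_le:
  fixes f :: "'a \<Rightarrow> real"
  shows "ennreal \<bar>\<integral>x. f x \<partial>M\<bar> \<le> (\<integral>\<^sup>+x. ennreal \<bar>f x\<bar> \<partial>M)"
  using integral_norm_bound_ennreal[of M f] by (cases "integrable M f") (auto simp: not_integrable_integral_eq)

section \<open>Rescaled kernels as test functions\<close>

context kinetic_scaling begin

definition Lin :: "real \<Rightarrow> 'd::finite pt \<Rightarrow> 'd pt \<Rightarrow> 'd pt" where
  "Lin s z u = (fst u / \<tau> s, exp (- s) *\<^sub>R (fst (snd u) - fst u *\<^sub>R snd (snd z)), (1 / \<nu> s) *\<^sub>R snd (snd u))"

lemma bounded_linear_Lin: "bounded_linear (Lin s z :: 'd::finite pt \<Rightarrow> 'd pt)"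
  unfolding linear_conv_bounded_linear[symmetric]
  by (rule linearI)
     (simp_all add: Lin_def add_divide_distrib algebra_simps)

lemma M_affine: "M s z w = Lin s z w + M s z 0"
  by (simp add: M_def Lin_def algebra_simps diff_divide_distrib)

text \<open>Radius of a ball around \<open>z\<close> that contains its cell. It grows with the
  velocity of \<open>z\<close> because of the drift, so the cells are not bounded uniformly in
  \<open>z\<close>.\<close>

definition reach :: "real \<Rightarrow> 'd::finite pt \<Rightarrow> real" where
  "reach s z = \<tau> s + exp s + \<tau> s * norm (snd (snd z)) + \<nu> s"

lemma M_bounds:
  assumes "norm (M s z w) \<le> 1"
  shows "\<bar>fst w - fst z\<bar> \<le> \<tau> s"
    "norm (fst (snd w) - fst (snd z)) \<le> exp s + \<tau> s * norm (snd (snd z))"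
    "norm (snd (snd w) - snd (snd z)) \<le> \<nu> s"
    "norm (w - z) \<le> reach s z"
proof -
  have f: "norm (fst (M s z w)) \<le> 1" and g: "norm (fst (snd (M s z w))) \<le> 1" and h: "norm (snd (snd (M s z w))) \<le> 1"
    using assms norm_fst_le[of "fst (M s z w)" "snd (M s z w)"] norm_snd_le[of "snd (M s z w)" "fst (M s z w)"]
      norm_fst_le[of "fst (snd (M s z w))" "snd (snd (M s z w))"]
      norm_snd_le[of "snd (snd (M s z w))" "fst (snd (M s z w))"] by simp_all
  show 1: "\<bar>fst w - fst z\<bar> \<le> \<tau> s" using f by (simp add: M_def abs_divide field_simps)
  show 3: "norm (snd (snd w) - snd (snd z)) \<le> \<nu> s" using h by (simp add: M_def divide_le_eq)
  have "norm (fst (snd w) - fst (snd z) - (fst w - fst z) *\<^sub>R snd (snd z)) \<le> exp s"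
    using g by (simp add: M_def exp_minus inverse_eq_divide divide_le_eq)
  then have "norm (fst (snd w) - fst (snd z)) \<le> exp s + norm ((fst w - fst z) *\<^sub>R snd (snd z))"
    using norm_triangle_sub[of "fst (snd w) - fst (snd z)" "(fst w - fst z) *\<^sub>R snd (snd z)"] by simp
  also have "\<dots> \<le> exp s + \<tau> s * norm (snd (snd z))"
    using 1 by (simp add: mult_right_mono)
  finally show 2: "norm (fst (snd w) - fst (snd z)) \<le> exp s + \<tau> s * norm (snd (snd z))" .
  have "norm (w - z) \<le> norm (fst (w - z)) + (norm (fst (snd (w - z))) + norm (snd (snd (w - z))))"
    using norm_Pair_le[of "fst (w - z)" "snd (w - z)"] norm_Pair_le[of "fst (snd (w - z))" "snd (snd (w - z))"]
    unfolding prod.collapse by linarith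
  then show "norm (w - z) \<le> reach s z" using 1 2 3 by (simp add: reach_def)
qed

lemma M_indicator_le:
  "indicator (cball 0 1) (M s z w) \<le> (indicator (cball 0 (norm z + reach s z)) w :: real)"
proof (cases "norm (M s z w) \<le> 1")
  case True
  have "norm w \<le> norm z + norm (w - z)" using norm_triangle_sub by blast
  then show ?thesis using M_bounds(4)[OF True] True by (auto simp: indicator_def)
qed (simp add: indicator_def)

lemma test_fun_M:
  fixes g :: "'d::finite pt \<Rightarrow> real"
  assumes C: "\<And>j. Ck j g" and supp: "\<And>y. norm y \<ge> 1 \<Longrightarrow> g y = 0"
  shows "test_fun (\<lambda>w. g (M s z w))"
  unfolding test_fun_def smooth_def
proof (intro conjI allI)
  fix j show "Ck j (\<lambda>w. g (M s z w))"
    by (subst M_affine) (intro Ck_affine C bounded_linear_Lin)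
next
  have "{w. g (M s z w) \<noteq> 0} \<subseteq> cball z (reach s z)"
  proof
    fix w assume "w \<in> {w. g (M s z w) \<noteq> 0}"
    then have "norm (M s z w) \<le> 1" using supp[of "M s z w"] by (cases "norm (M s z w) \<le> 1") auto
    then show "w \<in> cball z (reach s z)" using M_bounds(4)[of s z w] by (simp add: dist_norm norm_minus_commute)
  qed
  then have "bounded {w. g (M s z w) \<noteq> 0}" using bounded_cball bounded_subset by blast
  then show "compact (closure {w. g (M s z w) \<noteq> 0})" by (simp add: compact_closure)
qed

lemma frechet_derivative_M:
  fixes g :: "'d::finite pt \<Rightarrow> real"
  assumes C: "\<And>j. Ck j g"
  shows "frechet_derivative (\<lambda>w. g (M s z w)) (at w) u = frechet_derivative g (at (M s z w)) (Lin s z u)"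
proof -
  have "(M s z has_derivative Lin s z) (at w)"
  proof -
    have "((\<lambda>w. Lin s z w + M s z 0) has_derivative Lin s z) (at w)"
      using has_derivative_add_const[OF bounded_linear_imp_has_derivative[OF bounded_linear_Lin]] .
    then show ?thesis by (simp flip: M_affine)
  qed
  moreover have "(g has_derivative frechet_derivative g (at (M s z w))) (at (M s z w))"
    by (rule Ck_has_derivative[OF C])
  ultimately have "((\<lambda>w. g (M s z w)) has_derivative (\<lambda>u. frechet_derivative g (at (M s z w)) (Lin s z u))) (at w)"
    by (rule has_derivative_compose)
  from frechet_derivative_at[OF this] show ?thesis by metis
qed

text \<open>Here the relation \<open>\<tau> s * \<nu> s = exp s\<close> pays off: along
  \<open>Y\<close> the spatial coordinate moves by \<open>exp (- s)\<close> times the difference of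
  the velocities, which is \<open>1 / \<tau> s\<close> times the rescaled velocity exactly when the
  spatial scale is this product.\<close>

lemma Lin_Y: "Lin s z (1, snd (snd w), 0) = (1 / \<tau> s) *\<^sub>R (1, snd (snd (M s z w)), 0)"
proof -
  have "exp (- s) = 1 / \<tau> s * (1 / \<nu> s)"
    using \<tau>\<nu>[of s] by (simp add: exp_minus field_simps)
  then show ?thesis by (simp add: Lin_def M_def algebra_simps)
qed

lemma Lin_v: "Lin s z (0, 0, e) = (1 / \<nu> s) *\<^sub>R (0, 0, e)"
  by (simp add: Lin_def)

lemma linear_frechet_Ck: "(\<And>j. Ck j g) \<Longrightarrow> linear (frechet_derivative g (at y))"
  by (rule has_derivative_linear[OF Ck_has_derivative[of 0]])

lemma continuous_on_M: "continuous_on UNIV (M s z)"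
  unfolding M_def[abs_def] by (intro continuous_intros) auto

lemma continuous_on_comp_M: "continuous_on UNIV g \<Longrightarrow> continuous_on UNIV (\<lambda>w. g (M s z w))"
  using continuous_on_M continuous_on_compose2 by blast

lemma measurable_comp_M: "continuous_on UNIV g \<Longrightarrow> (\<lambda>w. g (M s z w)) \<in> borel_measurable borel"
  by (intro borel_measurable_continuous_onI continuous_on_comp_M)

lemma integrable_inner_comp_M:
  fixes f :: "'d::finite pt \<Rightarrow> 'b::euclidean_space"
  assumes f: "loc_integrable f" and g: "continuous_on UNIV g" "\<And>y. norm y \<ge> 1 \<Longrightarrow> g y = 0"
  shows "integrable lborel (\<lambda>w. f w \<bullet> g (M s z w))"
proof -
  obtain K where K: "K \<ge> 0" "\<And>y. norm (g y) \<le> K * indicator (cball 0 1) y"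
    using continuous_unit_support_bounded[OF g] by blast
  have [measurable]: "f \<in> borel_measurable borel" using f by (rule loc_integrable_measurable)
  have [measurable]: "(\<lambda>w. g (M s z w)) \<in> borel_measurable borel" by (rule measurable_comp_M[OF g(1)])
  show ?thesis
  proof (rule integrable_dominated_loc[OF f, where K=K and R="norm z + reach s z"])
    fix w
    have "\<bar>f w \<bullet> g (M s z w)\<bar> \<le> norm (f w) * norm (g (M s z w))" by (rule Cauchy_Schwarz_ineq2)
    also have "\<dots> \<le> norm (f w) * (K * indicator (cball 0 (norm z + reach s z)) w)"
      by (intro mult_left_mono order_trans[OF K(2)] M_indicator_le K(1)) auto
    finally show "\<bar>f w \<bullet> g (M s z w)\<bar> \<le> K * norm (f w) * indicator (cball 0 (norm z + reach s z)) w"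
      by (simp add: mult_ac)
  qed measurable
qed

lemma integrable_mult_comp_M:
  fixes f :: "'d::finite pt \<Rightarrow> real"
  assumes f: "loc_integrable f" and g: "continuous_on UNIV g" "\<And>y. norm y \<ge> 1 \<Longrightarrow> g y = 0"
  shows "integrable lborel (\<lambda>w. f w * g (M s z w))"
  using integrable_inner_comp_M[OF assms] by simp

text \<open>Composed with \<open>M s z\<close>, the potentials are admissible test functions.
  Undoing the rescaling of \<open>Y\<close> costs \<open>\<tau> s\<close>, and the
  \<open>v\<close>-gradient that the equation puts on the test function gains
  \<open>1 / \<nu> s\<close>; for the divergence part, undoing the rescaling of the
  \<open>v\<close>-derivative costs \<open>\<nu> s\<close>, and the derivative then falls on
  \<open>f\<close>.\<close>

lemma integral_dil:
  fixes f :: "'d::finite pt \<Rightarrow> real" and G S :: "'d pt \<Rightarrow> real^'d"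
  assumes f: "loc_integrable f" and G: "loc_integrable G" and S: "loc_integrable S"
    and wg: "weak_grad_v f G" and ke: "kinetic_eq f S"
  shows "(\<integral>w. f w * dil (M s z w) \<partial>lborel) =
    \<tau> s / \<nu> s * (\<integral>w. S w \<bullet> bpot_v (M s z w) \<partial>lborel) - \<nu> s * (\<integral>w. G w \<bullet> apot (M s z w) \<partial>lborel)"
proof -
  let ?Ga = "\<lambda>e w. (G w \<bullet> e) * (apot (M s z w) \<bullet> e)" and ?fa = "\<lambda>e w. f w * apot_v e (M s z w)"
  note meas [measurable] = f[THEN loc_integrable_measurable] G[THEN loc_integrable_measurable] S[THEN loc_integrable_measurable]
  note [measurable] = potentials_continuous[of UNIV, THEN measurable_comp_M]
  have leb: "integral\<^sup>L lebesgue g = integral\<^sup>L lborel g" if "g \<in> borel_measurable borel" for g :: "'d pt \<Rightarrow> real"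
    using that by (intro integral_completion) simp
  have Y: "(\<integral>w. f w * bpot_Y (M s z w) \<partial>lborel) = \<tau> s / \<nu> s * (\<integral>w. S w \<bullet> bpot_v (M s z w) \<partial>lborel)"
  proof -
    let ?g = "\<lambda>w. bpot (M s z w)"
    have D1: "frechet_derivative ?g (at w) (1, snd (snd w), 0) = bpot_Y (M s z w) / \<tau> s" for w
      unfolding frechet_derivative_M[OF Ck_bpot] Lin_Y linear_scale[OF linear_frechet_Ck[OF Ck_bpot]] bpot_derivative_Y by simp
    have D2: "frechet_derivative ?g (at w) (0, 0, e) = (bpot_v (M s z w) \<bullet> e) / \<nu> s" for w e
      unfolding frechet_derivative_M[OF Ck_bpot] Lin_v linear_scale[OF linear_frechet_Ck[OF Ck_bpot]] bpot_derivative_v by simp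
    have "test_fun ?g" by (rule test_fun_M[OF Ck_bpot potentials_eq_0(1)])
    then have "(\<integral>w. f w * (bpot_Y (M s z w) / \<tau> s) \<partial>lebesgue) = (\<integral>w. (bpot_v (M s z w) \<bullet> S w) / \<nu> s \<partial>lebesgue)"
      using ke unfolding kinetic_eq_def D1[symmetric] D2[symmetric] by blast
    then have "(\<integral>w. f w * bpot_Y (M s z w) / \<tau> s \<partial>lborel) = (\<integral>w. (S w \<bullet> bpot_v (M s z w)) / \<nu> s \<partial>lborel)"
      by (simp add: leb inner_commute)
    then show ?thesis by (simp add: field_simps)
  qed
  have A: "(\<integral>w. ?fa e w \<partial>lborel) = - \<nu> s * (\<integral>w. ?Ga e w \<partial>lborel)" for e
  proof -
    let ?g = "\<lambda>w. apot (M s z w) \<bullet> e"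
    have D: "frechet_derivative ?g (at w) (0, 0, e) = apot_v e (M s z w) / \<nu> s" for w
      unfolding frechet_derivative_M[OF Ck_apot] Lin_v linear_scale[OF linear_frechet_Ck[OF Ck_apot]] apot_derivative_v by simp
    have "test_fun ?g" by (rule test_fun_M[OF Ck_apot]) (simp add: potentials_eq_0)
    then have "(\<integral>w. f w * (apot_v e (M s z w) / \<nu> s) \<partial>lebesgue) = - (\<integral>w. ?Ga e w \<partial>lebesgue)"
      using wg unfolding weak_grad_v_def D[symmetric] by blast
    then have "(\<integral>w. ?fa e w / \<nu> s \<partial>lborel) = - (\<integral>w. ?Ga e w \<partial>lborel)"
      by (simp add: leb)
    then show ?thesis by (simp add: field_simps)
  qed
  have iA: "integrable lborel (\<lambda>w. ?fa e w)" for e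
    by (rule integrable_mult_comp_M[OF f potentials_continuous(5) potentials_eq_0(5)])
  have iY: "integrable lborel (\<lambda>w. f w * bpot_Y (M s z w))"
    by (rule integrable_mult_comp_M[OF f potentials_continuous(2) potentials_eq_0(2)])
  have iG: "integrable lborel (\<lambda>w. ?Ga e w)" for e
  proof -
    have "integrable lborel (\<lambda>w. G w \<bullet> (\<lambda>y. (apot y \<bullet> e) *\<^sub>R e) (M s z w))"
      by (intro integrable_inner_comp_M[OF G] continuous_intros potentials_continuous) (simp add: potentials_eq_0)
    then show ?thesis by (simp add: mult.commute)
  qed
  have "(\<integral>w. f w * dil (M s z w) \<partial>lborel) = (\<integral>w. f w * bpot_Y (M s z w) + (\<Sum>e\<in>Basis. ?fa e w) \<partial>lborel)"
    by (simp add: dil_decomposition distrib_left sum_distrib_left)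
  also have "\<dots> = (\<integral>w. f w * bpot_Y (M s z w) \<partial>lborel) + (\<Sum>e\<in>Basis. \<integral>w. ?fa e w \<partial>lborel)"
    using iA iY by simp
  also have "(\<Sum>e\<in>Basis. \<integral>w. ?fa e w \<partial>lborel) = - \<nu> s * (\<Sum>e\<in>Basis. \<integral>w. ?Ga e w \<partial>lborel)"
    unfolding A by (simp add: sum_distrib_left)
  also have "(\<Sum>e\<in>Basis. \<integral>w. ?Ga e w \<partial>lborel) = (\<integral>w. (\<Sum>e\<in>Basis. ?Ga e w) \<partial>lborel)"
    using iG by simp
  also have "\<dots> = (\<integral>w. G w \<bullet> apot (M s z w) \<partial>lborel)"
    by (intro Bochner_Integration.integral_cong refl) (rule euclidean_inner[symmetric])
  finally show ?thesis unfolding Y by simp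
qed

end

section \<open>Increments of the averages\<close>

text \<open>The minimum covers both regimes: Lipschitz continuity when the displacement is small,
  mere boundedness otherwise. The two indicators keep the estimate localised to the cells of both
  points, so that averages of the data appear.\<close>

definition kernel_increment :: "real \<Rightarrow> ('a::euclidean_space \<Rightarrow> 'b::euclidean_space) \<Rightarrow> bool" where
  "kernel_increment K g \<longleftrightarrow> (\<forall>y y'. norm (g y - g y') \<le>
     K * min 1 (norm (y - y')) * (indicator (cball 0 1) y + indicator (cball 0 1) y'))"

lemma C1_kernel_increment:
  fixes g :: "'a::euclidean_space \<Rightarrow> 'b::euclidean_space"
  assumes C: "\<And>e. Ck (Suc 0) (\<lambda>y. g y \<bullet> e)" and supp: "\<And>y. norm y \<ge> 1 \<Longrightarrow> g y = 0"
  obtains K where "K \<ge> 0"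
    "kernel_increment K g"
proof -
  have "\<exists>K\<ge>0. (\<forall>y y'. \<bar>g y \<bullet> e - g y' \<bullet> e\<bar> \<le> K * norm (y - y')) \<and> (\<forall>y. \<bar>g y \<bullet> e\<bar> \<le> K)" for e
    by (rule C1_compact_support_Lipschitz[OF C[of e]]) (auto simp: supp)
  then obtain K where K0: "\<And>e. K e \<ge> 0" and K1: "\<And>e y y'. \<bar>g y \<bullet> e - g y' \<bullet> e\<bar> \<le> K e * norm (y - y')"
    and K2: "\<And>e y. \<bar>g y \<bullet> e\<bar> \<le> K e" by metis
  \<comment> \<open>The factor 2 is for the difference of two values, each bounded by
    \<open>K e\<close>; it is harmless in the Lipschitz bound.\<close>
  define L where "L = (\<Sum>e\<in>Basis. 2 * K e)"
  have "L \<ge> 0" unfolding L_def using K0 by (simp add: sum_nonneg)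
  moreover have "norm (g y - g y') \<le> L * min 1 (norm (y - y')) * (indicator (cball 0 1) y + indicator (cball 0 1) y')" for y y'
  proof (cases "norm y \<le> 1 \<or> norm y' \<le> 1")
    case True
    have "norm (g y - g y') \<le> (\<Sum>e\<in>Basis. \<bar>(g y - g y') \<bullet> e\<bar>)" by (rule norm_le_l1)
    also have "\<dots> \<le> (\<Sum>e\<in>Basis. 2 * K e * min 1 (norm (y - y')))"
    proof (rule sum_mono)
      fix e :: 'b
      have "\<bar>(g y - g y') \<bullet> e\<bar> \<le> 2 * K e" using K2[of y e] K2[of y' e] by (simp add: inner_diff_left)
      moreover have "\<bar>(g y - g y') \<bullet> e\<bar> \<le> K e * norm (y - y')" using K1[of y e y'] by (simp add: inner_diff_left)
      moreover have "K e * norm (y - y') \<le> 2 * K e * norm (y - y')" using K0[of e] by (simp add: mult_right_mono)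
      ultimately show "\<bar>(g y - g y') \<bullet> e\<bar> \<le> 2 * K e * min 1 (norm (y - y'))" by (auto simp: min_def)
    qed
    also have "\<dots> = L * min 1 (norm (y - y'))" by (simp add: L_def sum_distrib_right)
    also have "\<dots> \<le> L * min 1 (norm (y - y')) * (indicator (cball 0 1) y + indicator (cball 0 1) y')"
      using True \<open>L \<ge> 0\<close> by (auto simp: indicator_def mult_le_cancel_left1 not_less)
    finally show ?thesis .
  qed (use \<open>L \<ge> 0\<close> supp in auto)
  ultimately show thesis using that unfolding kernel_increment_def by blast
qed

lemma kernel_increment_mono:
  assumes "kernel_increment K g" "K \<le> L" shows "kernel_increment L g"
  unfolding kernel_increment_def
proof (intro allI)
  fix y y' :: 'a
  have "K * min 1 (norm (y - y')) * (indicator (cball 0 1) y + indicator (cball 0 1) y')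
      \<le> L * min 1 (norm (y - y')) * (indicator (cball 0 1) y + indicator (cball 0 1) y')"
    using assms(2) by (intro mult_right_mono) auto
  then show "norm (g y - g y') \<le> L * min 1 (norm (y - y')) * (indicator (cball 0 1) y + indicator (cball 0 1) y')"
    using assms(1) order_trans unfolding kernel_increment_def by blast
qed

lemma ennreal_mult_plus_mult:
  "a \<ge> 0 \<Longrightarrow> b \<ge> 0 \<Longrightarrow> x \<ge> 0 \<Longrightarrow> y \<ge> 0 \<Longrightarrow>
    ennreal (a * x + b * y) = ennreal a * ennreal x + ennreal b * ennreal y"
  by (simp add: ennreal_mult)

section \<open>The averages as functions of the scale\<close>

context kinetic_scaling begin

text \<open>As \<open>s\<close> grows, the time, space and velocity coordinates contract at the
  rates \<open>\<beta>\<close>, 1 and \<open>\<gamma>\<close>.\<close>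

lemma M_inner_DERIV:
  "((\<lambda>s. M s z w \<bullet> M s z w) has_real_derivative
     - 2 * (\<beta> * fst (M s z w) * fst (M s z w) + fst (snd (M s z w)) \<bullet> fst (snd (M s z w))
        + \<gamma> * (snd (snd (M s z w)) \<bullet> snd (snd (M s z w))))) (at s)"
proof -
  define a where "a = fst w - fst z"
  define b where "b = fst (snd w) - fst (snd z) - a *\<^sub>R snd (snd z)"
  define c where "c = snd (snd w) - snd (snd z)"
  have Me: "M s z w = (a * exp (- (k + \<beta> * s)), exp (- s) *\<^sub>R b, exp (k - \<gamma> * s) *\<^sub>R c)" for s
    by (simp add: M_def a_def b_def c_def \<tau>_def \<nu>_def exp_minus exp_diff exp_add field_simps)
  show ?thesis unfolding Me
    by (auto intro!: derivative_eq_intros simp: inner_prod_def algebra_simps)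
qed

text \<open>This is the origin of \<open>dil\<close>: the normalisation \<open>1 / V\<close>
  contributes the zeroth-order term and the bump the first-order ones. The minus sign lets the
  smaller scale appear with a plus sign after integration.\<close>

lemma scaled_bump_DERIV:
  fixes z w :: "'d::finite pt"
  shows "((\<lambda>s. - (1 / V (real CARD('d)) s * bump 0 (M s z w))) has_real_derivative
    1 / V (real CARD('d)) s * dil (M s z w)) (at s)"
proof -
  let ?n = "real CARD('d)"
  let ?W = "\<beta> * (1 + ?n) + 2 * ?n * \<gamma>"
  let ?N = "\<beta> * fst (M s z w) * fst (M s z w) + fst (snd (M s z w)) \<bullet> fst (snd (M s z w))
        + \<gamma> * (snd (snd (M s z w)) \<bullet> snd (snd (M s z w)))"
  have V: "1 / V ?n s = exp (- ((1 - ?n) * k + ?W * s))" for s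
    by (simp only: V_def exp_minus inverse_eq_divide)
  have DV: "((\<lambda>s. 1 / V ?n s) has_real_derivative 1 / V ?n s * (- ?W)) (at s)"
    unfolding V by (auto intro!: derivative_eq_intros)
  have "((\<lambda>s. 1 - M s z w \<bullet> M s z w) has_real_derivative 2 * ?N) (at s)"
    by (auto intro!: derivative_eq_intros M_inner_DERIV)
  from DERIV_chain2[OF bump_profile_DERIV[of 0] this]
  have "((\<lambda>s. bump 0 (M s z w)) has_real_derivative bump 2 (M s z w) * (2 * ?N)) (at s)"
    unfolding bump_def by (simp add: numeral_2_eq_2)
  from DERIV_minus[OF DERIV_mult[OF DV this]]
  show ?thesis unfolding dil_def by (rule DERIV_cong) (simp add: algebra_simps)
qed

lemma continuous_V: "continuous_on A (V n)"
  unfolding V_def[abs_def] by (intro continuous_intros)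

lemma integral_scaled_dil:
  fixes z w :: "'d::finite pt"
  assumes "a \<le> b"
  shows "(\<integral>s. (1 / V (real CARD('d)) s * dil (M s z w)) * indicator {a..b} s \<partial>lborel)
    = 1 / V (real CARD('d)) a * bump 0 (M a z w) - 1 / V (real CARD('d)) b * bump 0 (M b z w)"
proof -
  have "continuous_on UNIV (\<lambda>s. M s z w)"
    unfolding M_def \<tau>_def \<nu>_def by (intro continuous_intros) auto
  then have "continuous_on UNIV (\<lambda>s. 1 / V (real CARD('d)) s * dil (M s z w))"
    by (intro continuous_intros continuous_V continuous_on_compose2[OF potentials_continuous(6)]) auto
  then have "isCont (\<lambda>s. 1 / V (real CARD('d)) s * dil (M s z w)) s" for s
    by (simp add: continuous_on_eq_continuous_at)
  from integral_FTC_Icc_real[OF assms scaled_bump_DERIV this]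
  show ?thesis by simp
qed

definition Fav :: "real \<Rightarrow> ('d::finite pt \<Rightarrow> real) \<Rightarrow> 'd pt \<Rightarrow> real" where
  "Fav s f z = 1 / V (real CARD('d)) s * (\<integral>w. f w * bump 0 (M s z w) \<partial>lborel)"

lemma V_mono: "a \<le> s \<Longrightarrow> n \<ge> 0 \<Longrightarrow> V n a \<le> V n s"
  using \<beta> \<gamma> by (simp add: V_def mult_left_mono)

lemma reach_mono: "s \<le> b \<Longrightarrow> reach s z \<le> reach b z"
  using \<beta> \<gamma> unfolding reach_def \<tau>_def \<nu>_def by (intro add_mono mult_right_mono) (auto simp: mult_left_mono)

lemma V_measurable [measurable]: "V n \<in> borel_measurable borel"
  by (intro borel_measurable_continuous_onI continuous_V)

lemma dil_measurable [measurable]: "(dil :: 'd::finite pt \<Rightarrow> real) \<in> borel_measurable borel"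
  by (intro borel_measurable_continuous_onI potentials_continuous)

text \<open>For scales in the compact range \<open>{a..b}\<close> all cells lie in one ball,
  governed by \<open>reach b z\<close>, and \<open>1 / V\<close> is at most its value at
  \<open>a\<close>; local integrability of \<open>f\<close> then justifies Fubini.\<close>

lemma integrable_scaled_dil:
  fixes f :: "'d::finite pt \<Rightarrow> real"
  assumes f: "loc_integrable f"
  shows "integrable (lborel \<Otimes>\<^sub>M lborel)
    (\<lambda>(w, s). f w * ((1 / V (real CARD('d)) s * dil (M s z w)) * indicator {a..b} s))"
proof (rule integrableI_bounded)
  let ?n = "real CARD('d)"
  let ?h = "\<lambda>w s. f w * ((1 / V ?n s * dil (M s z w)) * indicator {a..b} s)"
  have [measurable]: "f \<in> borel_measurable borel" using f by (rule loc_integrable_measurable)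
  have [measurable]: "(\<lambda>x. M (snd x) z (fst x)) \<in> borel_measurable (borel \<Otimes>\<^sub>M borel)" by measurable
  have [measurable]: "(\<lambda>x. dil (M (snd x) z (fst x))) \<in> borel_measurable (borel \<Otimes>\<^sub>M borel)"
    by (rule measurable_compose[OF _ dil_measurable]) measurable
  show meas: "(\<lambda>(w, s). ?h w s) \<in> borel_measurable (lborel \<Otimes>\<^sub>M lborel)"
    unfolding case_prod_beta by measurable
  obtain K where K: "K \<ge> 0" "\<And>y. norm (dil y) \<le> K * indicator (cball 0 1) (y :: 'd pt)"
    using continuous_unit_support_bounded[OF potentials_continuous(6) potentials_eq_0(6)] by blast
  define R where "R = norm z + reach b z"
  let ?u = "\<lambda>w. ennreal (norm (f w)) * indicator (cball 0 R) w" and ?c = "\<lambda>s. ennreal (K / V ?n a) * indicator {a..b} s"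
  have bd: "ennreal \<bar>?h w s\<bar>
      \<le> ?u w * ?c s" for w s
  proof (cases "s \<in> {a..b}")
    case True
    have "\<bar>dil (M s z w)\<bar> \<le> K * indicator (cball 0 R) w"
    proof -
      have "indicator (cball 0 (norm z + reach s z)) w \<le> (indicator (cball 0 R) w :: real)"
        using reach_mono[of s b z] True by (auto simp: indicator_def R_def)
      then have "indicator (cball 0 1) (M s z w) \<le> (indicator (cball 0 R) w :: real)"
        using M_indicator_le[of s z w] by linarith
      then show ?thesis using K(2)[of "M s z w"] mult_left_mono[OF _ K(1)] by fastforce
    qed
    moreover have "1 / V ?n s \<le> 1 / V ?n a" using V_mono[of a s ?n] True by (simp add: frac_le)
    ultimately have "\<bar>f w\<bar> * (1 / V ?n s * \<bar>dil (M s z w)\<bar>) \<le> \<bar>f w\<bar> * (1 / V ?n a * (K * indicator (cball 0 R) w))"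
      by (intro mult_left_mono mult_mono) (auto simp: less_imp_le)
    then show ?thesis
      using True K(1) \<open>\<bar>dil (M s z w)\<bar> \<le> K * indicator (cball 0 R) w\<close>
      by (cases "w \<in> cball 0 R") (auto simp: abs_mult ennreal_mult[symmetric] less_imp_le)
  qed simp
  have "(\<integral>\<^sup>+x. ennreal (norm (case x of (w, s) \<Rightarrow> ?h w s)) \<partial>(lborel \<Otimes>\<^sub>M lborel))
    \<le> (\<integral>\<^sup>+x. ?u (fst x) * ?c (snd x) \<partial>(lborel \<Otimes>\<^sub>M lborel))"
    using bd by (intro nn_integral_mono) (auto simp: case_prod_beta)
  also have "\<dots> = (\<integral>\<^sup>+w. \<integral>\<^sup>+s. ?u w * ?c s \<partial>lborel \<partial>lborel)"
    by (subst lborel.nn_integral_fst[symmetric]) (simp, measurable)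
  also have "\<dots> = integral\<^sup>N lborel ?u * (ennreal (K / V ?n a) * emeasure lborel {a..b})"
    by (simp add: nn_integral_cmult nn_integral_multc)
  also have "\<dots> < \<infinity>" using f by (simp add: loc_integrable_def ennreal_mult_less_top emeasure_lborel_Icc_eq)
  finally show "(\<integral>\<^sup>+x. ennreal (norm (case x of (w, s) \<Rightarrow> ?h w s)) \<partial>(lborel \<Otimes>\<^sub>M lborel)) < \<infinity>" .
qed

text \<open>Integrating in \<open>s\<close> before \<open>w\<close> reduces the identity to the
  fundamental theorem of calculus for the kernel alone.\<close>

lemma Fav_diff:
  fixes f :: "'d::finite pt \<Rightarrow> real" and z :: "'d pt"
  assumes f: "loc_integrable f" and "a \<le> b"
  defines "D \<equiv> (\<lambda>s. (1 / V (real CARD('d)) s * (\<integral>w. f w * dil (M s z w) \<partial>lborel)) * indicator {a..b} s)"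
  shows "Fav a f z - Fav b f z = (\<integral>s. D s \<partial>lborel)" "integrable lborel D"
proof -
  let ?n = "real CARD('d)"
  let ?g = "\<lambda>w s. f w * ((1 / V ?n s * dil (M s z w)) * indicator {a..b} s)"
  note int = integrable_scaled_dil[OF f, of z a b]
  have Deq: "(\<integral>w. ?g w s \<partial>lborel) = D s" for s
  proof -
    have "(\<integral>w. ?g w s \<partial>lborel) = (\<integral>w. (1 / V ?n s * indicator {a..b} s) * (f w * dil (M s z w)) \<partial>lborel)"
      by (intro Bochner_Integration.integral_cong refl) (simp add: mult_ac)
    also have "\<dots> = (1 / V ?n s * indicator {a..b} s) * (\<integral>w. f w * dil (M s z w) \<partial>lborel)"
      by (rule integral_mult_right_zero)
    finally show ?thesis by (simp only: D_def mult_ac)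
  qed
  have "integrable lborel (\<lambda>s. \<integral>w. ?g w s \<partial>lborel)"
    using lborel_pair.integrable_snd[OF int] .
  then show "integrable lborel D" by (simp only: Deq)
  have "(\<integral>s. D s \<partial>lborel) = (\<integral>s. \<integral>w. ?g w s \<partial>lborel \<partial>lborel)" by (simp only: Deq)
  also have "\<dots> = (\<integral>w. \<integral>s. ?g w s \<partial>lborel \<partial>lborel)"
    using lborel_pair.Fubini_integral[OF int] .
  also have "\<dots> = (\<integral>w. f w * (1 / V ?n a * bump 0 (M a z w) - 1 / V ?n b * bump 0 (M b z w)) \<partial>lborel)"
    by (intro Bochner_Integration.integral_cong refl) (simp only: integral_mult_right_zero integral_scaled_dil[OF \<open>a \<le> b\<close>])
  also have "\<dots> = (\<integral>w. 1 / V ?n a * (f w * bump 0 (M a z w)) - 1 / V ?n b * (f w * bump 0 (M b z w)) \<partial>lborel)"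
    by (intro Bochner_Integration.integral_cong refl) (simp add: algebra_simps)
  also have "\<dots> = Fav a f z - Fav b f z"
  proof -
    have "integrable lborel (\<lambda>w. f w * bump 0 (M s z w))" for s
      by (rule integrable_mult_comp_M[OF f continuous_on_bump bump_eq_0])
    then show ?thesis unfolding Fav_def by (subst Bochner_Integration.integral_diff) auto
  qed
  finally show "Fav a f z - Fav b f z = (\<integral>s. D s \<partial>lborel)" by simp
qed

text \<open>Shifting the base point in \<open>x\<close> alone leaves the drift untouched, so the
  kinetic coordinates undergo a pure translation. Its length \<open>norm h * exp (- s)\<close> is
  what the increments of the kernels see.\<close>

lemma M_shift: "M s (z + (0, h, 0)) w = M s z w - (0, exp (- s) *\<^sub>R h, 0)"
  by (simp add: M_def algebra_simps)

lemma kernel_increment_le: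
  fixes S :: "'d::finite pt \<Rightarrow> real^'d" and \<kappa> :: "'d pt \<Rightarrow> real^'d"
  assumes S: "loc_integrable S" and \<kappa>: "continuous_on UNIV \<kappa>" "\<And>y. norm y \<ge> 1 \<Longrightarrow> \<kappa> y = 0"
    and K: "K \<ge> 0" "kernel_increment K \<kappa>"
  shows "ennreal (1 / V (real CARD('d)) s * \<bar>(\<integral>w. S w \<bullet> \<kappa> (M s (z + (0, h, 0)) w) \<partial>lborel) - (\<integral>w. S w \<bullet> \<kappa> (M s z w) \<partial>lborel)\<bar>)
    \<le> ennreal (K * min 1 (norm h * exp (- s))) * (avg s (nrm S) (z + (0, h, 0)) + avg s (nrm S) z)"
proof -
  let ?z = "z + (0, h, 0)" and ?n = "real CARD('d)" and ?m = "K * min 1 (norm h * exp (- s))"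
  let ?I = "\<lambda>z. \<integral>w. S w \<bullet> \<kappa> (M s z w) \<partial>lborel" and ?d = "\<lambda>w. S w \<bullet> (\<kappa> (M s ?z w) - \<kappa> (M s z w))"
  let ?r = "\<lambda>z w. indicator (cball 0 1) (M s z w) * ennreal (norm (S w))"
  have [measurable]: "S \<in> borel_measurable borel" using S by (rule loc_integrable_measurable)
  note [measurable] = measurable_comp_M[OF \<kappa>(1)]
  have m0: "?m \<ge> 0" using K(1) by simp
  have i: "integrable lborel (\<lambda>w. S w \<bullet> \<kappa> (M s z w))" for z
    by (rule integrable_inner_comp_M[OF S \<kappa>])
  have "?I ?z - ?I z = (\<integral>w. ?d w \<partial>lborel)"
    using i[of ?z] i[of z] by (simp add: inner_diff_right)
  then have "ennreal \<bar>?I ?z - ?I z\<bar>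
     \<le> (\<integral>\<^sup>+w. ennreal \<bar>?d w\<bar> \<partial>lborel)"
    by (simp add: ennreal_norm_integral_le)
  also have "\<dots> \<le> (\<integral>\<^sup>+w. ennreal ?m * (?r ?z w + ?r z w) \<partial>lborel)"
  proof (intro nn_integral_mono)
    fix w
    have nn: "norm (M s ?z w - M s z w) = norm h * exp (- s)"
      unfolding M_shift by (simp add: norm_prod_def)
    have "\<bar>?d w\<bar> \<le> norm (S w) * norm (\<kappa> (M s ?z w) - \<kappa> (M s z w))"
      by (rule Cauchy_Schwarz_ineq2)
    also have "\<dots> \<le> norm (S w) * (?m * (indicator (cball 0 1) (M s ?z w) + indicator (cball 0 1) (M s z w)))"
      using K(2)[unfolded kernel_increment_def, rule_format, of "M s ?z w" "M s z w"] unfolding nn by (intro mult_left_mono) auto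
    finally have *: "\<bar>?d w\<bar> \<le> ?m * (indicator (cball 0 1) (M s ?z w) * norm (S w) + indicator (cball 0 1) (M s z w) * norm (S w))"
      by (simp add: algebra_simps)
    have ie: "indicator (cball 0 1) y * ennreal c = ennreal (indicator (cball 0 1) y * c)" for y :: "'d pt" and c
      by (simp add: indicator_def)
    have "ennreal \<bar>?d w\<bar> \<le> ennreal (?m * (indicator (cball 0 1) (M s ?z w) * norm (S w) + indicator (cball 0 1) (M s z w) * norm (S w)))"
      by (rule ennreal_leI[OF *])
    also have "\<dots> = ennreal ?m * (ennreal (indicator (cball 0 1) (M s ?z w) * norm (S w)) + ennreal (indicator (cball 0 1) (M s z w) * norm (S w)))"
      unfolding distrib_left using m0 by (intro ennreal_mult_plus_mult) auto
    finally show "ennreal \<bar>?d w\<bar> \<le> ennreal ?m * (?r ?z w + ?r z w)"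
      unfolding ie .
  qed
  finally have 1: "ennreal \<bar>?I ?z - ?I z\<bar> \<le> \<dots>" .
  have kernel_meas: "(\<lambda>w. ?r z w) \<in> borel_measurable lborel"
      "(\<lambda>w. ?r z' w + ?r z w) \<in> borel_measurable lborel" for z z'
    by measurable
  have av: "avg s (nrm S) z = ennreal (1 / V ?n s) * integral\<^sup>N lborel (?r z)" for z
    unfolding avg_def mult.assoc by (intro nn_integral_cmult) measurable
  have "ennreal (1 / V ?n s * \<bar>?I ?z - ?I z\<bar>)
    \<le> ennreal (1 / V ?n s) * (\<integral>\<^sup>+w. ennreal ?m * (?r ?z w + ?r z w) \<partial>lborel)"
    by (subst ennreal_mult) (auto intro!: mult_left_mono 1 simp: less_imp_le)
  also have "(\<integral>\<^sup>+w. ennreal ?m * (?r ?z w + ?r z w) \<partial>lborel)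
     = ennreal ?m * (integral\<^sup>N lborel (?r ?z) + integral\<^sup>N lborel (?r z))"
    by (simp only: nn_integral_cmult nn_integral_add kernel_meas)
  finally show ?thesis unfolding av distrib_left[symmetric] by (simp only: mult_ac)
qed

text \<open>A potential built from averages at all scales. The minimum is the smoothing gained from
  the increment; the weight \<open>\<omega>\<close> will be \<open>\<tau> / \<nu>\<close> for the
  source and \<open>\<nu>\<close> for the gradient.\<close>

definition pot :: "(real \<Rightarrow> real) \<Rightarrow> real^'d \<Rightarrow> ('d::finite pt \<Rightarrow> ennreal) \<Rightarrow> 'd pt \<Rightarrow> ennreal" where
  "pot \<omega> h F z = (\<integral>\<^sup>+s. ennreal (min 1 (norm h * exp (- s)) * \<omega> s) * avg s F z \<partial>lborel)"

text \<open>The right-hand side is free of \<open>a\<close> and \<open>b\<close>: once absolute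
  values are taken, the scale integral over \<open>{a..b}\<close> is bounded by the one over the
  whole line. This uniformity allows both scales to go to their limits.\<close>

lemma Fav_increment_le:
  fixes f :: "'d::finite pt \<Rightarrow> real" and G S :: "'d pt \<Rightarrow> real^'d" and h :: "real^'d"
  assumes f: "loc_integrable f" and G: "loc_integrable G" and S: "loc_integrable S"
    and wg: "weak_grad_v f G" and ke: "kinetic_eq f S"
    and K: "K \<ge> 0" "kernel_increment K (bpot_v :: 'd pt \<Rightarrow> _)"
      "kernel_increment K (apot :: 'd pt \<Rightarrow> _)"
    and "a \<le> b"
  defines "P \<equiv> (\<lambda>z. pot (\<lambda>s. \<tau> s / \<nu> s) h (nrm S) z + pot \<nu> h (nrm G) z)"
  shows "ennreal \<bar>(Fav a f (z + (0, h, 0)) - Fav a f z) - (Fav b f (z + (0, h, 0)) - Fav b f z)\<bar>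
    \<le> ennreal K * (P (z + (0, h, 0)) + P z)"
proof -
  let ?z = "z + (0, h, 0)" and ?n = "real CARD('d)" and ?m = "\<lambda>s. min 1 (norm h * exp (- s))"
  let ?PS = "pot (\<lambda>s. \<tau> s / \<nu> s) h (nrm S)" and ?PG = "pot \<nu> h (nrm G)"
  note [measurable] = f[THEN loc_integrable_measurable] G[THEN loc_integrable_measurable] S[THEN loc_integrable_measurable]
  have [measurable]: "\<tau> \<in> borel_measurable borel" "\<nu> \<in> borel_measurable borel"
    unfolding \<tau>_def[abs_def] \<nu>_def[abs_def] by measurable
  have avm [measurable]: "(\<lambda>s. avg s F z) \<in> borel_measurable borel" if "F \<in> borel_measurable borel" for F :: "'d pt \<Rightarrow> ennreal" and z
    using measurable_compose[OF _ avg_measurable[OF that], of "\<lambda>s. (s, z)" borel] by simp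
  let ?D = "\<lambda>z s. (1 / V ?n s * (\<integral>w. f w * dil (M s z w) \<partial>lborel)) * indicator {a..b} s"
  let ?AS = "\<lambda>s. avg s (nrm S) ?z + avg s (nrm S) z"
  let ?AG = "\<lambda>s. avg s (nrm G) ?z + avg s (nrm G) z"
  let ?cS = "\<lambda>s. ennreal (?m s * (\<tau> s / \<nu> s)) * ?AS s" and ?cG = "\<lambda>s. ennreal (?m s * \<nu> s) * ?AG s"
  have "(Fav a f ?z - Fav a f z) - (Fav b f ?z - Fav b f z) = (\<integral>s. ?D ?z s \<partial>lborel) - (\<integral>s. ?D z s \<partial>lborel)"
    using Fav_diff(1)[OF f \<open>a \<le> b\<close>, of ?z] Fav_diff(1)[OF f \<open>a \<le> b\<close>, of z] by simp
  also have "\<dots> = (\<integral>s. ?D ?z s - ?D z s \<partial>lborel)"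
    using Fav_diff(2)[OF f \<open>a \<le> b\<close>, of ?z] Fav_diff(2)[OF f \<open>a \<le> b\<close>, of z] by simp
  finally have "ennreal \<bar>(Fav a f ?z - Fav a f z) - (Fav b f ?z - Fav b f z)\<bar> \<le> (\<integral>\<^sup>+s. ennreal \<bar>?D ?z s - ?D z s\<bar> \<partial>lborel)"
    by (simp add: ennreal_norm_integral_le)
  also have "\<dots> \<le> (\<integral>\<^sup>+s. ennreal K * (?cS s + ?cG s) \<partial>lborel)"
  proof (intro nn_integral_mono)
    fix s
    let ?iS = "\<lambda>z. \<integral>w. S w \<bullet> bpot_v (M s z w) \<partial>lborel" and ?iG = "\<lambda>z. \<integral>w. G w \<bullet> apot (M s z w) \<partial>lborel"
    have "\<bar>?D ?z s - ?D z s\<bar> \<le> 1 / V ?n s * \<bar>(\<integral>w. f w * dil (M s ?z w) \<partial>lborel) - (\<integral>w. f w * dil (M s z w) \<partial>lborel)\<bar>"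
      by (auto simp: indicator_def abs_divide less_imp_le simp flip: diff_divide_distrib)
    also have "\<dots> = 1 / V ?n s * \<bar>\<tau> s / \<nu> s * (?iS ?z - ?iS z) - \<nu> s * (?iG ?z - ?iG z)\<bar>"
      unfolding integral_dil[OF f G S wg ke] by (simp add: right_diff_distrib)
    also have "\<dots> \<le> 1 / V ?n s * (\<tau> s / \<nu> s * \<bar>?iS ?z - ?iS z\<bar> + \<nu> s * \<bar>?iG ?z - ?iG z\<bar>)"
      by (intro mult_left_mono order_trans[OF abs_triangle_ineq4]) (auto simp: abs_mult less_imp_le)
    finally have "ennreal \<bar>?D ?z s - ?D z s\<bar> \<le> ennreal (\<tau> s / \<nu> s * (1 / V ?n s * \<bar>?iS ?z - ?iS z\<bar>) + \<nu> s * (1 / V ?n s * \<bar>?iG ?z - ?iG z\<bar>))"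
      by (intro ennreal_leI) (simp add: algebra_simps)
    also have "\<dots> = ennreal (\<tau> s / \<nu> s) * ennreal (1 / V ?n s * \<bar>?iS ?z - ?iS z\<bar>) + ennreal (\<nu> s) * ennreal (1 / V ?n s * \<bar>?iG ?z - ?iG z\<bar>)"
      by (intro ennreal_mult_plus_mult) (simp_all add: less_imp_le)
    also have "\<dots> \<le> ennreal (\<tau> s / \<nu> s) * (ennreal (K * ?m s) * ?AS s) + ennreal (\<nu> s) * (ennreal (K * ?m s) * ?AG s)"
      by (intro add_mono mult_left_mono kernel_increment_le S G K potentials_continuous potentials_eq_0) auto
    also have "\<dots> = ennreal K * (?cS s + ?cG s)"
    proof -
      have "ennreal c * (ennreal (K * m) * X) = ennreal K * (ennreal (m * c) * X)" if "c > 0" "m \<ge> 0" for c m X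
        using K(1) that by (simp add: ennreal_mult less_imp_le mult_ac)
      then show ?thesis by (simp only: distrib_left[of "ennreal K"]) simp
    qed
    finally show "ennreal \<bar>?D ?z s - ?D z s\<bar> \<le> ennreal K * (?cS s + ?cG s)" .
  qed
  also have "\<dots> = ennreal K * (\<integral>\<^sup>+s. ?cS s + ?cG s \<partial>lborel)"
    by (intro nn_integral_cmult) measurable
  also have "(\<integral>\<^sup>+s. ?cS s + ?cG s \<partial>lborel)
    = integral\<^sup>N lborel ?cS + integral\<^sup>N lborel ?cG"
    by (intro nn_integral_add) measurable
  also have "integral\<^sup>N lborel ?cS =
      ?PS ?z + ?PS z"
    unfolding pot_def distrib_left by (intro nn_integral_add) measurable
  also have "integral\<^sup>N lborel ?cG =
      ?PG ?z + ?PG z"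
    unfolding pot_def distrib_left by (intro nn_integral_add) measurable
  also have "ennreal K * (?PS ?z + ?PS z
      + (?PG ?z + ?PG z)) = ennreal K * (P ?z + P z)"
    unfolding P_def by (simp only: add_ac)
  finally show ?thesis .
qed

end

section \<open>Comparison through test functions\<close>

lemma loc_integrable_subset_finite:
  fixes g :: "'a::euclidean_space \<Rightarrow> real"
  assumes "loc_integrable g" "bounded A" "A \<in> sets borel"
  shows "integrable lborel (\<lambda>x. g x * indicator A x)"
proof -
  obtain R where R: "A \<subseteq> cball 0 R" using assms(2) by (auto simp: bounded_iff subset_iff)
  have [measurable]: "g \<in> borel_measurable borel" "A \<in> sets borel"
    using assms by (auto intro: loc_integrable_measurable)
  show ?thesis
    by (rule integrable_dominated_loc[OF assms(1), where K=1 and R=R])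
       (use R in \<open>auto simp: indicator_def\<close>)
qed

lemma loc_integrable_mult_bounded:
  fixes g :: "'a::euclidean_space \<Rightarrow> real"
  assumes "loc_integrable g" "\<psi> \<in> borel_measurable borel" "\<And>x. \<bar>\<psi> x\<bar> \<le> K * indicator (cball 0 R) x"
  shows "integrable lborel (\<lambda>x. \<psi> x * g x)"
proof -
  have [measurable]: "g \<in> borel_measurable borel" "\<psi> \<in> borel_measurable borel"
    using assms by (auto intro: loc_integrable_measurable)
  show ?thesis
  proof (rule integrable_dominated_loc[OF assms(1), where K=K and R=R])
    fix x
    show "\<bar>\<psi> x * g x\<bar> \<le> K * norm (g x) * indicator (cball 0 R) x"
      using mult_right_mono[OF assms(3)[of x], of "\<bar>g x\<bar>"] by (simp add: abs_mult mult_ac)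
  qed measurable
qed

lemma loc_integrable_diff:
  fixes f g :: "'a::euclidean_space \<Rightarrow> real"
  assumes f: "loc_integrable f" and g: "loc_integrable g"
  shows "loc_integrable (\<lambda>x. f x - g x)"
  unfolding loc_integrable_def
proof (intro conjI allI)
  note [measurable] = f[THEN loc_integrable_measurable] g[THEN loc_integrable_measurable]
  show "(\<lambda>x. f x - g x) \<in> borel_measurable borel" by measurable
  fix R
  have "(\<integral>\<^sup>+w. ennreal (norm (f w - g w)) * indicator (cball 0 R) w \<partial>lborel) \<le>
    (\<integral>\<^sup>+w. ennreal (norm (f w)) * indicator (cball 0 R) w + ennreal (norm (g w)) * indicator (cball 0 R) w \<partial>lborel)"
    by (intro nn_integral_mono)
       (auto simp: indicator_def ennreal_plus[symmetric] simp del: ennreal_plus intro!: ennreal_leI abs_triangle_ineq4)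
  also have "\<dots> = (\<integral>\<^sup>+w. ennreal (norm (f w)) * indicator (cball 0 R) w \<partial>lborel) + (\<integral>\<^sup>+w. ennreal (norm (g w)) * indicator (cball 0 R) w \<partial>lborel)"
    by (intro nn_integral_add) measurable
  also have "\<dots> < \<infinity>" using f g by (simp add: loc_integrable_def)
  finally show "(\<integral>\<^sup>+w. ennreal (norm (f w - g w)) * indicator (cball 0 R) w \<partial>lborel) < \<infinity>" .
qed

definition Cc_nonneg :: "('a::euclidean_space \<Rightarrow> real) \<Rightarrow> bool" where
  "Cc_nonneg \<psi> \<longleftrightarrow> continuous_on UNIV \<psi> \<and> (\<forall>x. \<psi> x \<ge> 0) \<and> (\<exists>R. \<forall>x. norm x > R \<longrightarrow> \<psi> x = 0)"

lemma Cc_nonnegD: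
  assumes "Cc_nonneg \<psi>"
  shows "continuous_on UNIV \<psi>" "\<psi> x \<ge> 0" "\<psi> \<in> borel_measurable borel"
  using assms borel_measurable_continuous_onI unfolding Cc_nonneg_def by blast+

lemma Cc_nonneg_bound:
  assumes "Cc_nonneg \<psi>"
  obtains K R where "K \<ge> 0" "R \<ge> 0" "\<And>x. \<bar>\<psi> x\<bar> \<le> K * indicator (cball 0 R) x"
proof -
  obtain R0 where R0: "\<And>x. norm x > R0 \<Longrightarrow> \<psi> x = 0" using assms by (auto simp: Cc_nonneg_def)
  define R where "R = max R0 0"
  have "compact (\<psi> ` cball 0 R)"
    using assms by (intro compact_continuous_image[OF continuous_on_subset[OF _ subset_UNIV]]) (auto simp: Cc_nonneg_def)
  then obtain K where "\<forall>x\<in>cball 0 R. \<bar>\<psi> x\<bar> \<le> K"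
    by (auto dest!: compact_imp_bounded simp: bounded_iff)
  then have "\<bar>\<psi> x\<bar> \<le> max K 0 * indicator (cball 0 R) x" for x
    using R0[of x] by (cases "norm x \<le> R") (auto simp: R_def le_max_iff_disj)
  then show thesis using that[of "max K 0" R] by (simp add: R_def)
qed

text \<open>The indicator of a compact set is a decreasing limit of such test functions, so the
  hypothesis extends to compact sets and, by inner regularity, forces \<open>u \<le> 0\<close>.\<close>

lemma AE_nonpos_of_Cc:
  fixes u :: "'a::euclidean_space \<Rightarrow> real"
  assumes u: "loc_integrable u"
    and test: "\<And>\<psi>. Cc_nonneg \<psi> \<Longrightarrow> (\<integral>x. \<psi> x * u x \<partial>lborel) \<le> 0"
  shows "AE x in lborel. u x \<le> 0"
proof -
  have [measurable]: "u \<in> borel_measurable borel" using u by (rule loc_integrable_measurable)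
  have comp: "(\<integral>x. u x * indicator C x \<partial>lborel) \<le> 0" if C: "compact C" for C :: "'a set"
  proof (cases "C = {}")
    case False
    have [measurable]: "C \<in> sets borel" using C by (simp add: compact_imp_closed borel_closed)
    obtain R where R: "\<And>x. x \<in> C \<Longrightarrow> norm x \<le> R"
      using compact_imp_bounded[OF C] by (auto simp: bounded_iff)
    \<comment> \<open>Tents of slope \<open>n\<close> around \<open>C\<close>. From slope 1 on they
      vanish at distance 1 from \<open>C\<close>, which explains the radius \<open>R + 1\<close> and
      the index \<open>Suc n\<close> in the limit.\<close>
    define \<psi> where "\<psi> n x = max 0 (1 - real n * infdist x C)" for n x
    have cont: "continuous_on UNIV (\<psi> n)" for n
      unfolding \<psi>_def[abs_def] by (intro continuous_intros continuous_on_infdist)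
    have supp: "\<psi> n x = 0" if "norm x > R + 1" "n > 0" for n x
    proof -
      have "infdist x C \<ge> 1"
        unfolding infdist_notempty[OF False]
      proof (rule cINF_greatest[OF False])
        fix y assume "y \<in> C"
        then show "1 \<le> dist x y" using R[of y] that norm_triangle_sub[of x y] by (simp add: dist_norm)
      qed
      moreover have "1 \<le> real n" using that by simp
      ultimately have "1 * 1 \<le> real n * infdist x C" by (intro mult_mono) auto
      then show ?thesis by (simp add: \<psi>_def)
    qed
    have Cc: "Cc_nonneg (\<psi> n)" if "n > 0" for n
      unfolding Cc_nonneg_def using cont supp that by (auto simp: \<psi>_def)
    have lim: "(\<lambda>n. \<psi> (Suc n) x * u x) \<longlonglongrightarrow> u x * indicator C x" for x
    proof (cases "x \<in> C")
      case True
      then show ?thesis by (simp add: \<psi>_def)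
    next
      case x: False
      have pos: "infdist x C > 0" using x False C infdist_pos_not_in_closed compact_imp_closed by blast
      obtain N where N: "real N * infdist x C > 1" using reals_Archimedean3[OF pos] by auto
      have "\<psi> (Suc n) x = 0" if "n \<ge> N" for n
      proof -
        have "real N * infdist x C \<le> real (Suc n) * infdist x C" using that pos by (intro mult_right_mono) auto
        then show ?thesis using N by (simp add: \<psi>_def)
      qed
      then have "\<forall>\<^sub>F n in sequentially. \<psi> (Suc n) x * u x = u x * indicator C x"
        using x by (auto simp: eventually_sequentially)
      then show ?thesis by (rule tendsto_eventually)
    qed
    have "(\<lambda>n. \<integral>x. \<psi> (Suc n) x * u x \<partial>lborel) \<longlonglongrightarrow> (\<integral>x. u x * indicator C x \<partial>lborel)"
    proof (rule integral_dominated_convergence[where w="\<lambda>x. norm (u x * indicator (cball 0 (R + 1)) x)"])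
      show "(\<lambda>x. \<psi> (Suc n) x * u x) \<in> borel_measurable lborel" for n
        using borel_measurable_continuous_onI[OF cont[of "Suc n"]] by simp
      show "integrable lborel (\<lambda>x. norm (u x * indicator (cball 0 (R + 1)) x))"
        using loc_integrable_subset_finite[OF u, of "cball 0 (R + 1)"] by (intro integrable_norm) auto
      show "AE x in lborel. norm (\<psi> (Suc n) x * u x) \<le> norm (u x * indicator (cball 0 (R + 1)) x)" for n
      proof (rule AE_I2)
        fix x
        have "\<bar>\<psi> (Suc n) x\<bar> \<le> 1" using infdist_nonneg[of x C] by (auto simp: \<psi>_def)
        then show "norm (\<psi> (Suc n) x * u x) \<le> norm (u x * indicator (cball 0 (R + 1)) x)"
          using supp[of x "Suc n"] by (cases "norm x \<le> R + 1") (auto simp: abs_mult mult_left_le_one_le)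
      qed
    qed (use lim in auto)
    then show ?thesis
      by (rule LIMSEQ_le_const2) (use test Cc in auto)
  qed simp
  have null: "AE x in lborel. \<not> (u x > 0 \<and> norm x \<le> R)" for R
  proof -
    let ?h = "\<lambda>x. ennreal (u x) * indicator (cball 0 R) x"
    \<comment> \<open>The measure with density the positive part of \<open>u\<close> on a ball is
      finite, so its value on the Borel set where \<open>u > 0\<close> is a supremum over compact
      subsets.\<close>
    let ?N = "density lborel ?h"
    let ?B = "{x. u x > 0} \<inter> cball 0 R"
    have B [measurable]: "?B \<in> sets borel" by measurable
    have fin: "emeasure ?N (space ?N) \<noteq> \<infinity>"
    proof -
      have "emeasure ?N (space ?N) = (\<integral>\<^sup>+x. ?h x \<partial>lborel)"
        by (subst emeasure_density) auto
      also have "\<dots> \<le> (\<integral>\<^sup>+x. ennreal (norm (u x)) * indicator (cball 0 R) x \<partial>lborel)"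
        by (intro nn_integral_mono mult_right_mono) (auto intro: ennreal_leI)
      also have "\<dots> < \<infinity>" using u by (simp add: loc_integrable_def)
      finally show ?thesis by simp
    qed
    have "emeasure ?N ?B = (SUP C \<in> {C. C \<subseteq> ?B \<and> compact C}. emeasure ?N C)"
      by (rule inner_regular[OF _ fin B]) simp
    also have "\<dots> \<le> 0"
    proof (rule SUP_least)
      fix C assume "C \<in> {C. C \<subseteq> ?B \<and> compact C}"
      then have C: "C \<subseteq> ?B" "compact C" by auto
      have [measurable]: "C \<in> sets borel" using C by (simp add: compact_imp_closed borel_closed)
      have "emeasure ?N C = (\<integral>\<^sup>+x. ?h x * indicator C x \<partial>lborel)"
        by (subst emeasure_density) auto
      also have "\<dots> = (\<integral>\<^sup>+x. ennreal (u x * indicator C x) \<partial>lborel)"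
        using C by (intro nn_integral_cong) (auto simp: indicator_def)
      also have "\<dots> = ennreal (\<integral>x. u x * indicator C x \<partial>lborel)"
        using C loc_integrable_subset_finite[OF u compact_imp_bounded[OF C(2)]]
        by (intro nn_integral_eq_integral AE_I2) (auto simp: indicator_def intro!: less_imp_le)
      also have "\<dots> = 0" using comp[OF C(2)] by (simp add: ennreal_neg)
      finally show "emeasure ?N C \<le> 0" by simp
    qed
    finally have "(\<integral>\<^sup>+x. ?h x * indicator ?B x \<partial>lborel) = 0"
      by (simp add: emeasure_density)
    then have "AE x in lborel. ?h x * indicator ?B x = 0"
      by (subst (asm) nn_integral_0_iff_AE) auto
    then show ?thesis by eventually_elim (auto simp: indicator_def split: if_splits)
  qed
  have "AE x in lborel. \<forall>n::nat. \<not> (u x > 0 \<and> norm x \<le> real n)"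
    unfolding AE_all_countable using null by blast
  then show ?thesis
  proof eventually_elim
    case (elim x)
    obtain n :: nat where "norm x \<le> real n" using real_arch_simple by blast
    then show ?case using elim by force
  qed
qed

text \<open>A bound that survives only after testing becomes a pointwise one. Since \<open>Q\<close>
  may be infinite, it is replaced by the real function \<open>q\<close>, equal to it almost
  everywhere by local integrability; the sign criterion is then applied to \<open>g - q\<close> and
  \<open>- g - q\<close>.\<close>

lemma AE_le_of_Cc:
  fixes g :: "'a::euclidean_space \<Rightarrow> real" and Q :: "'a \<Rightarrow> ennreal"
  assumes g: "loc_integrable g" and [measurable]: "Q \<in> borel_measurable borel"
    and Q: "\<And>R. (\<integral>\<^sup>+x. Q x * indicator (cball 0 R) x \<partial>lborel) < \<infinity>"
    and test: "\<And>\<psi>. Cc_nonneg \<psi> \<Longrightarrow> ennreal \<bar>\<integral>x. \<psi> x * g x \<partial>lborel\<bar> \<le> (\<integral>\<^sup>+x. ennreal (\<psi> x) * Q x \<partial>lborel)"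
  shows "AE x in lborel. ennreal \<bar>g x\<bar> \<le> Q x"
proof -
  have [measurable]: "g \<in> borel_measurable borel" using g by (rule loc_integrable_measurable)
  have fin: "AE x in lborel. Q x < \<infinity>"
  proof -
    have "AE x in lborel. Q x * indicator (cball 0 (real n)) x \<noteq> \<infinity>" for n :: nat
      using Q[of "real n"] by (intro nn_integral_PInf_AE) auto
    then have "AE x in lborel. \<forall>n. Q x * indicator (cball 0 (real n)) x \<noteq> \<infinity>"
      by (simp add: AE_all_countable)
    then show ?thesis
    proof eventually_elim
      case (elim x)
      obtain n :: nat where "norm x \<le> real n" using real_arch_simple by blast
      then show ?case using elim[rule_format, of n] by (simp add: top.not_eq_extremum)
    qed
  qed
  define q where "q x = enn2real (Q x)" for x
  have qQ: "AE x in lborel. ennreal (q x) = Q x"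
    using fin by eventually_elim (simp add: q_def)
  have [measurable]: "q \<in> borel_measurable borel" unfolding q_def[abs_def] by measurable
  have q0: "q x \<ge> 0" for x by (simp add: q_def)
  have lq: "loc_integrable q"
    unfolding loc_integrable_def
  proof (intro conjI allI)
    fix R
    have "(\<integral>\<^sup>+w. ennreal (norm (q w)) * indicator (cball 0 R) w \<partial>lborel) = (\<integral>\<^sup>+x. Q x * indicator (cball 0 R) x \<partial>lborel)"
      using qQ by (intro nn_integral_cong_AE) (auto simp: q0)
    then show "(\<integral>\<^sup>+w. ennreal (norm (q w)) * indicator (cball 0 R) w \<partial>lborel) < \<infinity>" using Q by simp
  qed simp
  have tq: "\<bar>\<integral>x. \<psi> x * g x \<partial>lborel\<bar> \<le> (\<integral>x. \<psi> x * q x \<partial>lborel)" "integrable lborel (\<lambda>x. \<psi> x * g x)" "integrable lborel (\<lambda>x. \<psi> x * q x)"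
    if \<psi>: "Cc_nonneg \<psi>" for \<psi>
  proof -
    obtain K R where KR: "\<And>x. \<bar>\<psi> x\<bar> \<le> K * indicator (cball 0 R) x" using Cc_nonneg_bound[OF \<psi>] by metis
    note [measurable] = Cc_nonnegD(3)[OF \<psi>]
    show "integrable lborel (\<lambda>x. \<psi> x * g x)" by (rule loc_integrable_mult_bounded[OF g _ KR]) measurable
    show iq: "integrable lborel (\<lambda>x. \<psi> x * q x)" by (rule loc_integrable_mult_bounded[OF lq _ KR]) measurable
    note p0 = Cc_nonnegD(2)[OF \<psi>]
    have "ennreal \<bar>\<integral>x. \<psi> x * g x \<partial>lborel\<bar> \<le> (\<integral>\<^sup>+x. ennreal (\<psi> x) * Q x \<partial>lborel)" by (rule test[OF \<psi>])
    also have "\<dots> = (\<integral>\<^sup>+x. ennreal (\<psi> x * q x) \<partial>lborel)"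
      using qQ by (intro nn_integral_cong_AE) (auto simp: ennreal_mult p0 q0)
    also have "\<dots> = ennreal (\<integral>x. \<psi> x * q x \<partial>lborel)"
      using iq by (intro nn_integral_eq_integral) (auto simp: p0 q0)
    finally show "\<bar>\<integral>x. \<psi> x * g x \<partial>lborel\<bar> \<le> (\<integral>x. \<psi> x * q x \<partial>lborel)"
      by (simp add: ennreal_le_iff integral_nonneg_AE p0 q0)
  qed
  have lmg: "loc_integrable (\<lambda>x. - g x)" using g by (simp add: loc_integrable_def)
  have "AE x in lborel. g x - q x \<le> 0"
  proof (rule AE_nonpos_of_Cc[OF loc_integrable_diff[OF g lq]])
    fix \<psi> :: "'a \<Rightarrow> real" assume \<psi>: "Cc_nonneg \<psi>"
    show "(\<integral>x. \<psi> x * (g x - q x) \<partial>lborel) \<le> 0"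
      using tq[OF \<psi>] by (simp add: right_diff_distrib)
  qed
  moreover have "AE x in lborel. - g x - q x \<le> 0"
  proof (rule AE_nonpos_of_Cc[OF loc_integrable_diff[OF lmg lq]])
    fix \<psi> :: "'a \<Rightarrow> real" assume \<psi>: "Cc_nonneg \<psi>"
    have "(\<integral>x. \<psi> x * (- g x - q x) \<partial>lborel) = (\<integral>x. - (\<psi> x * g x) - \<psi> x * q x \<partial>lborel)"
      by (simp add: right_diff_distrib)
    also have "\<dots> = - (\<integral>x. \<psi> x * g x \<partial>lborel) - (\<integral>x. \<psi> x * q x \<partial>lborel)"
      using tq(2,3)[OF \<psi>] by simp
    finally show "(\<integral>x. \<psi> x * (- g x - q x) \<partial>lborel) \<le> 0" using tq(1)[OF \<psi>] by simp
  qed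
  ultimately show ?thesis using qQ
  proof eventually_elim
    case (elim x)
    have "ennreal \<bar>g x\<bar> \<le> ennreal (q x)" using elim(1,2) by (intro ennreal_leI) auto
    then show ?case using elim(3) by simp
  qed
qed

section \<open>Limits of the averages\<close>

lemma loc_integrable_translate:
  fixes f :: "'a::euclidean_space \<Rightarrow> real"
  assumes f: "loc_integrable f"
  shows "loc_integrable (\<lambda>w. f (w + c))"
  unfolding loc_integrable_def
proof (intro conjI allI)
  have [measurable]: "f \<in> borel_measurable borel" using f by (rule loc_integrable_measurable)
  show "(\<lambda>w. f (w + c)) \<in> borel_measurable borel" by measurable
  fix R
  have "(\<integral>\<^sup>+w. ennreal (norm (f (w + c))) * indicator (cball 0 R) w \<partial>lborel)
    \<le> (\<integral>\<^sup>+w. ennreal (norm (f (c + w))) * indicator (cball 0 (R + norm c)) (c + w) \<partial>lborel)"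
  proof (intro nn_integral_mono)
    fix w
    have "norm w \<le> R \<Longrightarrow> norm (c + w) \<le> R + norm c" using norm_triangle_ineq[of c w] by linarith
    then show "ennreal (norm (f (w + c))) * indicator (cball 0 R) w \<le> ennreal (norm (f (c + w))) * indicator (cball 0 (R + norm c)) (c + w)"
      by (auto simp: indicator_def add.commute)
  qed
  also have "\<dots> = (\<integral>\<^sup>+w. ennreal (norm (f w)) * indicator (cball 0 (R + norm c)) w \<partial>lborel)"
    using nn_integral_affine[of "\<lambda>w. ennreal (norm (f w)) * indicator (cball 0 (R + norm c)) w" 1 c] by simp
  also have "\<dots> < \<infinity>" using f by (simp add: loc_integrable_def)
  finally show "(\<integral>\<^sup>+w. ennreal (norm (f (w + c))) * indicator (cball 0 R) w \<partial>lborel) < \<infinity>" .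
qed

lemma integral_lborel_translate:
  fixes f :: "'a::euclidean_space \<Rightarrow> real"
  assumes [measurable]: "f \<in> borel_measurable borel"
  shows "(\<integral>w. f (w + c) \<partial>lborel) = (\<integral>w. f w \<partial>lborel)"
proof -
  have "lborel = distr lborel borel (\<lambda>x. c + x)"
    using lborel_affine[of 1 c] by (simp add: density_1)
  then have "(\<integral>w. f w \<partial>lborel) = (\<integral>w. f w \<partial>(distr lborel borel (\<lambda>x. c + x)))" by metis
  also have "\<dots> = (\<integral>w. f (c + w) \<partial>lborel)" by (intro integral_distr) auto
  finally show ?thesis by (simp add: add.commute)
qed

context kinetic_scaling begin

text \<open>The bump is not normalised, so the averages tend to \<open>mass\<close> times the
  function at small scales; the final constant is divided by it.\<close>

definition mass :: "'d::finite pt itself \<Rightarrow> real" where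
  "mass _ = (\<integral>y. bump 0 (y :: 'd pt) \<partial>lborel)"

lemma bump_measurable [measurable]: "(bump n :: 'd::finite pt \<Rightarrow> real) \<in> borel_measurable borel"
  by (intro borel_measurable_continuous_onI continuous_on_bump)

lemma bump_0_le_indicator: "bump 0 y \<le> indicator (cball 0 1) y"
  using bump_0_le_1[of y] bump_eq_0[of y 0] by (cases "norm y \<le> 1") auto

lemma integrable_bump: "integrable lborel (bump 0 :: 'd::finite pt \<Rightarrow> real)"
proof (rule Bochner_Integration.integrable_bound[where f="indicator (cball 0 1) :: 'd pt \<Rightarrow> real"])
  show "integrable lborel (indicator (cball 0 1) :: 'd pt \<Rightarrow> real)"
    using emeasure_lborel_cball_finite[of "0::'d pt" 1] by (intro integrable_real_indicator) auto
qed (auto simp: bump_0_nonneg bump_0_le_indicator intro!: AE_I2)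

lemma nn_integral_bump: "(\<integral>\<^sup>+y. ennreal (bump 0 (y :: 'd::finite pt)) \<partial>lborel) = ennreal (mass TYPE('d pt))"
  unfolding mass_def by (intro nn_integral_eq_integral integrable_bump) (simp add: bump_0_nonneg)

lemma mass_pos: "mass TYPE('d::finite pt) > 0"
proof -
  have "mass TYPE('d pt) \<noteq> 0"
  proof
    assume "mass TYPE('d pt) = 0"
    then have "AE y in lborel. bump 0 (y :: 'd pt) = 0"
      unfolding mass_def using integral_nonneg_eq_0_iff_AE[OF integrable_bump[where 'd='d]] by (simp add: bump_0_nonneg)
    then have "emeasure lborel {y :: 'd pt. bump 0 y \<noteq> 0} = 0"
      by (subst (asm) AE_iff_measurable[OF _ refl]) auto
    moreover have "ball 0 1 \<subseteq> {y :: 'd pt. bump 0 y \<noteq> 0}"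
    proof
      fix y :: "'d pt" assume "y \<in> ball 0 1"
      then have "y \<bullet> y < 1" by (simp add: dot_square_norm abs_square_less_1)
      then show "y \<in> {y :: 'd pt. bump 0 y \<noteq> 0}" by (simp add: bump_def bump_profile_def)
    qed
    moreover have "{y :: 'd pt. bump 0 y \<noteq> 0} \<in> sets lborel" by measurable
    ultimately have "emeasure lborel (ball 0 1 :: 'd pt set) = 0"
      using emeasure_mono[of "ball 0 1" "{y :: 'd pt. bump 0 y \<noteq> 0}" lborel] by simp
    then show False using content_ball_pos[of 1 "0 :: 'd pt"] by (simp add: measure_def)
  qed
  moreover have "mass TYPE('d pt) \<ge> 0" unfolding mass_def by (simp add: bump_0_nonneg integral_nonneg_AE)
  ultimately show ?thesis by simp
qed

lemma abs_Fav_le: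
  fixes f :: "'d::finite pt \<Rightarrow> real"
  assumes [measurable]: "f \<in> borel_measurable borel"
  shows "ennreal \<bar>Fav s f z\<bar> \<le> avg s (nrm f) z"
proof -
  let ?n = "real CARD('d)"
  have "ennreal \<bar>Fav s f z\<bar> = ennreal (1 / V ?n s) * ennreal \<bar>\<integral>w. f w * bump 0 (M s z w) \<partial>lborel\<bar>"
    unfolding Fav_def abs_mult by (subst ennreal_mult) (simp_all add: less_imp_le)
  also have "\<dots> \<le> ennreal (1 / V ?n s) * (\<integral>\<^sup>+w. ennreal \<bar>f w * bump 0 (M s z w)\<bar> \<partial>lborel)"
    by (intro mult_left_mono ennreal_norm_integral_le) auto
  also have "\<dots> \<le> ennreal (1 / V ?n s) * (\<integral>\<^sup>+w. indicator (cball 0 1) (M s z w) * ennreal (norm (f w)) \<partial>lborel)"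
  proof (intro mult_left_mono nn_integral_mono)
    fix w
    have "\<bar>f w * bump 0 (M s z w)\<bar> \<le> indicator (cball 0 1) (M s z w) * norm (f w)"
      using mult_left_mono[OF bump_0_le_indicator[of "M s z w"], of "\<bar>f w\<bar>"] bump_0_nonneg[of "M s z w"]
      by (simp add: abs_mult mult.commute)
    then show "ennreal \<bar>f w * bump 0 (M s z w)\<bar> \<le> indicator (cball 0 1) (M s z w) * ennreal (norm (f w))"
      by (auto simp: indicator_def intro: ennreal_leI)
  qed auto
  also have "\<dots> = avg s (nrm f) z"
    unfolding avg_def mult.assoc by (subst nn_integral_cmult) measurable
  finally show ?thesis .
qed

lemma V_at_top: "n \<ge> 0 \<Longrightarrow> filterlim (V n) at_top at_top"
proof -
  assume "n \<ge> 0"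
  then have "\<beta> * (1 + n) + 2 * n * \<gamma> > 0" using \<beta> \<gamma> by (intro add_pos_nonneg mult_pos_pos) auto
  then show ?thesis unfolding V_def[abs_def]
    by (intro filterlim_compose[OF exp_at_top] filterlim_tendsto_add_at_top[OF tendsto_const]
       filterlim_tendsto_pos_mult_at_top[OF tendsto_const _ filterlim_ident])
qed

text \<open>Averages of an L^2 function are bounded by a multiple of the power
  \<open>- 1 / 2\<close> of the cell volume, uniformly in the base point, and the volume grows
  without bound. Hence no residual term survives at infinite scale.\<close>

lemma Fav_tendsto_0:
  fixes f :: "'d::finite pt \<Rightarrow> real"
  assumes [measurable]: "f \<in> borel_measurable borel"
    and fin: "(epow_int 2 (nrm f)) < \<infinity>"
  obtains \<eta> where "\<And>s z. \<bar>Fav s f z\<bar> \<le> \<eta> s" "(\<eta> \<longlongrightarrow> 0) at_top"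
proof -
  let ?n = "real CARD('d)"
  obtain N where N: "(epow_int 2 (nrm f)) = ennreal N" "N \<ge> 0"
    using fin by (cases "(epow_int 2 (nrm f))") auto
  define A where "A = cavg TYPE('d pt) 2 * N"
  have A: "A \<ge> 0" using cavg_pos[of 2, where 'd='d] N by (simp add: A_def)
  define \<eta> where "\<eta> s = (A / V ?n s) powr (1/2)" for s
  have "\<bar>Fav s f z\<bar> \<le> \<eta> s" for s z
  proof -
    have "epowr (avg s (nrm f) z) 2 \<le> ennreal (cavg TYPE('d pt) 2 / V ?n s) * ennreal N"
      unfolding N(1)[symmetric] by (rule epowr_avg_sup) auto
    also have "\<dots> = ennreal (A / V ?n s)"
      using N(2) cavg_pos[of 2, where 'd='d] by (simp add: A_def ennreal_mult'[symmetric] less_imp_le)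
    finally have "avg s (nrm f) z \<le> ennreal (\<eta> s)"
      unfolding \<eta>_def using A by (intro epowr_le_iff_root) (auto simp: less_imp_le)
    then have "ennreal \<bar>Fav s f z\<bar> \<le> ennreal (\<eta> s)" using abs_Fav_le[OF assms(1)] order_trans by blast
    then show ?thesis by (simp add: \<eta>_def)
  qed
  moreover have "(\<eta> \<longlongrightarrow> 0) at_top"
  proof -
    have "((\<lambda>s. A / V ?n s) \<longlongrightarrow> 0) at_top"
      by (intro tendsto_divide_0[OF tendsto_const] filterlim_at_top_imp_at_infinity V_at_top) simp
    then have "((\<lambda>s. (A / V ?n s) powr (1/2)) \<longlongrightarrow> 0 powr (1/2)) at_top"
      using A by (intro tendsto_powr2 tendsto_const always_eventually) (auto simp: less_imp_le)
    then show ?thesis by (simp add: \<eta>_def[abs_def])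
  qed
  ultimately show thesis using that by blast
qed

lemma M_translate: "M s (z + (0, h, 0)) (w + (0, h, 0)) = M s z w"
  by (simp add: M_def)

text \<open>Positions enter \<open>M\<close> through their difference, so it is unchanged when both
  points are shifted in \<open>x\<close>. The increment thus passes from the average to
  \<open>f\<close>, where the small-scale limit identifies it.\<close>

lemma Fav_translate:
  fixes f :: "'d::finite pt \<Rightarrow> real"
  assumes f: "loc_integrable f"
  shows "Fav s f (z + (0, h, 0)) - Fav s f z = Fav s (\<lambda>w. f (w + (0, h, 0)) - f w) z"
proof -
  have [measurable]: "f \<in> borel_measurable borel" using f by (rule loc_integrable_measurable)
  let ?g = "\<lambda>w. f w * bump 0 (M s (z + (0, h, 0)) w)"
  have "?g \<in> borel_measurable borel" by measurable
  from integral_lborel_translate[OF this, of "(0, h, 0)"]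
  have "(\<integral>w. f w * bump 0 (M s (z + (0, h, 0)) w) \<partial>lborel) = (\<integral>w. f (w + (0, h, 0)) * bump 0 (M s z w) \<partial>lborel)"
    by (simp add: M_translate)
  moreover have "integrable lborel (\<lambda>w. f (w + (0, h, 0)) * bump 0 (M s z w))" "integrable lborel (\<lambda>w. f w * bump 0 (M s z w))"
    by (intro integrable_mult_comp_M loc_integrable_translate f continuous_on_bump bump_eq_0; assumption)+
  ultimately show ?thesis
    unfolding Fav_def by (simp add: left_diff_distrib right_diff_distrib diff_divide_distrib)
qed

text \<open>A version of \<open>reach\<close> that is uniform as soon as either of the two points
  lies in the ball of radius \<open>R\<close>: if only \<open>w\<close> does, the velocity of
  \<open>z\<close> is still at most \<open>R + \<nu> s\<close>.\<close>

definition rad :: "real \<Rightarrow> real \<Rightarrow> real" where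
  "rad R s = \<tau> s * (1 + R + \<nu> s) + exp s + \<nu> s"

lemma rad_tendsto_0: "(rad R \<longlongrightarrow> 0) at_bot"
proof -
  have E: "((\<lambda>s. exp (a + b * s)) \<longlongrightarrow> 0) at_bot" if "b > 0" for a b :: real
  proof -
    have "filterlim (\<lambda>s. b * s) at_bot at_bot"
      using filterlim_tendsto_pos_mult_at_bot[OF tendsto_const that filterlim_ident] .
    then have "((\<lambda>s. exp (b * s)) \<longlongrightarrow> 0) at_bot" by (rule filterlim_compose[OF exp_at_bot])
    then have "((\<lambda>s. exp a * exp (b * s)) \<longlongrightarrow> 0) at_bot" by (rule tendsto_mult_right_zero)
    then show ?thesis by (simp add: exp_add)
  qed
  have T: "(\<tau> \<longlongrightarrow> 0) at_bot" and N: "(\<nu> \<longlongrightarrow> 0) at_bot"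
    unfolding \<tau>_def[abs_def] \<nu>_def[abs_def] by (intro E \<beta> \<gamma>)+
  have "(rad R \<longlongrightarrow> 0 * (1 + R + 0) + 0 + 0) at_bot"
    unfolding rad_def[abs_def] by (intro tendsto_intros T N exp_at_bot)
  then show ?thesis by simp
qed

lemma M_close:
  fixes z w :: "'d::finite pt"
  assumes M: "norm (M s z w) \<le> 1" and R: "norm z \<le> R \<or> norm w \<le> R"
  shows "norm (w - z) \<le> rad R s"
proof -
  have v: "norm (snd (snd y)) \<le> norm y" for y :: "'d pt"
    using norm_snd_le[of "snd y" "fst y"] norm_snd_le[of "snd (snd y)" "fst (snd y)"] by simp
  have "norm (snd (snd z)) \<le> norm (snd (snd w)) + norm (snd (snd w) - snd (snd z))"
    using norm_triangle_sub[of "snd (snd z)" "snd (snd w)"] by (simp add: norm_minus_commute)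
  then have "norm (snd (snd z)) \<le> R + \<nu> s"
    using R v[of z] v[of w] M_bounds(3)[OF M] pos(2)[of s] by linarith
  then have "\<tau> s * norm (snd (snd z)) \<le> \<tau> s * (R + \<nu> s)" by (simp add: mult_left_mono less_imp_le)
  then have "reach s z \<le> rad R s" unfolding reach_def rad_def by (simp add: algebra_simps)
  then show ?thesis using M_bounds(4)[OF M] by linarith
qed

lemma integral_bump_M_left:
  "integrable lborel (\<lambda>z. bump 0 (M s z (w :: 'd::finite pt)))"
  "1 / V (real CARD('d)) s * (\<integral>z. bump 0 (M s z (w :: 'd::finite pt)) \<partial>lborel) = mass TYPE('d pt)"
proof -
  let ?V = "V (real CARD('d)) s"
  have nn: "(\<integral>\<^sup>+z. ennreal (bump 0 (M s z w)) \<partial>lborel) = ennreal (?V * mass TYPE('d pt))"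
    using nn_integral_M_left[of "\<lambda>y. ennreal (bump 0 y)" s w] mass_pos[where 'd='d]
    by (simp add: nn_integral_bump ennreal_mult' less_imp_le)
  show i: "integrable lborel (\<lambda>z. bump 0 (M s z w))"
    by (intro integrableI_bounded) (simp_all add: nn bump_0_nonneg)
  have "(\<integral>z. bump 0 (M s z w) \<partial>lborel) = ?V * mass TYPE('d pt)"
    using nn mass_pos[where 'd='d] by (intro integral_eq_nn_integral[THEN trans]) (auto simp: bump_0_nonneg less_imp_le)
  then show "1 / ?V * (\<integral>z. bump 0 (M s z w) \<partial>lborel) = mass TYPE('d pt)" by simp
qed

text \<open>Fubini moves the average onto \<open>\<psi>\<close>. The kernel has total mass
  \<open>mass\<close> in \<open>z\<close> as well, so the adjoint average differs from
  \<open>mass * \<psi> w\<close> by the oscillation of \<open>\<psi>\<close> over one cell only. The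
  condition \<open>rad R s \<le> 1\<close> confines everything to the ball of radius
  \<open>R + 1\<close>.\<close>

lemma Fav_weak_error:
  fixes g :: "'d::finite pt \<Rightarrow> real"
  assumes g: "loc_integrable g" and \<psi>: "\<psi> \<in> borel_measurable borel" "\<And>x. \<bar>\<psi> x\<bar> \<le> K * indicator (cball 0 R) x"
    and K: "K \<ge> 0" and rad: "rad R s \<le> 1" and e: "e \<ge> 0"
    and osc: "\<And>z w. norm z \<le> R + 1 \<Longrightarrow> norm w \<le> R + 1 \<Longrightarrow> norm (w - z) \<le> rad R s \<Longrightarrow> \<bar>\<psi> z - \<psi> w\<bar> \<le> e"
  shows "\<bar>(\<integral>z. \<psi> z * Fav s g z \<partial>lborel) - mass TYPE('d pt) * (\<integral>z. \<psi> z * g z \<partial>lborel)\<bar>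
    \<le> e * mass TYPE('d pt) * (\<integral>w. norm (g w * indicator (cball 0 (R + 1)) w) \<partial>lborel)"
proof -
  let ?V = "V (real CARD('d)) s" and ?c = "mass TYPE('d pt)" and ?b = "\<lambda>z w. bump 0 (M s z w)"
    and ?i = "indicator (cball 0 (R + 1)) :: 'd pt \<Rightarrow> real"
  have [measurable]: "g \<in> borel_measurable borel" "\<psi> \<in> borel_measurable borel"
    using g \<psi> by (auto intro: loc_integrable_measurable)
  have \<psi>0: "\<psi> x = 0" if "norm x > R" for x using \<psi>(2)[of x] that by simp
  have close: "norm w \<le> R + 1 \<and> norm z \<le> R + 1 \<and> norm (w - z) \<le> rad R s"
    if "norm (M s z w) \<le> 1" "norm z \<le> R \<or> norm w \<le> R" for z w :: "'d pt"
    using M_close[OF that] that(2) rad norm_triangle_sub[of w z] norm_triangle_sub[of z w]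
    by (auto simp: norm_minus_commute)
  let ?h = "\<lambda>z w. \<psi> z * (g w * ?b z w)"
  let ?u = "\<lambda>z::'d pt. ennreal K * indicator (cball 0 R) z" and ?g = "\<lambda>w. ennreal (norm (g w)) * indicator (cball 0 (R + 1)) w"
  have ih: "integrable (lborel \<Otimes>\<^sub>M lborel) (\<lambda>(z, w). ?h z w)"
  proof (rule integrableI_bounded)
    have [measurable]: "(\<lambda>x. bump 0 (M s (fst x) (snd x :: 'd pt))) \<in> borel_measurable (borel \<Otimes>\<^sub>M borel)"
      by (rule measurable_compose[OF _ bump_measurable]) measurable
    show "(\<lambda>(z, w). ?h z w) \<in> borel_measurable (lborel \<Otimes>\<^sub>M lborel)"
      unfolding case_prod_beta by measurable
    have "(\<integral>\<^sup>+x. ennreal (norm (case x of (z, w) \<Rightarrow> ?h z w)) \<partial>(lborel \<Otimes>\<^sub>M lborel))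
      \<le> (\<integral>\<^sup>+x. ?u (fst x) * ?g (snd x) \<partial>(lborel \<Otimes>\<^sub>M lborel))"
    proof (intro nn_integral_mono)
      fix x :: "'d pt \<times> 'd pt"
      obtain z w where x: "x = (z, w)" by (cases x)
      show "ennreal (norm (case x of (z, w) \<Rightarrow> ?h z w)) \<le> ?u (fst x) * ?g (snd x)"
      proof (cases "norm (M s z w) \<le> 1 \<and> norm z \<le> R")
        case True
        have "\<bar>\<psi> z\<bar> * (\<bar>g w\<bar> * ?b z w) \<le> K * (\<bar>g w\<bar> * 1)"
          using \<psi>(2)[of z] True K by (intro mult_mono mult_left_mono bump_0_le_1) (auto simp: bump_0_nonneg)
        then have "norm (?h z w) \<le> K * \<bar>g w\<bar>" by (simp add: abs_mult bump_0_nonneg)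
        then show ?thesis using True close[of z w] K by (simp add: x ennreal_mult[symmetric])
      next
        case False
        then have "?h z w = 0" using \<psi>0[of z] bump_eq_0[of "M s z w" 0] by (auto simp: not_le less_imp_le)
        then show ?thesis by (simp only: x prod.case) simp
      qed
    qed
    also have "\<dots> = (\<integral>\<^sup>+z. \<integral>\<^sup>+w. ?u z * ?g w \<partial>lborel \<partial>lborel)"
      by (subst lborel.nn_integral_fst[symmetric]) (simp, measurable)
    also have "\<dots> = (ennreal K * emeasure lborel (cball (0::'d pt) R)) * integral\<^sup>N lborel ?g"
      by (simp add: nn_integral_cmult nn_integral_multc)
    also have "\<dots> < \<infinity>"
      using g emeasure_lborel_cball_finite[of "0::'d pt" R] by (simp add: loc_integrable_def ennreal_mult_less_top)
    finally show "(\<integral>\<^sup>+x. ennreal (norm (case x of (z, w) \<Rightarrow> ?h z w)) \<partial>(lborel \<Otimes>\<^sub>M lborel)) < \<infinity>" .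
  qed
  define \<psi>s where "\<psi>s w = 1 / ?V * (\<integral>z. \<psi> z * ?b z w \<partial>lborel)" for w
  have swap: "(\<integral>z. ?h z w \<partial>lborel) = ?V * (g w * \<psi>s w)" for w
  proof -
    have "(\<integral>z. ?h z w \<partial>lborel) = (\<integral>z. g w * (\<psi> z * ?b z w) \<partial>lborel)"
      by (intro Bochner_Integration.integral_cong refl) (simp only: mult_ac)
    also have "\<dots> = g w * (\<integral>z. \<psi> z * ?b z w \<partial>lborel)" by (rule integral_mult_right_zero)
    finally show ?thesis by (simp add: \<psi>s_def)
  qed
  have Fav_eq: "?V * (\<psi> z * Fav s g z) = (\<integral>w. ?h z w \<partial>lborel)" for z
    by (simp only: Fav_def integral_mult_right_zero) simp
  have ig: "integrable lborel (\<lambda>w. g w * \<psi>s w)"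
  proof -
    have "integrable lborel (\<lambda>w. ?V * (g w * \<psi>s w))"
      using lborel_pair.integrable_snd[OF ih] by (simp only: swap)
    then have "integrable lborel (\<lambda>w. (1 / ?V) * (?V * (g w * \<psi>s w)))" by (rule integrable_mult_right)
    then show ?thesis by simp
  qed
  have i\<psi>g: "integrable lborel (\<lambda>w. \<psi> w * g w)" by (rule loc_integrable_mult_bounded[OF g \<psi>])
  have "?V * (\<integral>z. \<psi> z * Fav s g z \<partial>lborel) = (\<integral>z. \<integral>w. ?h z w \<partial>lborel \<partial>lborel)"
    unfolding Fav_eq[symmetric] by simp
  also have "\<dots> = (\<integral>w. \<integral>z. ?h z w \<partial>lborel \<partial>lborel)"
    using lborel_pair.Fubini_integral[OF ih] by simp
  also have "\<dots> = ?V * (\<integral>w. g w * \<psi>s w \<partial>lborel)" unfolding swap by simp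
  finally have eq: "(\<integral>z. \<psi> z * Fav s g z \<partial>lborel) = (\<integral>w. g w * \<psi>s w \<partial>lborel)" by simp
  have "(\<integral>z. \<psi> z * Fav s g z \<partial>lborel) - ?c * (\<integral>z. \<psi> z * g z \<partial>lborel) = (\<integral>w. g w * \<psi>s w - ?c * (\<psi> w * g w) \<partial>lborel)"
    unfolding eq using ig i\<psi>g by simp
  also have "\<bar>\<dots>\<bar> \<le> (\<integral>w. e * ?c * norm (g w * ?i w) \<partial>lborel)"
  proof (rule order_trans[OF integral_abs_bound], rule integral_mono)
    show "integrable lborel (\<lambda>w. \<bar>g w * \<psi>s w - ?c * (\<psi> w * g w)\<bar>)"
      using ig i\<psi>g by (intro integrable_abs Bochner_Integration.integrable_diff integrable_mult_right) auto
    show "integrable lborel (\<lambda>w. e * ?c * norm (g w * ?i w))"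
      by (intro integrable_mult_right integrable_norm loc_integrable_subset_finite g) auto
    fix w
    have i1: "integrable lborel (\<lambda>z. \<psi> z * ?b z w)"
    proof (rule Bochner_Integration.integrable_bound[where f="\<lambda>z. K * ?b z w"])
      show "integrable lborel (\<lambda>z. K * ?b z w)" by (intro integrable_mult_right integral_bump_M_left)
      have "\<bar>\<psi> z\<bar> * ?b z w \<le> K * ?b z w" for z
        using \<psi>(2)[of z] K by (cases "z \<in> cball 0 R") (auto intro!: mult_right_mono bump_0_nonneg simp: bump_0_nonneg)
      then show "AE z in lborel. norm (\<psi> z * ?b z w) \<le> norm (K * ?b z w)"
        using K by (intro AE_I2) (simp add: abs_mult bump_0_nonneg)
    qed measurable
    have i2: "integrable lborel (\<lambda>z. \<psi> w * ?b z w)" by (intro integrable_mult_right integral_bump_M_left)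
    have "?V * (\<psi>s w - ?c * \<psi> w) = (\<integral>z. \<psi> z * ?b z w \<partial>lborel) - \<psi> w * (\<integral>z. ?b z w \<partial>lborel)"
      unfolding \<psi>s_def integral_bump_M_left(2)[of s w, symmetric] by (simp add: field_simps)
    also have "\<dots> = (\<integral>z. \<psi> z * ?b z w - \<psi> w * ?b z w \<partial>lborel)"
      using i1 i2 by simp
    also have "\<bar>\<dots>\<bar> \<le> (\<integral>z. e * ?i w * ?b z w \<partial>lborel)"
    proof (rule order_trans[OF integral_abs_bound], rule integral_mono)
      show "integrable lborel (\<lambda>z. \<bar>\<psi> z * ?b z w - \<psi> w * ?b z w\<bar>)"
        using i1 i2 by (intro integrable_abs Bochner_Integration.integrable_diff) auto
      show "integrable lborel (\<lambda>z. e * ?i w * ?b z w)"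
        by (intro integrable_mult_right integral_bump_M_left)
      fix z
      have "\<bar>\<psi> z - \<psi> w\<bar> * ?b z w \<le> e * ?i w * ?b z w"
      \<comment> \<open>Either the points share a cell and one of them is in the ball of radius
        \<open>R\<close>, or the bump vanishes, or both values of \<open>\<psi>\<close> do.\<close>
      proof (cases "norm (M s z w) \<le> 1 \<and> (norm z \<le> R \<or> norm w \<le> R)")
        case True
        then have "\<bar>\<psi> z - \<psi> w\<bar> \<le> e * ?i w"
          using close[of z w] osc[of z w] by simp
        then show ?thesis by (intro mult_right_mono bump_0_nonneg)
      next
        case False
        then have "\<bar>\<psi> z - \<psi> w\<bar> * ?b z w = 0"
          using \<psi>0[of z] \<psi>0[of w] bump_eq_0[of "M s z w" 0] by (auto simp: not_le less_imp_le)
        moreover have "0 \<le> e * ?i w * ?b z w"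
          using e by (simp add: bump_0_nonneg)
        ultimately show ?thesis by linarith
      qed
      then show "\<bar>\<psi> z * ?b z w - \<psi> w * ?b z w\<bar> \<le> e * ?i w * ?b z w"
        by (simp add: left_diff_distrib[symmetric] abs_mult bump_0_nonneg)
    qed
    also have "\<dots> = ?V * (e * ?i w * ?c)"
      unfolding integral_bump_M_left(2)[of s w, symmetric] by simp
    finally have "?V * \<bar>\<psi>s w - ?c * \<psi> w\<bar> \<le> ?V * (e * ?i w * ?c)" by (simp add: abs_mult)
    then have "\<bar>\<psi>s w - ?c * \<psi> w\<bar> \<le> e * ?i w * ?c" by (simp add: mult_le_cancel_left_pos)
    then have "\<bar>g w\<bar> * \<bar>\<psi>s w - ?c * \<psi> w\<bar> \<le> \<bar>g w\<bar> * (e * ?i w * ?c)" by (rule mult_left_mono) simp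
    moreover have "\<bar>g w * \<psi>s w - ?c * (\<psi> w * g w)\<bar> = \<bar>g w\<bar> * \<bar>\<psi>s w - ?c * \<psi> w\<bar>"
      unfolding abs_mult[symmetric] by (simp add: algebra_simps)
    ultimately show "\<bar>g w * \<psi>s w - ?c * (\<psi> w * g w)\<bar> \<le> e * ?c * norm (g w * ?i w)"
      by (simp add: abs_mult mult_ac)
  qed
  finally show ?thesis by simp
qed

lemma Fav_weak_limit:
  fixes g :: "'d::finite pt \<Rightarrow> real"
  assumes g: "loc_integrable g" and \<psi>: "Cc_nonneg \<psi>"
  shows "((\<lambda>s. \<integral>z. \<psi> z * Fav s g z \<partial>lborel) \<longlongrightarrow> mass TYPE('d pt) * (\<integral>z. \<psi> z * g z \<partial>lborel)) at_bot"
proof (rule tendstoI)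
  fix \<epsilon> :: real assume \<epsilon>: "\<epsilon> > 0"
  obtain K R where K: "K \<ge> 0" and R: "R \<ge> 0" "\<And>x. \<bar>\<psi> x\<bar> \<le> K * indicator (cball 0 R) x"
    using Cc_nonneg_bound[OF \<psi>] by metis
  note cont = Cc_nonnegD(1)[OF \<psi>] and meas = Cc_nonnegD(3)[OF \<psi>]
  define I where "I = mass TYPE('d pt) * (\<integral>w. norm (g w * indicator (cball 0 (R + 1)) w) \<partial>lborel)"
  have I: "I \<ge> 0" using mass_pos[where 'd='d] by (simp add: I_def)
  \<comment> \<open>The summand 1 covers \<open>I = 0\<close> and makes
    \<open>e * I < \<epsilon>\<close> strict.\<close>
  define e where "e = \<epsilon> / (I + 1)"
  have e: "e > 0" using \<epsilon> I by (simp add: e_def)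
  have "uniformly_continuous_on (cball 0 (R + 1)) \<psi>"
    by (rule compact_uniformly_continuous[OF continuous_on_subset[OF cont subset_UNIV]]) simp
  then obtain \<delta> where \<delta>: "\<delta> > 0" "\<And>z w. z \<in> cball 0 (R + 1) \<Longrightarrow> w \<in> cball 0 (R + 1) \<Longrightarrow> dist w z < \<delta> \<Longrightarrow> dist (\<psi> w) (\<psi> z) < e"
    using e unfolding uniformly_continuous_on_def by metis
  have "\<forall>\<^sub>F s in at_bot. rad R s < min \<delta> 1"
    using order_tendstoD(2)[OF rad_tendsto_0, of "min \<delta> 1" R] \<delta>(1) by simp
  then show "\<forall>\<^sub>F s in at_bot. dist (\<integral>z. \<psi> z * Fav s g z \<partial>lborel) (mass TYPE('d pt) * (\<integral>z. \<psi> z * g z \<partial>lborel)) < \<epsilon>"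
  proof eventually_elim
    case (elim s)
    have "\<bar>(\<integral>z. \<psi> z * Fav s g z \<partial>lborel) - mass TYPE('d pt) * (\<integral>z. \<psi> z * g z \<partial>lborel)\<bar>
      \<le> e * mass TYPE('d pt) * (\<integral>w. norm (g w * indicator (cball 0 (R + 1)) w) \<partial>lborel)"
    proof (rule Fav_weak_error[OF g meas R(2) K])
      fix z w :: "'d pt" assume "norm z \<le> R + 1" "norm w \<le> R + 1" "norm (w - z) \<le> rad R s"
      then show "\<bar>\<psi> z - \<psi> w\<bar> \<le> e" using \<delta>(2)[of z w] elim by (simp add: dist_norm abs_minus_commute)
    qed (use elim e in auto)
    also have "\<dots> = e * I" by (simp add: I_def)
    also have "\<dots> < \<epsilon>" using \<epsilon> I by (simp add: e_def field_simps)
    finally show ?case by (simp add: dist_real_def)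
  qed
qed

text \<open>The endpoints are taken as \<open>- s\<close> and \<open>s\<close>, so one limit serves
  both ends: the large-scale average of the increment is at most \<open>2 * \<eta> s\<close>
  everywhere, while the small-scale one converges after pairing with a test function.\<close>

lemma increment_AE_le:
  fixes f :: "'d::finite pt \<Rightarrow> real" and G S :: "'d pt \<Rightarrow> real^'d" and h :: "real^'d"
  assumes f: "loc_integrable f" and G: "loc_integrable G" and S: "loc_integrable S"
    and f2: "(epow_int 2 (nrm f)) < \<infinity>"
    and wg: "weak_grad_v f G" and ke: "kinetic_eq f S"
    and K: "K \<ge> 0" "kernel_increment K (bpot_v :: 'd pt \<Rightarrow> _)"
      "kernel_increment K (apot :: 'd pt \<Rightarrow> _)"
  defines "P \<equiv> (\<lambda>z. pot (\<lambda>s. \<tau> s / \<nu> s) h (nrm S) z + pot \<nu> h (nrm G) z)"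
  defines "Q \<equiv> (\<lambda>z. ennreal K * (P (z + (0, h, 0)) + P z))"
  assumes Qm: "Q \<in> borel_measurable borel" and Qi: "\<And>R. (\<integral>\<^sup>+z. Q z * indicator (cball 0 R) z \<partial>lborel) < \<infinity>"
  shows "AE z in lborel. ennreal (mass TYPE('d pt) * \<bar>f (z + (0, h, 0)) - f z\<bar>) \<le> Q z"
proof -
  let ?c = "mass TYPE('d pt)" and ?g = "\<lambda>w. f (w + (0, h, 0)) - f w"
  note [measurable] = f[THEN loc_integrable_measurable] Qm
  have g: "loc_integrable ?g" by (intro loc_integrable_diff loc_integrable_translate f)
  obtain \<eta> where \<eta>: "\<And>s z. \<bar>Fav s f z\<bar> \<le> \<eta> s" "(\<eta> \<longlongrightarrow> 0) at_top"
    using Fav_tendsto_0[OF _ f2] by auto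
  have \<eta>0: "\<eta> s \<ge> 0" for s using \<eta>(1)[of s undefined] by linarith
  have Fm: "Fav s ?g \<in> borel_measurable borel" for s
  proof -
    have [measurable]: "(\<lambda>x. bump 0 (M s (fst x) (snd x :: 'd pt))) \<in> borel_measurable (borel \<Otimes>\<^sub>M borel)"
      by (rule measurable_compose[OF _ bump_measurable]) measurable
    have "(\<lambda>z. \<integral>w. ?g w * bump 0 (M s z w) \<partial>lborel) \<in> borel_measurable borel"
      by (intro lborel.borel_measurable_lebesgue_integral) (simp add: case_prod_beta)
    then show ?thesis unfolding Fav_def[abs_def] by measurable
  qed
  have point: "ennreal \<bar>Fav (- s) ?g z\<bar> \<le> Q z + ennreal (2 * \<eta> s)" if "s \<ge> 0" for s z
  proof -
    have "\<bar>Fav (- s) ?g z\<bar> \<le> \<bar>Fav (- s) ?g z - Fav s ?g z\<bar> + \<bar>Fav s ?g z\<bar>" by linarith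
    also have "\<bar>Fav s ?g z\<bar> \<le> 2 * \<eta> s"
      unfolding Fav_translate[OF f, symmetric] using \<eta>(1)[of s "z + (0, h, 0)"] \<eta>(1)[of s z] by linarith
    finally have "ennreal \<bar>Fav (- s) ?g z\<bar> \<le> ennreal (\<bar>Fav (- s) ?g z - Fav s ?g z\<bar> + 2 * \<eta> s)"
      by (intro ennreal_leI) simp
    also have "\<dots> = ennreal \<bar>Fav (- s) ?g z - Fav s ?g z\<bar> + ennreal (2 * \<eta> s)"
      using \<eta>0 by simp
    also have "\<dots> \<le> Q z + ennreal (2 * \<eta> s)"
      unfolding Fav_translate[OF f, symmetric] Q_def P_def using that
      by (intro add_right_mono Fav_increment_le f G S wg ke K) auto
    finally show ?thesis .
  qed
  have "AE z in lborel. ennreal \<bar>?c * ?g z\<bar> \<le> Q z"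
  proof (rule AE_le_of_Cc[OF _ Qm Qi])
    show "loc_integrable (\<lambda>z. ?c * ?g z)"
      unfolding loc_integrable_def
    proof (intro conjI allI)
      fix R
      have "(\<integral>\<^sup>+w. ennreal (norm (?c * ?g w)) * indicator (cball 0 R) w \<partial>lborel) = ennreal ?c * (\<integral>\<^sup>+w. ennreal (norm (?g w)) * indicator (cball 0 R) w \<partial>lborel)"
        using mass_pos[where 'd='d]
        by (subst nn_integral_cmult[symmetric]) (auto simp: abs_mult ennreal_mult mult.assoc)
      then show "(\<integral>\<^sup>+w. ennreal (norm (?c * ?g w)) * indicator (cball 0 R) w \<partial>lborel) < \<infinity>"
        using g by (simp add: loc_integrable_def ennreal_mult_less_top)
    qed measurable
    fix \<psi> :: "'d pt \<Rightarrow> real" assume \<psi>: "Cc_nonneg \<psi>"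
    let ?F = "\<lambda>s. \<integral>z. \<psi> z * Fav (- s) ?g z \<partial>lborel" and ?I = "\<integral>z. \<psi> z * ?g z \<partial>lborel"
    let ?J = "\<integral>\<^sup>+z. ennreal (\<psi> z) \<partial>lborel" and ?Q = "\<integral>\<^sup>+z. ennreal (\<psi> z) * Q z \<partial>lborel"
    note p0 = Cc_nonnegD(2)[OF \<psi>]
    note [measurable] = Cc_nonnegD(3)[OF \<psi>]
    obtain L R where L: "L \<ge> 0" "\<And>x. \<bar>\<psi> x\<bar> \<le> L * indicator (cball 0 R) x"
      using Cc_nonneg_bound[OF \<psi>] by metis
    show "ennreal \<bar>\<integral>z. \<psi> z * (?c * ?g z) \<partial>lborel\<bar> \<le> ?Q"
    proof (cases "?Q")
      case (real B)
      have "?J \<le> (\<integral>\<^sup>+z. ennreal L * indicator (cball (0::'d pt) R) z \<partial>lborel)"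
      proof (intro nn_integral_mono)
        fix z
        have "\<psi> z \<le> L * indicator (cball 0 R) z" using L(2)[of z] by linarith
        then show "ennreal (\<psi> z) \<le> ennreal L * indicator (cball 0 R) z"
          by (cases "z \<in> cball 0 R") (auto intro: ennreal_leI simp: ennreal_neg)
      qed
      also have "\<dots> < \<infinity>" using emeasure_lborel_cball_finite[of "0::'d pt" R]
        by (simp add: nn_integral_cmult ennreal_mult_less_top)
      finally obtain J where J: "?J = ennreal J" "J \<ge> 0"
        by (cases "?J") auto
      have bound: "\<bar>?F s\<bar> \<le> B + J * (2 * \<eta> s)" if s: "s \<ge> 0" for s
      proof -
        have "ennreal \<bar>?F s\<bar> \<le> (\<integral>\<^sup>+z. ennreal \<bar>\<psi> z * Fav (- s) ?g z\<bar> \<partial>lborel)"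
          by (rule ennreal_norm_integral_le)
        also have "\<dots> \<le> (\<integral>\<^sup>+z. ennreal (\<psi> z) * Q z + ennreal (\<psi> z) * ennreal (2 * \<eta> s) \<partial>lborel)"
        proof (intro nn_integral_mono)
          fix z
          have "ennreal \<bar>\<psi> z * Fav (- s) ?g z\<bar> = ennreal (\<psi> z) * ennreal \<bar>Fav (- s) ?g z\<bar>"
            using p0[of z] by (simp add: abs_mult ennreal_mult)
          also have "\<dots> \<le> ennreal (\<psi> z) * (Q z + ennreal (2 * \<eta> s))"
            by (intro mult_left_mono point s) auto
          finally show "ennreal \<bar>\<psi> z * Fav (- s) ?g z\<bar> \<le> ennreal (\<psi> z) * Q z + ennreal (\<psi> z) * ennreal (2 * \<eta> s)"
            by (simp only: distrib_left)
        qed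
        also have "\<dots> = ?Q + ?J * ennreal (2 * \<eta> s)"
          by (simp add: nn_integral_add nn_integral_multc)
        also have "\<dots> = ennreal (B + J * (2 * \<eta> s))"
          using real J \<eta>0[of s] by (simp add: ennreal_mult)
        finally show ?thesis
          using ennreal_le_iff[of "B + J * (2 * \<eta> s)"] real J \<eta>0[of s] by (simp del: ennreal_plus)
      qed
      have "(?F \<longlongrightarrow> ?c * ?I) at_top"
        using filterlim_compose[OF Fav_weak_limit[OF g \<psi>] filterlim_uminus_at_bot_at_top] .
      then have l1: "((\<lambda>s. \<bar>?F s\<bar>) \<longlongrightarrow> \<bar>?c * ?I\<bar>) at_top"
        by (rule tendsto_rabs)
      have l2: "((\<lambda>s. B + J * (2 * \<eta> s)) \<longlongrightarrow> B + J * (2 * 0)) at_top"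
        by (intro tendsto_intros \<eta>(2))
      have "\<bar>?c * ?I\<bar> \<le> B + J * (2 * 0)"
        by (rule tendsto_le[OF _ l2 l1]) (use bound in \<open>auto intro: eventually_mono[OF eventually_ge_at_top[of 0]]\<close>)
      moreover have "(\<integral>z. \<psi> z * (?c * ?g z) \<partial>lborel) = ?c * ?I"
        unfolding mult.left_commute[of "\<psi> _" ?c] by (rule integral_mult_right_zero)
      ultimately show ?thesis unfolding real by (simp add: ennreal_leI)
    qed simp
  qed
  then show ?thesis using mass_pos[where 'd='d] by (simp add: abs_mult)
qed

end

section \<open>The Besov estimate\<close>

lemma nn_integral_lborel_translate:
  fixes f :: "'a::euclidean_space \<Rightarrow> ennreal"
  assumes "f \<in> borel_measurable borel"
  shows "(\<integral>\<^sup>+x. f (x + c) \<partial>lborel) = (\<integral>\<^sup>+x. f x \<partial>lborel)"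
  using nn_integral_affine[OF assms, of 1 c] by (simp add: add.commute)

text \<open>A crude substitute for Minkowski: one factor \<open>2 powr q\<close> comes from the
  power of a sum, another from the two equal bounds since \<open>2 \<le> 2 powr q\<close>, which
  makes 4 inside the power.\<close>

lemma nn_integral_epowr_add_le:
  fixes f g :: "'a::euclidean_space \<Rightarrow> ennreal"
  assumes [measurable]: "f \<in> borel_measurable borel" "g \<in> borel_measurable borel" and q: "q \<ge> 1" and B: "B \<ge> 0"
    and "(epow_int q f) \<le> ennreal (B powr q)" "(epow_int q g) \<le> ennreal (B powr q)"
  shows "(\<integral>\<^sup>+x. epowr (f x + g x) q \<partial>lborel) \<le> ennreal ((4 * B) powr q)"
proof -
  have "(\<integral>\<^sup>+x. epowr (f x + g x) q \<partial>lborel) \<le> (\<integral>\<^sup>+x. ennreal (2 powr q) * (epowr (f x) q + epowr (g x) q) \<partial>lborel)"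
    using q by (intro nn_integral_mono epowr_add_le) simp
  also have "\<dots> = ennreal (2 powr q) * ((epow_int q f) + (epow_int q g))"
    by (simp add: nn_integral_cmult nn_integral_add)
  also have "\<dots> \<le> ennreal (2 powr q) * (ennreal (B powr q) + ennreal (B powr q))"
    by (intro mult_left_mono add_mono assms) auto
  also have "\<dots> = ennreal (2 powr q * (2 * B powr q))"
    by (simp add: ennreal_plus[symmetric] ennreal_mult[symmetric] del: ennreal_plus)
  also have "\<dots> \<le> ennreal (2 powr q * (2 powr q * B powr q))"
  proof (intro ennreal_leI mult_left_mono mult_right_mono)
    show "2 \<le> (2::real) powr q" using powr_mono[of 1 q "2::real"] q by simp
  qed auto
  also have "2 powr q * (2 powr q * B powr q) = (4 * B) powr q"
    using B powr_mult[of 2 2 q] by (simp add: powr_mult)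
  finally show ?thesis .
qed

context kinetic_scaling begin

lemma pot_measurable:
  fixes F :: "'d::finite pt \<Rightarrow> ennreal"
  assumes [measurable]: "F \<in> borel_measurable borel" "\<omega> \<in> borel_measurable borel"
  shows "pot \<omega> h F \<in> borel_measurable borel"
proof -
  note [measurable] = avg_measurable[OF assms(1)]
  have "(\<lambda>(z, s). ennreal (min 1 (norm h * exp (- s)) * \<omega> s) * avg s F z) \<in> borel_measurable (borel \<Otimes>\<^sub>M lborel)"
  proof -
    have "(\<lambda>x. (\<lambda>(s, z). avg s F z) (snd x, fst x)) \<in> borel_measurable (borel \<Otimes>\<^sub>M lborel)"
      by measurable
    then show ?thesis unfolding case_prod_beta by measurable
  qed
  then show ?thesis unfolding pot_def[abs_def] by (intro lborel.borel_measurable_nn_integral)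
qed

text \<open>The factors are the 2 of the mixture inequality, the scale integral, and the norm of the
  averages from \<open>L\<^sup>p\<close> to \<open>L\<^sup>q\<close>. None of them involves
  \<open>k\<close>.\<close>

definition cpot :: "'d::finite pt itself \<Rightarrow> real \<Rightarrow> real \<Rightarrow> real \<Rightarrow> real" where
  "cpot T \<sigma> p q = 2 * (1 / \<sigma> + 1 / (1 - \<sigma>)) * cavg2 T p q powr (1 / q)"

lemma cpot_pos: "0 < \<sigma> \<Longrightarrow> \<sigma> < 1 \<Longrightarrow> cpot TYPE('d::finite pt) \<sigma> p q > 0"
  using cavg2_pos[where 'd='d, of p q] by (simp add: cpot_def add_pos_pos)

text \<open>The second condition on \<open>\<omega>\<close> says that the weight times the norm of
  the average at scale \<open>s\<close> is a pure exponential. The mixture inequality then leaves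
  exactly the scale integral that scales like \<open>norm h powr \<sigma>\<close>.\<close>

lemma nn_integral_epowr_pot:
  fixes F :: "'d::finite pt \<Rightarrow> ennreal"
  assumes [measurable]: "F \<in> borel_measurable borel" "\<omega> \<in> borel_measurable borel"
    and \<omega>: "\<And>s. \<omega> s \<ge> 0" "\<And>s. \<omega> s * V (real CARD('d)) s powr (- (1 / p - 1 / q)) = E * exp (\<sigma> * s)"
    and E: "E > 0" and \<sigma>: "0 < \<sigma>" "\<sigma> < 1" and h: "h \<noteq> 0" and p: "p \<ge> 1" and q: "q > p"
    and F: "(epow_int p F) \<le> ennreal (A powr p)" and A: "A > 0"
  shows "(epow_int q (pot \<omega> h F)) \<le> ennreal ((cpot TYPE('d pt) \<sigma> p q * (E * norm h powr \<sigma> * A)) powr q)"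
proof -
  let ?c2 = "cavg2 TYPE('d pt) p q" and ?cs = "1 / \<sigma> + 1 / (1 - \<sigma>)"
  let ?X = "ennreal ?c2 * epowr (epow_int p F) (q / p)"
  let ?m = "E * (norm h powr \<sigma> * ?cs)"
  have cs: "?cs > 0" using \<sigma> by (simp add: add_pos_pos)
  have m: "?m > 0" using E cs h by simp
  have "(epow_int q (pot \<omega> h F)) \<le> ennreal (2 powr q * ?m powr q) * ?X"
    unfolding pot_def
  proof (rule nn_integral_epowr_mixture[where N="\<lambda>s. V (real CARD('d)) s powr (- (1 / p - 1 / q))"])
    show "(\<lambda>(s, z). avg s F z) \<in> borel_measurable (borel \<Otimes>\<^sub>M borel)" by (rule avg_measurable) measurable
    show "(epow_int q (avg s F)) \<le> ennreal ((V (real CARD('d)) s powr (- (1 / p - 1 / q))) powr q) * ?X" for s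
      by (rule nn_integral_epowr_avg) (use p q in auto)
    have "(\<integral>\<^sup>+s. ennreal (min 1 (norm h * exp (- s)) * \<omega> s * V (real CARD('d)) s powr (- (1 / p - 1 / q))) \<partial>lborel)
       = (\<integral>\<^sup>+s. ennreal E * ennreal (min 1 (norm h * exp (- s)) * exp (\<sigma> * s)) \<partial>lborel)"
      unfolding mult.assoc \<omega>(2) using E by (intro nn_integral_cong) (simp add: ennreal_mult'[symmetric] mult_ac)
    also have "\<dots> = ennreal E * (\<integral>\<^sup>+s. ennreal (min 1 (norm h * exp (- s)) * exp (\<sigma> * s)) \<partial>lborel)"
      by (intro nn_integral_cmult) measurable
    also have "\<dots> \<le> ennreal E * ennreal (norm h powr \<sigma> * ?cs)"
      using h by (intro mult_left_mono nn_integral_min_exp \<sigma>) auto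
    also have "\<dots> = ennreal ?m" using E cs by (simp add: ennreal_mult)
    finally show "(\<integral>\<^sup>+s. ennreal (min 1 (norm h * exp (- s)) * \<omega> s * V (real CARD('d)) s powr (- (1 / p - 1 / q))) \<partial>lborel) \<le> ennreal ?m" .
    show "?m > 0" by (rule m)
    show "q \<ge> 1" using p q by simp
    show "0 \<le> min 1 (norm h * exp (- s)) * \<omega> s" for s using \<omega>(1)[of s] by simp
    show "(\<lambda>s. V (real CARD('d)) s powr (- (1 / p - 1 / q))) \<in> borel_measurable borel" by measurable
  qed simp_all
  also have "\<dots> \<le> ennreal (2 powr q * ?m powr q) * (ennreal ?c2 * ennreal (A powr q))"
  proof (intro mult_left_mono)
    have "epowr (epow_int p F) (q / p) \<le> epowr (ennreal (A powr p)) (q / p)"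
      using p q by (intro epowr_mono F) auto
    then show "epowr (epow_int p F) (q / p) \<le> ennreal (A powr q)"
      using p q by (simp add: powr_powr)
  qed auto
  also have "\<dots> = ennreal ((2 powr q * ?m powr q) * (?c2 * A powr q))"
    using cavg2_pos[where 'd='d, of p q] by (simp add: ennreal_mult)
  also have "?c2 = (?c2 powr (1 / q)) powr q"
    using cavg2_pos[where 'd='d, of p q] p q by (simp add: powr_powr)
  also have "(2 powr q * ?m powr q) * ((?c2 powr (1 / q)) powr q * A powr q) = (cpot TYPE('d pt) \<sigma> p q * (E * norm h powr \<sigma> * A)) powr q"
  proof -
    have "(2 powr q * ?m powr q) * ((?c2 powr (1 / q)) powr q * A powr q) = ((2 * ?m) * (?c2 powr (1 / q) * A)) powr q"
      using m A by (simp only: powr_mult)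
    also have "(2 * ?m) * (?c2 powr (1 / q) * A) = cpot TYPE('d pt) \<sigma> p q * (E * norm h powr \<sigma> * A)"
      unfolding cpot_def by (simp only: mult_ac)
    finally show ?thesis .
  qed
  finally show ?thesis .
qed

text \<open>The two equations for \<open>\<sigma>\<close> say that the gradient and the source
  contribute with the same growth in \<open>s\<close>; \<open>e1\<close> and \<open>e2\<close>
  collect the remaining powers of \<open>exp k\<close>. The factor 16 is a 4 for adding the two
  potentials times a 4 for adding the two base points.\<close>

lemma increment_estimate:
  fixes f :: "'d::finite pt \<Rightarrow> real" and G S :: "'d pt \<Rightarrow> real^'d" and h :: "real^'d"
  assumes [measurable]: "f \<in> borel_measurable borel" "G \<in> borel_measurable borel" "S \<in> borel_measurable borel"
    and f2: "(epow_int 2 (nrm f)) < \<infinity>"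
    and GA: "(epow_int p (nrm G)) \<le> ennreal (A powr p)" "A > 0"
    and SB: "(epow_int p' (nrm S)) \<le> ennreal (B powr p')" "B > 0"
    and wg: "weak_grad_v f G" and ke: "kinetic_eq f S"
    and K: "K > 0" "kernel_increment K (bpot_v :: 'd pt \<Rightarrow> _)"
      "kernel_increment K (apot :: 'd pt \<Rightarrow> _)"
    and p: "p \<ge> 1" "p' \<ge> 1" "q > p" "q > p'" and \<sigma>: "0 < \<sigma>" "\<sigma> < 1" and h: "h \<noteq> 0"
    and \<sigma>1: "\<sigma> = \<gamma> - (\<beta> * (1 + real CARD('d)) + 2 * real CARD('d) * \<gamma>) * (1 / p - 1 / q)"
    and \<sigma>2: "\<sigma> = \<beta> - \<gamma> - (\<beta> * (1 + real CARD('d)) + 2 * real CARD('d) * \<gamma>) * (1 / p' - 1 / q)"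
  defines "e1 \<equiv> - 1 + (real CARD('d) - 1) * (1 / p - 1 / q)"
  defines "e2 \<equiv> 2 + (real CARD('d) - 1) * (1 / p' - 1 / q)"
  shows "(\<integral>\<^sup>+z. epowr (ennreal \<bar>f (z + (0, h, 0)) - f z\<bar>) q \<partial>lborel) \<le>
    ennreal ((16 * K * (cpot TYPE('d pt) \<sigma> p q + cpot TYPE('d pt) \<sigma> p' q) / mass TYPE('d pt)
       * (norm h powr \<sigma> * (exp (k * e1) * A + exp (k * e2) * B))) powr q)"
proof -
  let ?cp = "cpot TYPE('d pt) \<sigma> p q" and ?cp' = "cpot TYPE('d pt) \<sigma> p' q"
  let ?E = "norm h powr \<sigma> * (exp (k * e1) * A + exp (k * e2) * B)" and ?N = "\<integral>\<^sup>+z. epowr (ennreal \<bar>f (z + (0, h, 0)) - f z\<bar>) q \<partial>lborel"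
  let ?n = "real CARD('d)" and ?c = "mass TYPE('d pt)"
  let ?D = "?cp + ?cp'"
  \<comment> \<open>One common bound for both potentials, so that the additions below involve equal
    sizes.\<close>
  define H where "H = ?D * ?E"
  have cp: "?cp > 0" "?cp' > 0" using cpot_pos \<sigma> by auto
  have Hnn: "?E > 0"
    using h GA SB by (intro mult_pos_pos add_pos_pos) auto
  have H0: "H > 0" unfolding H_def by (intro mult_pos_pos[OF add_pos_pos[OF cp] Hnn])
  have [measurable]: "\<nu> \<in> borel_measurable borel" "(\<lambda>s. \<tau> s / \<nu> s) \<in> borel_measurable borel"
    unfolding \<tau>_def[abs_def] \<nu>_def[abs_def] by measurable
  let ?PS = "pot (\<lambda>s. \<tau> s / \<nu> s) h (nrm S)" and ?PG = "pot \<nu> h (nrm G)"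
  have m [measurable]: "?PS \<in> borel_measurable borel" "?PG \<in> borel_measurable borel"
    by (intro pot_measurable; measurable)+
  have powV: "V ?n s powr a = exp (a * ((1 - ?n) * k + (\<beta> * (1 + ?n) + 2 * ?n * \<gamma>) * s))" for a s
    by (simp add: V_def powr_def)
  have IG: "(epow_int q ?PG) \<le> ennreal (H powr q)"
  proof -
    have "(epow_int q ?PG) \<le> ennreal ((?cp * (exp (k * e1) * norm h powr \<sigma> * A)) powr q)"
    proof (rule nn_integral_epowr_pot)
      show "\<nu> s * V ?n s powr (- (1 / p - 1 / q)) = exp (k * e1) * exp (\<sigma> * s)" for s
        unfolding powV \<nu>_def e1_def exp_add[symmetric] \<sigma>1 by (simp add: algebra_simps)
    qed (use GA p \<sigma> h in \<open>auto simp: less_imp_le\<close>)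
    also have "\<dots> \<le> ennreal (H powr q)"
    proof (intro ennreal_leI powr_mono2)
      have "exp (k * e1) * norm h powr \<sigma> * A \<le> ?E"
        using GA(2) SB(2) by (simp add: algebra_simps)
      then show "?cp * (exp (k * e1) * norm h powr \<sigma> * A) \<le> H"
        unfolding H_def by (rule mult_mono[rotated]) (use cp GA(2) SB(2) in auto)
    qed (use p cp GA in auto)
    finally show ?thesis .
  qed
  have IS: "(epow_int q ?PS) \<le> ennreal (H powr q)"
  proof -
    have "(epow_int q ?PS) \<le> ennreal ((?cp' * (exp (k * e2) * norm h powr \<sigma> * B)) powr q)"
    proof (rule nn_integral_epowr_pot)
      show "\<tau> s / \<nu> s * V ?n s powr (- (1 / p' - 1 / q)) = exp (k * e2) * exp (\<sigma> * s)" for s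
        unfolding powV \<nu>_def \<tau>_def exp_diff[symmetric] e2_def exp_add[symmetric] \<sigma>2 by (simp add: algebra_simps)
    qed (use SB p \<sigma> h in \<open>auto simp: less_imp_le\<close>)
    also have "\<dots> \<le> ennreal (H powr q)"
    proof (intro ennreal_leI powr_mono2)
      have "exp (k * e2) * norm h powr \<sigma> * B \<le> ?E"
        using GA(2) SB(2) by (simp add: algebra_simps)
      then show "?cp' * (exp (k * e2) * norm h powr \<sigma> * B) \<le> H"
        unfolding H_def by (rule mult_mono[rotated]) (use cp GA(2) SB(2) in auto)
    qed (use p cp SB in auto)
    finally show ?thesis .
  qed
  let ?P = "\<lambda>z. ?PS z + ?PG z"
  let ?Q = "\<lambda>z. ennreal K * (?P (z + (0, h, 0)) + ?P z)"
  have q1: "q \<ge> 1" using p by simp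
  have IP: "(epow_int q ?P) \<le> ennreal ((4 * H) powr q)"
    by (rule nn_integral_epowr_add_le) (use q1 H0 IG IS in auto)
  have IP': "(\<integral>\<^sup>+z. epowr (?P (z + (0, h, 0)) + ?P z) q \<partial>lborel) \<le> ennreal ((4 * (4 * H)) powr q)"
  proof (rule nn_integral_epowr_add_le[OF _ _ q1 _ _ IP])
    show "(\<integral>\<^sup>+z. epowr (?P (z + (0, h, 0))) q \<partial>lborel) \<le> ennreal ((4 * H) powr q)"
      by (subst nn_integral_lborel_translate[where f="\<lambda>z. epowr (?P z) q"]) (use IP in auto)
  qed (use H0 in auto)
  have IQ: "(epow_int q ?Q) \<le> ennreal ((16 * K * H) powr q)"
  proof -
    have "(epow_int q ?Q) = ennreal (K powr q) * (\<integral>\<^sup>+z. epowr (?P (z + (0, h, 0)) + ?P z) q \<partial>lborel)"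
      using K(1) q1 by (subst epowr_mult) (auto intro!: nn_integral_cmult)
    also have "\<dots> \<le> ennreal (K powr q) * ennreal ((4 * (4 * H)) powr q)"
      by (intro mult_left_mono IP') auto
    also have "\<dots> = ennreal ((K * (4 * (4 * H))) powr q)"
      using K(1) H0 by (simp add: ennreal_mult[symmetric] powr_mult[symmetric])
    finally show ?thesis by (simp add: mult_ac)
  qed
  have Qm: "?Q \<in> borel_measurable borel" by measurable
  have Qi: "(\<integral>\<^sup>+z. ?Q z * indicator (cball 0 R) z \<partial>lborel) < \<infinity>" for R
  proof -
    have "(\<integral>\<^sup>+z. ?Q z * indicator (cball 0 R) z \<partial>lborel) \<le> (\<integral>\<^sup>+z. epowr (?Q z) q + indicator (cball 0 R) z \<partial>lborel)"
    proof (intro nn_integral_mono)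
      fix z
      show "?Q z * indicator (cball 0 R) z \<le> epowr (?Q z) q + indicator (cball 0 R) z"
        using epowr_tangent[of 1 q "?Q z"] q1 by (cases "z \<in> cball 0 R") auto
    qed
    also have "\<dots> = (epow_int q ?Q) + emeasure lborel (cball (0::'d pt) R)"
      by (subst nn_integral_add) auto
    also have "\<dots> < \<infinity>" using order_le_less_trans[OF IQ] emeasure_lborel_cball_finite[of "0::'d pt" R] by simp
    finally show ?thesis .
  qed
  have lf: "loc_integrable f" by (rule loc_integrable_Lp[OF _ _ f2]) auto
  have lG: "loc_integrable G" by (rule loc_integrable_Lp[OF _ p(1) order_le_less_trans[OF GA(1)]]) auto
  have lS: "loc_integrable S" by (rule loc_integrable_Lp[OF _ p(2) order_le_less_trans[OF SB(1)]]) auto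
  have ae: "AE z in lborel. ennreal (?c * \<bar>f (z + (0, h, 0)) - f z\<bar>) \<le> ?Q z"
    by (rule increment_AE_le[OF lf lG lS f2 wg ke _ K(2,3) Qm Qi]) (use K(1) in auto)
  have c: "?c > 0" by (rule mass_pos)
  have "ennreal (?c powr q) * ?N
    = (\<integral>\<^sup>+z. epowr (ennreal (?c * \<bar>f (z + (0, h, 0)) - f z\<bar>)) q \<partial>lborel)"
    using c q1 by (simp add: ennreal_mult epowr_mult nn_integral_cmult powr_mult)
  also have "\<dots> \<le> (epow_int q ?Q)"
    using ae q1 by (intro nn_integral_mono_AE) (auto intro!: epowr_mono)
  also have "\<dots> \<le> ennreal ((16 * K * H) powr q)" by (rule IQ)
  finally have "ennreal ((1 / ?c) powr q) * (ennreal (?c powr q) * ?N)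
     \<le> ennreal ((1 / ?c) powr q) * ennreal ((16 * K * H) powr q)" by (rule mult_left_mono) simp
  moreover have "ennreal ((1 / ?c) powr q) * (ennreal (?c powr q) * X) = X" for X
    using c by (simp add: mult.assoc[symmetric] ennreal_mult'[symmetric] powr_mult[symmetric] less_imp_le)
  moreover have "ennreal ((1 / ?c) powr q) * ennreal ((16 * K * H) powr q) = ennreal ((1 / ?c * (16 * K * H)) powr q)"
    using c K(1) H0 by (simp add: ennreal_mult'[symmetric] powr_mult[symmetric] less_imp_le)
  moreover have "1 / ?c * (16 * K * H) = 16 * K * ?D / ?c * ?E"
    by (simp add: H_def)
  ultimately show ?thesis by (simp only:)
qed

lemma potentials_increment:
  obtains K where "K > 0"
    "kernel_increment K (bpot_v :: 'd::finite pt \<Rightarrow> _)"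
    "kernel_increment K (apot :: 'd::finite pt \<Rightarrow> _)"
proof -
  obtain K1 where K1: "K1 \<ge> 0" "kernel_increment K1 (bpot_v :: 'd pt \<Rightarrow> _)"
    using C1_kernel_increment[of bpot_v, OF Ck_bpot_v potentials_eq_0(3)] by blast
  obtain K2 where K2: "K2 \<ge> 0" "kernel_increment K2 (apot :: 'd pt \<Rightarrow> _)"
    using C1_kernel_increment[of apot, OF Ck_apot potentials_eq_0(4)] by blast
  show thesis
  proof (rule that[of "K1 + K2 + 1"])
    show "kernel_increment (K1 + K2 + 1) (bpot_v :: 'd pt \<Rightarrow> _)"
      by (rule kernel_increment_mono[OF K1(2)]) (use K2 in simp)
    show "kernel_increment (K1 + K2 + 1) (apot :: 'd pt \<Rightarrow> _)"
      by (rule kernel_increment_mono[OF K2(2)]) (use K1 in simp)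
  qed (use K1 K2 in simp)
qed

end

section \<open>Borel representatives and invariance under null sets\<close>

lemma borel_measurable_completion_cong_AE:
  fixes f g :: "'a \<Rightarrow> real"
  assumes ae: "AE x in completion M. f x = g x" and f: "f \<in> borel_measurable (completion M)"
  shows "g \<in> borel_measurable (completion M)"
proof (rule measurableI)
  fix A :: "real set" assume "A \<in> sets borel"
  then have fA: "f -` A \<inter> space (completion M) \<in> sets (completion M)" using f by (rule measurable_sets[rotated])
  show "g -` A \<inter> space (completion M) \<in> sets (completion M)"
    by (rule completion.in_sets_AE[OF _ fA]) (use ae in \<open>eventually_elim, auto\<close>)
qed simp

text \<open>Non-measurable integrands are included, both integrals then being 0 by convention. The
  weak formulations thus pass to Borel representatives without a measurability check for the
  products with derivatives of test functions.\<close>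

lemma integral_completion_cong_AE:
  fixes f g :: "'a \<Rightarrow> real"
  assumes ae: "AE x in completion M. f x = g x"
  shows "integral\<^sup>L (completion M) f = integral\<^sup>L (completion M) g"
proof (cases "f \<in> borel_measurable (completion M)")
  case True
  with borel_measurable_completion_cong_AE[OF ae] show ?thesis by (intro integral_cong_AE ae) auto
next
  case False
  have "g \<notin> borel_measurable (completion M)"
    using False borel_measurable_completion_cong_AE[where f=g and g=f and M=M] ae by (auto simp: eq_commute)
  with False show ?thesis
    by (metis borel_measurable_integrable not_integrable_integral_eq)
qed

lemma completion_ex_borel_measurable_euclidean:
  fixes g :: "'a \<Rightarrow> 'b::euclidean_space"
  assumes g: "g \<in> borel_measurable (completion M)"
  obtains g' where "g' \<in> borel_measurable M" "AE x in M. g x = g' x"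
proof -
  have "\<exists>g'\<in>borel_measurable M. AE x in M. g x \<bullet> e = g' x" for e
    using g by (intro completion_ex_borel_measurable_real) auto
  then obtain G where G: "\<And>e. G e \<in> borel_measurable M" "\<And>e. AE x in M. g x \<bullet> e = G e x" by metis
  have "AE x in M. \<forall>e\<in>Basis. g x \<bullet> e = G e x"
    using G(2) by (intro AE_finite_allI) auto
  then have "AE x in M. g x = (\<Sum>e\<in>Basis. G e x *\<^sub>R e)"
  proof eventually_elim
    case (elim x)
    have "(\<Sum>e\<in>Basis. G e x *\<^sub>R e) = (\<Sum>e\<in>Basis. (g x \<bullet> e) *\<^sub>R e)" using elim by (intro sum.cong) auto
    then show ?case by (simp add: euclidean_representation)
  qed
  moreover have "(\<lambda>x. \<Sum>e\<in>Basis. G e x *\<^sub>R e) \<in> borel_measurable M" using G(1) by measurable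
  ultimately show thesis using that by blast
qed

lemma AE_lborel_translate:
  fixes c :: "'a::euclidean_space"
  assumes "AE x in lborel. P x"
  shows "AE x in lborel. P (x + c)"
proof -
  obtain N where N: "\<And>x. x \<in> space lborel - N \<Longrightarrow> P x" "N \<in> null_sets lborel"
    using AE_E3[OF assms] by blast
  have Nb: "N \<in> sets borel" using N(2) by auto
  have "AE x in distr lborel borel (\<lambda>x. c + x). x \<notin> N"
  proof -
    have "lborel = distr lborel borel (\<lambda>x. c + x)"
      using lborel_affine[of 1 c] by (simp add: density_1)
    then show ?thesis using AE_not_in[OF N(2)] by metis
  qed
  then have "AE x in lborel. c + x \<notin> N"
    using Nb by (subst (asm) AE_distr_iff) auto
  then show ?thesis by eventually_elim (simp add: N(1) add.commute)
qed

lemma Lp_norm_eq: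
  fixes g :: "'a::euclidean_space \<Rightarrow> 'b::real_normed_vector"
  assumes "p > 0"
  shows "Lp_norm p g = epowr (epow_int p (nrm g)) (1 / p)"
  unfolding Lp_norm_def epowr_def Let_def nn_integral_completion by simp

lemma Lp_norm_le_iff:
  fixes g :: "'a::euclidean_space \<Rightarrow> 'b::real_normed_vector"
  assumes "p > 0" "C \<ge> 0"
  shows "Lp_norm p g \<le> ennreal C \<longleftrightarrow> (epow_int p (nrm g)) \<le> ennreal (C powr p)"
proof
  let ?I = "\<integral>\<^sup>+z. epowr (ennreal (norm (g z))) p \<partial>lborel"
  { assume "Lp_norm p g \<le> ennreal C"
    then have "epowr (epowr ?I (1 / p)) p \<le> epowr (ennreal C) p"
      unfolding Lp_norm_eq[OF assms(1)] using assms by (intro epowr_mono) auto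
    then show "?I \<le> ennreal (C powr p)" using assms by (simp add: epowr_epowr) }
  { assume "?I \<le> ennreal (C powr p)"
    then have "epowr ?I (1 / p) \<le> epowr (ennreal (C powr p)) (1 / p)"
      using assms by (intro epowr_mono) auto
    then show "Lp_norm p g \<le> ennreal C"
      unfolding Lp_norm_eq[OF assms(1)] using assms by (simp add: powr_powr) }
qed

lemma Lp_norm_cong_AE:
  assumes "AE z in lborel. f z = g z" shows "Lp_norm p f = Lp_norm p g"
proof -
  have "(\<integral>\<^sup>+z. ennreal (norm (f z) powr p) \<partial>lebesgue) = (\<integral>\<^sup>+z. ennreal (norm (g z) powr p) \<partial>lebesgue)"
    unfolding nn_integral_completion using assms by (intro nn_integral_cong_AE) auto
  then show ?thesis by (simp add: Lp_norm_def)
qed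

lemma Delta_x_eq: "Delta_x h f z = f (z + (0, h, 0)) - f z"
  by (cases z) (simp add: Delta_x_def)

lemma weak_grad_v_cong_AE:
  fixes f f' :: "'d::finite pt \<Rightarrow> real"
  assumes f: "AE z in lborel. f z = f' z" and G: "AE z in lborel. G z = G' z"
    and "weak_grad_v f G"
  shows "weak_grad_v f' G'"
  unfolding weak_grad_v_def
proof (intro allI impI)
  fix \<phi> :: "'d pt \<Rightarrow> real" and e assume t: "test_fun \<phi>"
  have a: "(\<integral>z. f' z * frechet_derivative \<phi> (at z) (0, 0, e) \<partial>lebesgue) = (\<integral>z. f z * frechet_derivative \<phi> (at z) (0, 0, e) \<partial>lebesgue)"
    using f by (intro integral_completion_cong_AE AE_completion) auto
  have b: "(\<integral>z. (G' z \<bullet> e) * \<phi> z \<partial>lebesgue) = (\<integral>z. (G z \<bullet> e) * \<phi> z \<partial>lebesgue)"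
    using G by (intro integral_completion_cong_AE AE_completion) auto
  show "(\<integral>z. f' z * frechet_derivative \<phi> (at z) (0, 0, e) \<partial>lebesgue) = - (\<integral>z. (G' z \<bullet> e) * \<phi> z \<partial>lebesgue)"
    unfolding a b using assms(3) t unfolding weak_grad_v_def by blast
qed

lemma kinetic_eq_cong_AE:
  fixes f f' :: "'d::finite pt \<Rightarrow> real"
  assumes f: "AE z in lborel. f z = f' z" and S: "AE z in lborel. S z = S' z"
    and "kinetic_eq f S"
  shows "kinetic_eq f' S'"
  unfolding kinetic_eq_def
proof (intro allI impI)
  fix \<phi> :: "'d pt \<Rightarrow> real" assume t: "test_fun \<phi>"
  have a: "(\<integral>z. f' z * frechet_derivative \<phi> (at z) (1, snd (snd z), 0) \<partial>lebesgue) = (\<integral>z. f z * frechet_derivative \<phi> (at z) (1, snd (snd z), 0) \<partial>lebesgue)"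
    using f by (intro integral_completion_cong_AE AE_completion) auto
  have b: "(\<integral>z. frechet_derivative \<phi> (at z) (0, 0, S' z) \<partial>lebesgue) = (\<integral>z. frechet_derivative \<phi> (at z) (0, 0, S z) \<partial>lebesgue)"
    using S by (intro integral_completion_cong_AE AE_completion) auto
  show "(\<integral>z. f' z * frechet_derivative \<phi> (at z) (1, snd (snd z), 0) \<partial>lebesgue) = (\<integral>z. frechet_derivative \<phi> (at z) (0, 0, S' z) \<partial>lebesgue)"
    unfolding a b using assms(3) t unfolding kinetic_eq_def by blast
qed

text \<open>The order of quantifiers matters: \<open>C\<close> is fixed before \<open>k\<close>,
  which is possible because \<open>bpot_v\<close>, \<open>apot\<close>, \<open>cpot\<close> and
  \<open>mass\<close> do not depend on \<open>k\<close>. The strict bounds make \<open>A\<close> and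
  \<open>B\<close> positive even when a norm vanishes, so that their logarithms can be used.\<close>

lemma kinetic_increment_bound:
  fixes \<beta> \<gamma> \<sigma> p p' q :: real
  defines "n \<equiv> real CARD('d::finite)"
  defines "e1 \<equiv> - 1 + (n - 1) * (1 / p - 1 / q)"
  defines "e2 \<equiv> 2 + (n - 1) * (1 / p' - 1 / q)"
  assumes \<beta>\<gamma>: "\<beta> > 0" "\<gamma> > 0" "\<beta> + \<gamma> = 1"
    and p: "p \<ge> 1" "p' \<ge> 1" "q > p" "q > p'" and \<sigma>: "0 < \<sigma>" "\<sigma> < 1"
    and \<sigma>1: "\<sigma> = \<gamma> - (\<beta> * (1 + n) + 2 * n * \<gamma>) * (1 / p - 1 / q)"
    and \<sigma>2: "\<sigma> = \<beta> - \<gamma> - (\<beta> * (1 + n) + 2 * n * \<gamma>) * (1 / p' - 1 / q)"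
  obtains C where "C > 0"
    "\<And>k A B h (f :: 'd pt \<Rightarrow> real) (G :: 'd pt \<Rightarrow> real^'d) (S :: 'd pt \<Rightarrow> real^'d).
      in_Lp 2 f \<Longrightarrow> in_Lp p G \<Longrightarrow> in_Lp p' S \<Longrightarrow> weak_grad_v f G \<Longrightarrow> kinetic_eq f S \<Longrightarrow>
      enn2real (Lp_norm p G) < A \<Longrightarrow> enn2real (Lp_norm p' S) < B \<Longrightarrow> h \<noteq> 0 \<Longrightarrow>
      Lp_norm q (Delta_x h f) \<le> ennreal (C * (norm h powr \<sigma> * (exp (k * e1) * A + exp (k * e2) * B)))"
proof -
  have ks: "kinetic_scaling \<beta> \<gamma>" using \<beta>\<gamma> by unfold_locales
  obtain K where K: "K > 0"
    "kernel_increment K (kinetic_scaling.bpot_v \<beta> :: 'd pt \<Rightarrow> _)"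
    "kernel_increment K (kinetic_scaling.apot \<beta> \<gamma> :: 'd pt \<Rightarrow> _)"
    using kinetic_scaling.potentials_increment[OF ks] by blast
  define C where "C = 16 * K * (kinetic_scaling.cpot TYPE('d pt) \<sigma> p q + kinetic_scaling.cpot TYPE('d pt) \<sigma> p' q) / kinetic_scaling.mass TYPE('d pt)"
  have C: "C > 0" unfolding C_def
    using K(1) kinetic_scaling.cpot_pos[OF ks \<sigma>, where 'd='d] kinetic_scaling.mass_pos[OF ks, where 'd='d]
    by (intro divide_pos_pos mult_pos_pos add_pos_pos) auto
  show thesis
  proof (rule that[OF C])
    fix k A B :: real and h :: "real^'d" and f :: "'d pt \<Rightarrow> real" and G S :: "'d pt \<Rightarrow> real^'d"
    assume Lf: "in_Lp 2 f" and LG: "in_Lp p G" and LS: "in_Lp p' S" and wg: "weak_grad_v f G" and ke: "kinetic_eq f S"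
      and A: "enn2real (Lp_norm p G) < A" and B: "enn2real (Lp_norm p' S) < B" and h: "h \<noteq> 0"
    let ?R = "C * (norm h powr \<sigma> * (exp (k * e1) * A + exp (k * e2) * B))"
    obtain f' where f': "f' \<in> borel_measurable lborel" "AE z in lborel. f z = f' z"
      using Lf completion_ex_borel_measurable_euclidean unfolding in_Lp_def by blast
    obtain G' where G': "G' \<in> borel_measurable lborel" "AE z in lborel. G z = G' z"
      using LG completion_ex_borel_measurable_euclidean unfolding in_Lp_def by blast
    obtain S' where S': "S' \<in> borel_measurable lborel" "AE z in lborel. S z = S' z"
      using LS completion_ex_borel_measurable_euclidean unfolding in_Lp_def by blast
    have A0: "A > 0" and B0: "B > 0" using A B enn2real_nonneg order_le_less_trans by blast+
    have f2: "(epow_int 2 (nrm f')) < \<infinity>"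
    proof -
      have "Lp_norm 2 f' < \<infinity>" using Lf Lp_norm_cong_AE[OF f'(2)] by (simp add: in_Lp_def)
      then obtain c where "c \<ge> 0" "Lp_norm 2 f' = ennreal c" by (cases "Lp_norm 2 f'") auto
      then have "(epow_int 2 (nrm f')) \<le> ennreal (c powr 2)"
        using Lp_norm_le_iff[of 2 c f'] by simp
      then show ?thesis using order_le_less_trans by fastforce
    qed
    have GA: "(epow_int p (nrm G')) \<le> ennreal (A powr p)"
    proof -
      have "Lp_norm p G' = ennreal (enn2real (Lp_norm p G))" using LG Lp_norm_cong_AE[OF G'(2)] by (simp add: in_Lp_def)
      then have "Lp_norm p G' \<le> ennreal A" using A by (simp add: ennreal_leI)
      then show ?thesis using Lp_norm_le_iff[of p A G'] p A0 by simp
    qed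
    have SB: "(epow_int p' (nrm S')) \<le> ennreal (B powr p')"
    proof -
      have "Lp_norm p' S' = ennreal (enn2real (Lp_norm p' S))" using LS Lp_norm_cong_AE[OF S'(2)] by (simp add: in_Lp_def)
      then have "Lp_norm p' S' \<le> ennreal B" using B by (simp add: ennreal_leI)
      then show ?thesis using Lp_norm_le_iff[of p' B S'] p B0 by simp
    qed
    have "(\<integral>\<^sup>+z. epowr (ennreal \<bar>f' (z + (0, h, 0)) - f' z\<bar>) q \<partial>lborel)
        \<le> ennreal (?R powr q)"
      unfolding C_def e1_def e2_def n_def
      by (rule kinetic_scaling.increment_estimate[OF ks _ _ _ f2 GA A0 SB B0 _ _ K p \<sigma> h])
         (use f' G' S' \<sigma>1 \<sigma>2 weak_grad_v_cong_AE[OF f'(2) G'(2) wg] kinetic_eq_cong_AE[OF f'(2) S'(2) ke] in \<open>simp_all add: n_def\<close>)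
    then have "Lp_norm q (\<lambda>z. f' (z + (0, h, 0)) - f' z) \<le> ennreal ?R"
      using C A0 B0 p by (subst Lp_norm_le_iff) auto
    moreover have "Lp_norm q (Delta_x h f) = Lp_norm q (\<lambda>z. f' (z + (0, h, 0)) - f' z)"
    proof (rule Lp_norm_cong_AE)
      show "AE z in lborel. Delta_x h f z = f' (z + (0, h, 0)) - f' z"
        using f'(2) AE_lborel_translate[OF f'(2), of "(0, h, 0)"] by eventually_elim (simp add: Delta_x_eq)
    qed
    ultimately show "Lp_norm q (Delta_x h f) \<le> ennreal ?R" by simp
  qed
qed

text \<open>Equating the two formulas for \<open>s\<close> and inserting
  \<open>\<beta> = 1 - \<gamma>\<close> gives a linear equation for \<open>\<gamma>\<close> with
  coefficient \<open>D / p\<close>, which is where \<open>\<beta>\<close>, \<open>\<gamma>\<close>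
  and \<open>D\<close> come from. The last two identities express \<open>\<alpha>\<close> as
  \<open>e2 / (e2 - e1)\<close>, the exponent that arises when \<open>exp (k * e1) * A\<close> and
  \<open>exp (k * e2) * B\<close> are made equal.\<close>

lemma exponent_identities:
  fixes d p q :: real
  defines "D \<equiv> d * (p - 2) + 2 * p + 2"
  defines "s \<equiv> (p * (4 * d + 2) - q * d * (p + 2)) / (q * D)"
  defines "\<gamma> \<equiv> (2 + 2 * d - d * p) / D"
  defines "\<beta> \<equiv> (2 * d * p + 2 * p - 4 * d) / D"
  assumes D: "D \<noteq> 0" and p: "p \<noteq> 0" and q: "q \<noteq> 0" and d: "4 * d + 2 \<noteq> 0"
  shows "\<beta> + \<gamma> = 1"
    and "s = \<gamma> - (\<beta> * (1 + d) + 2 * d * \<gamma>) * (1 / p - 1 / q)"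
    and "s = \<beta> - \<gamma> - (\<beta> * (1 + d) + 2 * d * \<gamma>) * (1 - 1 / p - 1 / q)"
    and "2 + (d - 1) * (1 - 1 / p - 1 / q) = ((3 * d + 1) / (4 * d + 2) - (d - 1) / (4 * d + 2) * s) * (D / p)"
    and "2 + (d - 1) * (1 - 1 / p - 1 / q) - (- 1 + (d - 1) * (1 / p - 1 / q)) = D / p"
proof -
  \<comment> \<open>The growth rate of the cell volume, at the chosen \<open>\<beta>\<close> and
    \<open>\<gamma>\<close>.\<close>
  have W: "\<beta> * (1 + d) + 2 * d * \<gamma> = p * (4 * d + 2) / D"
    unfolding \<beta>_def \<gamma>_def using D by (simp add: field_simps)
  show "\<beta> + \<gamma> = 1"
    unfolding \<beta>_def \<gamma>_def add_divide_distrib[symmetric] using D by (simp add: D_def algebra_simps)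
  show "s = \<gamma> - (\<beta> * (1 + d) + 2 * d * \<gamma>) * (1 / p - 1 / q)"
    unfolding W unfolding s_def \<gamma>_def using D p q by (simp add: field_simps)
  show "s = \<beta> - \<gamma> - (\<beta> * (1 + d) + 2 * d * \<gamma>) * (1 - 1 / p - 1 / q)"
    unfolding W unfolding s_def \<gamma>_def \<beta>_def using D p q by (simp add: field_simps)
  have "(3 * d + 1) / (4 * d + 2) - (d - 1) / (4 * d + 2) * s = ((3 * d + 1) * (q * D) - (d - 1) * (p * (4 * d + 2) - q * d * (p + 2))) / ((4 * d + 2) * (q * D))"
  proof -
    have "a / m - b / m * (c / e) = (a * e - b * c) / (m * e)" if "m \<noteq> 0" "e \<noteq> 0" for a b c m e :: real
      using that by (simp add: field_simps)
    then show ?thesis unfolding s_def using D q d by simp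
  qed
  also have "(3 * d + 1) * (q * D) - (d - 1) * (p * (4 * d + 2) - q * d * (p + 2)) = (4 * d + 2) * (q * (p * (1 + d) - d + 1) - (d - 1) * p)"
    unfolding D_def by (simp add: algebra_simps)
  finally have al: "(3 * d + 1) / (4 * d + 2) - (d - 1) / (4 * d + 2) * s = (q * (p * (1 + d) - d + 1) - (d - 1) * p) / (q * D)"
    using d by simp
  show "2 + (d - 1) * (1 - 1 / p - 1 / q) = ((3 * d + 1) / (4 * d + 2) - (d - 1) / (4 * d + 2) * s) * (D / p)"
    unfolding al using D p q by (simp add: field_simps)
  show "2 + (d - 1) * (1 - 1 / p - 1 / q) - (- 1 + (d - 1) * (1 / p - 1 / q)) = D / p"
    unfolding D_def using p by (simp add: field_simps)
qed

text \<open>The third and fourth claims are the numerators of \<open>\<gamma>\<close> and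
  \<open>\<beta>\<close>. The lower bound on \<open>p\<close> yields \<open>D > 0\<close> and
  \<open>\<beta> > 0\<close>, the upper one \<open>\<gamma> > 0\<close>; the upper bound on
  \<open>q\<close> means \<open>s > 0\<close>, and \<open>s < 1\<close> results from
  \<open>p < q\<close> and \<open>\<beta> > 0\<close>.\<close>

lemma exponent_bounds:
  fixes d p q :: real
  defines "D \<equiv> d * (p - 2) + 2 * p + 2"
  defines "s \<equiv> (p * (4 * d + 2) - q * d * (p + 2)) / (q * D)"
  assumes d: "d \<ge> 1" and p1: "2 - 2 / (3 * d + 2) < p" and p2: "p < 2 + 2 / d"
    and q1: "p < q" and q2: "q < p * (4 * d + 2) / (d * (p + 2))"
  shows "p > 1" "D > 0" "2 + 2 * d - d * p > 0" "2 * d * p + 2 * p - 4 * d > 0" "0 < s" "s < 1"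
proof -
  have "2 / (3 * d + 2) < 1" using d by simp
  then show p: "p > 1" using p1 by linarith
  have p3: "6 * d + 2 < p * (3 * d + 2)" using p1 d by (simp add: field_simps)
  show "2 + 2 * d - d * p > 0" using p2 d by (simp add: field_simps)
  have "(d + 1) * (6 * d + 2) < (d + 1) * (p * (3 * d + 2))" using p3 d by (intro mult_strict_left_mono) auto
  then have "0 < (3 * d + 2) * (2 * d * p + 2 * p - 4 * d)" using d by (simp add: algebra_simps)
  then show b: "2 * d * p + 2 * p - 4 * d > 0" using d by (simp add: zero_less_mult_iff)
  have "(d + 2) * (6 * d + 2) < (d + 2) * (p * (3 * d + 2))" using p3 d by (intro mult_strict_left_mono) auto
  then have "0 < (3 * d + 2) * D" using d by (simp add: D_def algebra_simps)
  then show D: "D > 0" using d by (simp add: zero_less_mult_iff)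
  have q: "q > 0" using p q1 by simp
  have "q * (d * (p + 2)) < p * (4 * d + 2)" using q2 d p by (simp add: pos_less_divide_eq)
  then show "0 < s" unfolding s_def using q D by (simp add: mult_ac)
  \<comment> \<open>The claim \<open>s < 1\<close> amounts to
    \<open>p * (4 * d + 2) < q * (2 * d * p + 2 * p + 2)\<close>; positivity of the numerator of
    \<open>\<beta>\<close> gives it with \<open>p\<close> in place of \<open>q\<close> on the
    right.\<close>
  have "p * (4 * d + 2) < p * (2 * d * p + 2 * p + 2)" using b p by simp
  also have "\<dots> < q * (2 * d * p + 2 * p + 2)" using q1 p d b by (intro mult_strict_right_mono) auto
  finally have "p * (4 * d + 2) - q * d * (p + 2) < q * D" by (simp add: D_def algebra_simps)
  then show "s < 1" unfolding s_def using q D by simp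
qed

theorem theorem1p8:
  fixes p q :: real
  defines "d \<equiv> real CARD('d::finite)"
  defines "p' \<equiv> p / (p - 1)"
  defines "qbar \<equiv> p * (4 * d + 2) / (d * (p + 2))"
  defines "s \<equiv> (p * (4 * d + 2) - q * d * (p + 2)) / (q * (d * (p - 2) + 2 * p + 2))"
  defines "\<alpha> \<equiv> (3 * d + 1) / (4 * d + 2) - (d - 1) / (4 * d + 2) * s"
  assumes "2 - 2 / (3 * d + 2) < p" and "p < 2 + 2 / d"
    and "max p p' < q" and "q < qbar"
  shows "\<exists>C>0. \<forall>(f :: 'd pt \<Rightarrow> real) (G :: 'd pt \<Rightarrow> real^'d) (S0 :: 'd pt \<Rightarrow> real^'d).
           in_Lp 2 f \<and> in_Lp p G \<and> weak_grad_v f G \<and> in_Lp p' S0 \<and> kinetic_eq f S0 \<longrightarrow>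
           besov_x s q f \<le> ennreal (C * enn2real (Lp_norm p G) powr \<alpha>
                                      * enn2real (Lp_norm p' S0) powr (1 - \<alpha>))"
proof -
  define D where "D = d * (p - 2) + 2 * p + 2"
  define \<gamma> where "\<gamma> = (2 + 2 * d - d * p) / D"
  define \<beta> where "\<beta> = (2 * d * p + 2 * p - 4 * d) / D"
  have d: "d \<ge> 1" by (simp add: d_def Suc_leI)
  have qp: "p < q" "p' < q" using assms by auto
  note bounds = exponent_bounds[OF d assms(6,7) qp(1) assms(9)[unfolded qbar_def], folded D_def, folded s_def[folded D_def]]
  have p: "p > 1" and D: "D > 0" and s: "0 < s" "s < 1" using bounds by auto
  have p': "p' > 1" "1 / p' = 1 - 1 / p" using p by (simp_all add: p'_def field_simps)
  have \<beta>: "\<beta> > 0" "\<gamma> > 0" using bounds D by (simp_all add: \<beta>_def \<gamma>_def)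
  have nz: "D \<noteq> 0" "p \<noteq> 0" "q \<noteq> 0" "4 * d + 2 \<noteq> 0" using D p qp d by auto
  note ids = exponent_identities[where d=d and p=p and q=q, folded D_def, OF nz,
      folded \<beta>_def \<gamma>_def s_def[folded D_def], folded \<alpha>_def]
  define e1 where "e1 = - 1 + (d - 1) * (1 / p - 1 / q)"
  define e2 where "e2 = 2 + (d - 1) * (1 / p' - 1 / q)"
  have e2: "e2 = \<alpha> * (D / p)" using ids(4) by (simp add: e2_def p'(2))
  have e21: "e2 - e1 = D / p" using ids(5) by (simp add: e1_def e2_def p'(2))
  \<comment> \<open>Strictness matters: either norm may vanish, and the powers with exponents
    \<open>\<alpha>\<close> and \<open>1 - \<alpha>\<close> have to be continuous at 0.\<close>
  have \<alpha>: "0 < \<alpha>" "\<alpha> < 1"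
  proof -
    have a: "\<alpha> = (3 * d + 1 - (d - 1) * s) / (4 * d + 2)" unfolding \<alpha>_def diff_divide_distrib[of "3 * d + 1"] by simp
    have "0 \<le> (d - 1) * s" "(d - 1) * s \<le> d - 1" using d s by (auto simp: mult_left_le)
    then show "0 < \<alpha>" "\<alpha> < 1" unfolding a using d by auto
  qed
  have "1 \<le> p" "1 \<le> p'" using p p' by auto
  from kinetic_increment_bound[where 'd='d, folded d_def, OF \<beta> ids(1) this qp s ids(2) ids(3)[folded p'(2)], folded e1_def e2_def]
  obtain C where C: "C > 0"
    "\<And>k A B h (f :: 'd pt \<Rightarrow> real) (G :: 'd pt \<Rightarrow> real^'d) (S :: 'd pt \<Rightarrow> real^'d).
      in_Lp 2 f \<Longrightarrow> in_Lp p G \<Longrightarrow> in_Lp p' S \<Longrightarrow> weak_grad_v f G \<Longrightarrow> kinetic_eq f S \<Longrightarrow>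
      enn2real (Lp_norm p G) < A \<Longrightarrow> enn2real (Lp_norm p' S) < B \<Longrightarrow> h \<noteq> 0 \<Longrightarrow>
      Lp_norm q (Delta_x h f) \<le> ennreal (C * (norm h powr s * (exp (k * e1) * A + exp (k * e2) * B)))"
    by blast
  show ?thesis
  \<comment> \<open>The factor 2 appears because the gradient and the source contribute equally once
    \<open>k\<close> is balanced.\<close>
  proof (intro exI[of _ "2 * C"] conjI allI impI)
    show "2 * C > 0" using C by simp
    fix f :: "'d pt \<Rightarrow> real" and G S0 :: "'d pt \<Rightarrow> real^'d"
    assume "in_Lp 2 f \<and> in_Lp p G \<and> weak_grad_v f G \<and> in_Lp p' S0 \<and> kinetic_eq f S0"
    then have H: "in_Lp 2 f" "in_Lp p G" "in_Lp p' S0" "weak_grad_v f G" "kinetic_eq f S0" by auto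
    define a where "a = enn2real (Lp_norm p G)"
    define b where "b = enn2real (Lp_norm p' S0)"
    have ab: "a \<ge> 0" "b \<ge> 0" by (simp_all add: a_def b_def)
    show "besov_x s q f \<le> ennreal (2 * C * enn2real (Lp_norm p G) powr \<alpha> * enn2real (Lp_norm p' S0) powr (1 - \<alpha>))"
      unfolding besov_x_def a_def[symmetric] b_def[symmetric]
    proof (rule SUP_least)
      fix h :: "real^'d" assume "h \<in> UNIV - {0}"
      then have h: "h \<noteq> 0" by simp
      have strict: "Lp_norm q (Delta_x h f) \<le> ennreal (C * (norm h powr s * (2 * (A powr \<alpha> * B powr (1 - \<alpha>)))))"
        if AB: "A > a" "B > b" for A B
      proof -
        have pos: "A > 0" "B > 0" using AB ab by auto
        \<comment> \<open>This choice of the free scaling parameter balances the two contributions.\<close>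
        define k where "k = (ln A - ln B) / (D / p)"
        have "k * (D / p) = ln A - ln B" using D p by (simp add: k_def)
        then have k2: "k * e2 = \<alpha> * (ln A - ln B)" unfolding e2 by (metis mult.left_commute)
        have k1: "k * e1 = (\<alpha> - 1) * (ln A - ln B)"
        proof -
          have "k * e1 = k * e2 - k * (D / p)" unfolding e21[symmetric] by (simp add: algebra_simps)
          then show ?thesis unfolding k2 \<open>k * (D / p) = ln A - ln B\<close> by (simp add: algebra_simps)
        qed
        have "exp (k * e1) * A = exp (\<alpha> * ln A + (1 - \<alpha>) * ln B)"
        proof -
          have "exp (k * e1) * A = exp (k * e1 + ln A)" using pos by (simp add: exp_add)
          then show ?thesis unfolding k1 by (simp add: algebra_simps)
        qed
        moreover have "exp (k * e2) * B = exp (\<alpha> * ln A + (1 - \<alpha>) * ln B)"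
        proof -
          have "exp (k * e2) * B = exp (k * e2 + ln B)" using pos by (simp add: exp_add)
          then show ?thesis unfolding k2 by (simp add: algebra_simps)
        qed
        moreover have "exp (\<alpha> * ln A + (1 - \<alpha>) * ln B) = A powr \<alpha> * B powr (1 - \<alpha>)"
          using pos by (simp add: powr_def exp_add)
        ultimately have "exp (k * e1) * A + exp (k * e2) * B = 2 * (A powr \<alpha> * B powr (1 - \<alpha>))" by simp
        then show ?thesis using C(2)[OF H, of A B h k] AB h by (simp add: a_def b_def)
      qed
      have "Lp_norm q (Delta_x h f) \<le> ennreal (C * (norm h powr s * (2 * (a powr \<alpha> * b powr (1 - \<alpha>)))))"
      \<comment> \<open>The balanced bound needs positive \<open>A\<close> and \<open>B\<close>
        strictly above the norms; letting them decrease to \<open>a\<close> and \<open>b\<close>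
        includes vanishing norms.\<close>
      proof (rule LIMSEQ_le_const)
        have inv: "(\<lambda>n. c + inverse (real (Suc n))) \<longlonglongrightarrow> c" for c
          using tendsto_add[OF tendsto_const LIMSEQ_inverse_real_of_nat] by simp
        have "(\<lambda>n. (a + inverse (real (Suc n))) powr \<alpha>) \<longlonglongrightarrow> a powr \<alpha>"
          using \<alpha> ab by (intro tendsto_powr2 inv tendsto_const) auto
        moreover have "(\<lambda>n. (b + inverse (real (Suc n))) powr (1 - \<alpha>)) \<longlonglongrightarrow> b powr (1 - \<alpha>)"
          using \<alpha> ab by (intro tendsto_powr2 inv tendsto_const) auto
        ultimately show "(\<lambda>n. ennreal (C * (norm h powr s * (2 * ((a + inverse (real (Suc n))) powr \<alpha> * (b + inverse (real (Suc n))) powr (1 - \<alpha>))))))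
          \<longlonglongrightarrow> ennreal (C * (norm h powr s * (2 * (a powr \<alpha> * b powr (1 - \<alpha>)))))"
          by (intro tendsto_ennrealI tendsto_mult tendsto_const)
        show "\<exists>N. \<forall>n\<ge>N. Lp_norm q (Delta_x h f) \<le> ennreal (C * (norm h powr s * (2 * ((a + inverse (real (Suc n))) powr \<alpha> * (b + inverse (real (Suc n))) powr (1 - \<alpha>)))))"
          by (intro exI allI impI strict) auto
      qed
      then have "Lp_norm q (Delta_x h f) / ennreal (norm h powr s) \<le> ennreal (C * (norm h powr s * (2 * (a powr \<alpha> * b powr (1 - \<alpha>))))) / ennreal (norm h powr s)"
        by (rule divide_right_mono_ennreal)
      also have "\<dots> = ennreal (2 * C * a powr \<alpha> * b powr (1 - \<alpha>))"
        using h C(1) by (simp add: divide_ennreal)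
      finally show "Lp_norm q (Delta_x h f) / ennreal (norm h powr s) \<le> ennreal (2 * C * a powr \<alpha> * b powr (1 - \<alpha>))" .
    qed
  qed
qed

end
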